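(* Let $d\ge 2$, $\gamma>0$, $\Omega=[0,1]^d$. Fix $H$ with $1/H\in\mathbb{N}$, let $0<h\le H$, and choose the coefficient $a(x)=W_{\gamma,H}(x)$, where $$W_{\gamma,H}(x)=\left(\frac{H}{\mathsf{d}(x,X^H)}\right)^{d-2+\gamma},$$ $X^H$ is the set of centers of the cubes $\omega_i^H$, $i\in I$, and $\mathsf{d}(x,X^H)$ is the Euclidean distance from $x$ to $X^H$. With the ideal-solution errors $e_0^{h,H,\infty}(a,u)$, $e_1^{h,H,\infty}(a,u)$ and the relation $\lesssim$ as defined in the context, the following results hold for $u\in H_0^1(\Omega)$. 1. If $\|u\|_{H_a^1(\Omega)}<\infty$, then $$e_0^{h,H,\infty}(a,u)\lesssim C(\gamma)H\|u\|_{H_a^1(\Omega)}.$$ 2. If $-\nabla\cdot(a\nabla u)=f\in L^2(\Omega)$, then $$e_1^{h,H,\infty}(a,u)\lesssim C(\gamma)H\|f\|_{L^2(\Omega)}\quad\text{and}\quad e_0^{h,H,\infty}(a,u)\lesssim C(\gamma)H^2\|f\|_{L^2(\Omega)}.$$ Here $C(\gamma)$ represents a positive constant that depends on $\gamma$ only, and whose value may vary from place to place.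
   Context: $[\cdot,\cdot]$ is the $L^2(\Omega)$ inner product and $\|v\|_{H_a^1(\Omega)}^2=\int_\Omega a|\nabla v|^2$. $\Omega=[0,1]^d$ is decomposed uniformly into closed cubes $\omega_i^H$, $i\in I$, of side length $H$, so $|I|=1/H^d$. For each $i\in I$, $\omega_i^{h,H}\subset\omega_i^H$ is the closed cube of side length $h$ with the same center as $\omega_i^H$, and $\phi_i^{h,H}=h^{-d}\mathbf 1_{\omega_i^{h,H}}$ is the $L^1$-normalized indicator function of $\omega_i^{h,H}$. The basis function $\psi_i^{h,H}$ is the minimizer of $\|\psi\|_{H_a^1(\Omega)}^2$ over $\psi\in H_0^1(\Omega)$ subject to $[\psi,\phi_j^{h,H}]=\delta_{i,j}$ for all $j\in I$. The ideal solution is $\mathsf{P}^{h,H}u=\sum_{i\in I}[u,\phi_i^{h,H}]\psi_i^{h,H}$, and its errors are $e_1^{h,H,\infty}(a,u)=\|u-\mathsf{P}^{h,H}u\|_{H_a^1(\Omega)}$ and $e_0^{h,H,\infty}(a,u)=\|u-\mathsf{P}^{h,H}u\|_{L^2(\Omega)}$. The equation $-\nabla\cdot(a\nabla u)=f$ with $u=0$ on $\partial\Omega$ is understood in the weak (energy) sense: $\|u\|_{H_a^1(\Omega)}<\infty$ and $\int_\Omega a\nabla u\cdot\nabla v=\int_\Omega fv$ for all $v\in H_0^1(\Omega)$ with $\|v\|_{H_a^1(\Omega)}<\infty$. $A\lesssim B$ means $A\le CB$ for a constant $C$ independent of $h$, $H$ and $u$ (it may depend on $d$). *)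

theory Defs
  imports "HOL-Analysis.Analysis"
begin

section \<open>The space \<open>L\<^sup>2(\<Omega>)\<close>\<close>

definition Omega :: "(real ^ 'n) set" (\<open>\<Omega>\<close>) where
  "\<Omega> = cbox 0 1"

text \<open>Elements of function spaces are represented by functions on the whole of \<open>real ^ 'n\<close>;
  only their restriction to \<open>\<Omega>\<close> matters, and only up to null sets.\<close>

definition L2 :: "(real ^ 'n \<Rightarrow> 'b::euclidean_space) set" where
  "L2 = {f. f \<in> borel_measurable (lebesgue_on \<Omega>) \<and>
            integrable (lebesgue_on \<Omega>) (\<lambda>x. (norm (f x))\<^sup>2)}"

definition L2_inner :: "(real ^ 'n \<Rightarrow> real) \<Rightarrow> (real ^ 'n \<Rightarrow> real) \<Rightarrow> real" where
  "L2_inner u v = (LINT x|lebesgue_on \<Omega>. u x * v x)"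

text \<open>All norms take values in \<open>[0, \<infinity>]\<close>, so that a norm bound by a finite quantity contains the
  claim that the norm is finite.\<close>

definition ennreal_sqrt :: "ennreal \<Rightarrow> ennreal" where
  "ennreal_sqrt x = (if x = \<infinity> then \<infinity> else ennreal (sqrt (enn2real x)))"

definition L2_norm :: "(real ^ 'n \<Rightarrow> 'b::euclidean_space) \<Rightarrow> ennreal" where
  "L2_norm f = ennreal_sqrt (\<integral>\<^sup>+ x. ennreal ((norm (f x))\<^sup>2) \<partial>lebesgue_on \<Omega>)"

section \<open>The spaces \<open>H\<^sup>1(\<Omega>)\<close> and \<open>H\<^sup>1\<^sub>0(\<Omega>)\<close>\<close>

primrec C_k :: "nat \<Rightarrow> (real ^ 'n \<Rightarrow> real) \<Rightarrow> bool" where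
  "C_k 0 f \<longleftrightarrow> continuous_on UNIV f"
| "C_k (Suc k) f \<longleftrightarrow> (\<exists>G. (\<forall>x. GDERIV f x :> G x) \<and> (\<forall>j. C_k k (\<lambda>x. G x $ j)))"

definition test_functions :: "(real ^ 'n \<Rightarrow> real) set" where
  "test_functions =
    {\<phi>. (\<forall>k. C_k k \<phi>) \<and> compact (closure {x. \<phi> x \<noteq> 0}) \<and> closure {x. \<phi> x \<noteq> 0} \<subseteq> interior \<Omega>}"

definition is_weak_grad :: "(real ^ 'n \<Rightarrow> real) \<Rightarrow> (real ^ 'n \<Rightarrow> real ^ 'n) \<Rightarrow> bool" where
  "is_weak_grad u g \<longleftrightarrow> g \<in> L2 \<and>
    (\<forall>\<phi>\<in>test_functions. \<forall>G. (\<forall>x. GDERIV \<phi> x :> G x) \<longrightarrow>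
      (LINT x|lebesgue_on \<Omega>. u x *\<^sub>R G x) = - (LINT x|lebesgue_on \<Omega>. \<phi> x *\<^sub>R g x))"

definition H1 :: "(real ^ 'n \<Rightarrow> real) set" where
  "H1 = {u \<in> L2. \<exists>g. is_weak_grad u g}"

text \<open>For \<open>u \<in> H1\<close> the weak gradient is unique up to null sets.\<close>

definition weak_grad :: "(real ^ 'n \<Rightarrow> real) \<Rightarrow> real ^ 'n \<Rightarrow> real ^ 'n" where
  "weak_grad u = (SOME g. is_weak_grad u g)"

definition H1_norm :: "(real ^ 'n \<Rightarrow> real) \<Rightarrow> ennreal" where
  "H1_norm u = ennreal_sqrt ((L2_norm u)\<^sup>2 + (L2_norm (weak_grad u))\<^sup>2)"

text \<open>The closure of the test functions in \<open>H1\<close>.\<close>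

definition H10 :: "(real ^ 'n \<Rightarrow> real) set" where
  "H10 = {u \<in> H1. \<forall>\<epsilon>>0. \<exists>\<phi>\<in>test_functions. H1_norm (\<lambda>x. u x - \<phi> x) < ennreal \<epsilon>}"

definition energy_norm :: "(real ^ 'n \<Rightarrow> real) \<Rightarrow> (real ^ 'n \<Rightarrow> real) \<Rightarrow> ennreal" where
  "energy_norm a v =
    ennreal_sqrt (\<integral>\<^sup>+ x. ennreal (a x * (norm (weak_grad v x))\<^sup>2) \<partial>lebesgue_on \<Omega>)"

definition weak_solution ::
    "(real ^ 'n \<Rightarrow> real) \<Rightarrow> (real ^ 'n \<Rightarrow> real) \<Rightarrow> (real ^ 'n \<Rightarrow> real) \<Rightarrow> bool" where
  "weak_solution a f u \<longleftrightarrow> u \<in> H10 \<and> energy_norm a u < \<infinity> \<and>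
    (\<forall>v\<in>H10. energy_norm a v < \<infinity> \<longrightarrow>
      (LINT x|lebesgue_on \<Omega>. a x * (weak_grad u x \<bullet> weak_grad v x)) = L2_inner f v)"

section \<open>Subsampled data and the ideal solution\<close>

text \<open>The cubes of side \<open>H\<close> are indexed by \<open>i \<in> {0, \<dots>, 1/H - 1}\<^sup>d\<close>.\<close>

definition indices :: "real \<Rightarrow> (nat ^ 'n) set" where
  "indices H = {i. \<forall>k. real (i $ k) < 1 / H}"

definition center :: "real \<Rightarrow> nat ^ 'n \<Rightarrow> real ^ 'n" where
  "center H i = (\<chi> k. (real (i $ k) + 1 / 2) * H)"

text \<open>\<open>subcube H H i\<close> is the full cube of the decomposition.\<close>

definition subcube :: "real \<Rightarrow> real \<Rightarrow> nat ^ 'n \<Rightarrow> (real ^ 'n) set" where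
  "subcube h H i = cbox (center H i - (\<chi> k. h / 2)) (center H i + (\<chi> k. h / 2))"

definition measurement :: "real \<Rightarrow> real \<Rightarrow> nat ^ 'n \<Rightarrow> real ^ 'n \<Rightarrow> real" where
  "measurement h H i = (\<lambda>x. indicator (subcube h H i) x / h ^ CARD('n))"

definition basis_function ::
    "(real ^ 'n \<Rightarrow> real) \<Rightarrow> real \<Rightarrow> real \<Rightarrow> nat ^ 'n \<Rightarrow> real ^ 'n \<Rightarrow> real" where
  "basis_function a h H i =
    arg_min (\<lambda>\<psi>. (energy_norm a \<psi>)\<^sup>2)
      (\<lambda>\<psi>. \<psi> \<in> H10 \<and>
        (\<forall>j\<in>indices H. L2_inner \<psi> (measurement h H j) = (if i = j then 1 else 0)))"

definition ideal_solution ::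
    "(real ^ 'n \<Rightarrow> real) \<Rightarrow> real \<Rightarrow> real \<Rightarrow> (real ^ 'n \<Rightarrow> real) \<Rightarrow> real ^ 'n \<Rightarrow> real" where
  "ideal_solution a h H u =
    (\<lambda>x. \<Sum>i\<in>indices H. L2_inner u (measurement h H i) * basis_function a h H i x)"

definition error1 :: "(real ^ 'n \<Rightarrow> real) \<Rightarrow> real \<Rightarrow> real \<Rightarrow> (real ^ 'n \<Rightarrow> real) \<Rightarrow> ennreal" where
  "error1 a h H u = energy_norm a (\<lambda>x. u x - ideal_solution a h H u x)"

definition error0 :: "(real ^ 'n \<Rightarrow> real) \<Rightarrow> real \<Rightarrow> real \<Rightarrow> (real ^ 'n \<Rightarrow> real) \<Rightarrow> ennreal" where
  "error0 a h H u = L2_norm (\<lambda>x. u x - ideal_solution a h H u x)"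

section \<open>The weight\<close>

text \<open>At the centers themselves, a null set, the weight should be \<open>\<infinity>\<close>; here it is \<open>0\<close> because
  \<open>H / 0 = 0\<close>.\<close>

definition weight :: "real \<Rightarrow> real \<Rightarrow> real ^ 'n \<Rightarrow> real" where
  "weight \<gamma> H x = (H / infdist x (center H ` indices H)) powr (real CARD('n) - 2 + \<gamma>)"

end

theory Submission
  imports Defs "HOL-Computational_Algebra.Polynomial"
begin

text \<open>
  The theorem rests on a Poincare inequality with the singular weight \<open>a\<close> (\<open>weighted_Poincare\<close>): if \<open>v\<close> in
  \<open>H\<^sup>1\<^sub>0\<close> has finite energy and its mean over each subsampled cube of side \<open>h\<close> vanishes, then
  \<open>\<parallel>v\<parallel>\<^sup>2 \<le> C * H\<^sup>2 * \<parallel>v\<parallel>\<^sub>a\<^sup>2\<close>, where \<open>\<parallel>v\<parallel>\<close> is the \<open>L\<^sup>2\<close> norm, \<open>\<parallel>v\<parallel>\<^sub>a\<close> the energy norm, and \<open>C\<close> does not depend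
  on \<open>h\<close> and \<open>H\<close>.

  Given this inequality, the estimates are geometry in the energy inner product
  (\<open>ideal_solution_decomposition\<close>). The error \<open>w = u - P u\<close> has zero measurements and, since every basis
  function minimizes the energy under its constraints, \<open>w\<close> is orthogonal in energy to \<open>P u\<close>. Therefore
  \<open>\<parallel>w\<parallel>\<^sub>a \<le> \<parallel>u\<parallel>\<^sub>a\<close>, and the inequality for \<open>w\<close> bounds the \<open>L\<^sup>2\<close> error. If \<open>u\<close> solves the equation with right-hand
  side \<open>f\<close>, then \<open>\<parallel>w\<parallel>\<^sub>a\<^sup>2\<close> is the energy product of \<open>u\<close> and \<open>w\<close>, that is \<open>[f, w]\<close>, which is at most
  \<open>\<parallel>f\<parallel> * \<parallel>w\<parallel> \<le> sqrt C * H * \<parallel>f\<parallel> * \<parallel>w\<parallel>\<^sub>a\<close>; cancelling \<open>\<parallel>w\<parallel>\<^sub>a\<close> gives the energy estimate, and the inequality for \<open>w\<close>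
  once more gives the \<open>L\<^sup>2\<close> estimate.

  The inequality is uniform in \<open>h\<close> for the following reason. In one grid cube, consider the concentric cubes of
  side \<open>t \<le> H\<close>. By the unweighted Poincare inequality, the squared difference of the means of \<open>v\<close> over two such
  cubes with comparable sides is at most a multiple of \<open>t\<close> to the power \<open>2 - d\<close> times the unweighted energy in the
  larger one. The weight there is at least of order \<open>(H / t)\<close> to the power \<open>d - 2 + \<gamma>\<close>, so this is at most a
  multiple of \<open>H\<close> to the power \<open>2 - d\<close>, times \<open>(t / H)\<close> to the power \<open>\<gamma>\<close>, times the weighted energy (\<open>avg_step\<close>). The
  square roots form a geometric series as \<open>t\<close> runs through \<open>H\<close>, \<open>H / 2\<close>, \<open>H / 4\<close> and so on, so the means at the scales
  \<open>h\<close> and \<open>H\<close> differ by an amount bounded independently of \<open>h\<close> (\<open>telescope_halving\<close>, \<open>cube_Poincare\<close>).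

  The same inequality yields the existence of the energy minimizers by the direct method
  (\<open>energy_minimizer_exists\<close>): a minimizing sequence is Cauchy in energy, hence in \<open>L\<^sup>2\<close>. This needs completeness of
  \<open>L\<^sup>2\<close> (\<open>L2_complete_rapid\<close>) and one competitor of finite energy (\<open>dual_bump_exists\<close>).

  The Sobolev space enters through approximation by test functions. The unweighted Poincare inequality is proved
  for these by integrating along segments and then passed to the limit; the energy itself is well defined because
  weak gradients are unique almost everywhere (\<open>is_weak_grad_unique\<close>).
\<close>

section \<open>Square-integrable functions on the unit cube\<close>

text \<open>The inner product of \<^const>\<open>L2_inner\<close> for functions with values in any Euclidean space, so that
  functions and gradient fields are treated alike.\<close>

definition ip :: "(real ^ 'n \<Rightarrow> 'b::euclidean_space) \<Rightarrow> (real ^ 'n \<Rightarrow> 'b) \<Rightarrow> real" where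
  "ip f g = (LINT x|lebesgue_on \<Omega>. f x \<bullet> g x)"

abbreviation sqnorm :: "(real ^ 'n \<Rightarrow> 'b::euclidean_space) \<Rightarrow> real" where
  "sqnorm f \<equiv> ip f f"

abbreviation sqnorm_on :: "(real ^ 'n) set \<Rightarrow> (real ^ 'n \<Rightarrow> 'b::euclidean_space) \<Rightarrow> real" where
  "sqnorm_on Q f \<equiv> ip (\<lambda>x. indicator Q x *\<^sub>R f x) f"

lemma lmeasurable_Omega: "(\<Omega> :: (real ^ 'n) set) \<in> lmeasurable"
  by (simp add: Omega_def)

lemma finite_measure_Omega: "finite_measure (lebesgue_on (\<Omega> :: (real ^ 'n) set))"
  using lmeasurable_Omega by (rule finite_measure_lebesgue_on)

lemma L2_iff:
  "f \<in> L2 \<longleftrightarrow> f \<in> borel_measurable (lebesgue_on \<Omega>) \<and> integrable (lebesgue_on \<Omega>) (\<lambda>x. f x \<bullet> f x)"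
  by (simp add: L2_def power2_norm_eq_inner)

lemma L2_measurable: "f \<in> L2 \<Longrightarrow> f \<in> borel_measurable (lebesgue_on \<Omega>)"
  by (simp add: L2_def)

lemma L2_integrable_inner:
  assumes "f \<in> L2" "g \<in> L2"
  shows "integrable (lebesgue_on \<Omega>) (\<lambda>x. f x \<bullet> g x)"
proof (rule Bochner_Integration.integrable_bound)
  show "integrable (lebesgue_on \<Omega>) (\<lambda>x. f x \<bullet> f x + g x \<bullet> g x)"
    using assms by (auto simp: L2_iff)
  show "(\<lambda>x. f x \<bullet> g x) \<in> borel_measurable (lebesgue_on \<Omega>)"
    using assms[THEN L2_measurable] by measurable
  have "\<bar>f x \<bullet> g x\<bar> \<le> f x \<bullet> f x + g x \<bullet> g x" for x
  proof -
    have "0 \<le> (f x + g x) \<bullet> (f x + g x)" "0 \<le> (f x - g x) \<bullet> (f x - g x)"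
      by (rule inner_ge_zero)+
    moreover have "0 \<le> f x \<bullet> f x" "0 \<le> g x \<bullet> g x"
      by (rule inner_ge_zero)+
    ultimately show ?thesis
      by (simp add: inner_simps inner_commute[of "g x" "f x"])
  qed
  then show "AE x in lebesgue_on \<Omega>. norm (f x \<bullet> g x) \<le> norm (f x \<bullet> f x + g x \<bullet> g x)"
    by (auto simp: intro!: AE_I2 order_trans[OF _ abs_ge_self])
qed

lemma L2_add: "f \<in> L2 \<Longrightarrow> g \<in> L2 \<Longrightarrow> (\<lambda>x. f x + g x) \<in> L2"
  using L2_integrable_inner[of f g]
  by (auto simp: L2_iff inner_simps inner_commute[of "g _" "f _"] simp flip: mult_2)

lemma L2_scale: "f \<in> L2 \<Longrightarrow> (\<lambda>x. c *\<^sub>R f x) \<in> L2"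
  by (auto simp: L2_iff)

lemma L2_diff: "f \<in> L2 \<Longrightarrow> g \<in> L2 \<Longrightarrow> (\<lambda>x. f x - g x) \<in> L2"
  using L2_add[of f "\<lambda>x. (-1) *\<^sub>R g x"] L2_scale[of g "-1"] by simp

lemma L2_zero: "(\<lambda>x. 0) \<in> L2"
  by (auto simp: L2_iff)

lemma L2_bounded_mult:
  assumes "f \<in> L2" "b \<in> borel_measurable (lebesgue_on \<Omega>)" "\<And>x. x \<in> \<Omega> \<Longrightarrow> \<bar>b x\<bar> \<le> K"
  shows "(\<lambda>x. b x *\<^sub>R f x) \<in> L2"
  unfolding L2_iff
proof safe
  show m: "(\<lambda>x. b x *\<^sub>R f x) \<in> borel_measurable (lebesgue_on \<Omega>)"
    using assms(2) assms(1)[THEN L2_measurable] by measurable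
  show "integrable (lebesgue_on \<Omega>) (\<lambda>x. b x *\<^sub>R f x \<bullet> b x *\<^sub>R f x)"
  proof (rule Bochner_Integration.integrable_bound)
    show "integrable (lebesgue_on \<Omega>) (\<lambda>x. K\<^sup>2 * (f x \<bullet> f x))"
      using assms by (auto simp: L2_iff)
    show "(\<lambda>x. b x *\<^sub>R f x \<bullet> b x *\<^sub>R f x) \<in> borel_measurable (lebesgue_on \<Omega>)"
      using m by measurable
    have "b x * b x * (f x \<bullet> f x) \<le> K\<^sup>2 * (f x \<bullet> f x)" if "x \<in> \<Omega>" for x
      using power_mono[OF assms(3)[OF that], of 2]
      by (intro mult_right_mono) (auto simp: power2_eq_square)
    then show "AE x in lebesgue_on \<Omega>. norm (b x *\<^sub>R f x \<bullet> b x *\<^sub>R f x) \<le> norm (K\<^sup>2 * (f x \<bullet> f x))"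
      by (auto simp: space_restrict_space abs_mult mult.assoc[symmetric] abs_mult_self_eq intro!: AE_I2)
  qed
qed

lemma L2_bounded:
  assumes "f \<in> borel_measurable (lebesgue_on \<Omega>)" "\<And>x. x \<in> \<Omega> \<Longrightarrow> norm (f x) \<le> K"
  shows "f \<in> L2"
  unfolding L2_def mem_Collect_eq
proof (intro conjI assms(1))
  interpret finite_measure "lebesgue_on (\<Omega> :: (real ^ 'n) set)"
    by (rule finite_measure_Omega)
  show "integrable (lebesgue_on \<Omega>) (\<lambda>x. (norm (f x))\<^sup>2)"
  proof (rule integrable_const_bound[where B = "K\<^sup>2"])
    show "AE x in lebesgue_on \<Omega>. norm ((norm (f x))\<^sup>2) \<le> K\<^sup>2"
      by (auto simp: space_restrict_space intro!: AE_I2 power_mono assms)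
  qed (use assms in measurable)
qed

lemma L2_AE_cong:
  assumes "f \<in> L2" "g \<in> borel_measurable (lebesgue_on \<Omega>)" "AE x in lebesgue_on \<Omega>. f x = g x"
  shows "g \<in> L2"
proof -
  have "integrable (lebesgue_on \<Omega>) (\<lambda>x. (norm (f x))\<^sup>2) \<longleftrightarrow> integrable (lebesgue_on \<Omega>) (\<lambda>x. (norm (g x))\<^sup>2)"
    using assms L2_measurable[OF assms(1)]
    by (intro integrable_cong_AE) (measurable, auto)
  then show ?thesis
    using assms by (simp add: L2_def)
qed

lemma ip_commute: "ip f g = ip g f"
  by (simp add: ip_def inner_commute)

lemma ip_add_left: "f \<in> L2 \<Longrightarrow> g \<in> L2 \<Longrightarrow> k \<in> L2 \<Longrightarrow> ip (\<lambda>x. f x + g x) k = ip f k + ip g k"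
  by (simp add: ip_def inner_simps L2_integrable_inner)

lemma ip_diff_left: "f \<in> L2 \<Longrightarrow> g \<in> L2 \<Longrightarrow> k \<in> L2 \<Longrightarrow> ip (\<lambda>x. f x - g x) k = ip f k - ip g k"
  by (simp add: ip_def inner_simps L2_integrable_inner)

lemma ip_scale_left: "ip (\<lambda>x. c *\<^sub>R f x) k = c * ip f k"
  by (simp add: ip_def)

lemma ip_add_right: "f \<in> L2 \<Longrightarrow> g \<in> L2 \<Longrightarrow> k \<in> L2 \<Longrightarrow> ip k (\<lambda>x. f x + g x) = ip k f + ip k g"
  by (simp add: ip_def inner_simps L2_integrable_inner)

lemma ip_diff_right: "f \<in> L2 \<Longrightarrow> g \<in> L2 \<Longrightarrow> k \<in> L2 \<Longrightarrow> ip k (\<lambda>x. f x - g x) = ip k f - ip k g"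
  by (simp add: ip_def inner_simps L2_integrable_inner)

lemma ip_scale_right: "ip k (\<lambda>x. c *\<^sub>R f x) = c * ip k f"
  by (simp add: ip_def)

lemmas ip_linear = ip_add_left ip_diff_left ip_scale_left ip_add_right ip_diff_right ip_scale_right
  L2_add L2_diff L2_scale

lemma ip_self_nonneg: "0 \<le> sqnorm f"
  by (simp add: ip_def)

lemma ip_AE_cong:
  assumes "f \<in> L2" "g \<in> L2" "f' \<in> L2" "g' \<in> L2"
    "AE x in lebesgue_on \<Omega>. f x = f' x" "AE x in lebesgue_on \<Omega>. g x = g' x"
  shows "ip f g = ip f' g'"
  unfolding ip_def
proof (rule integral_cong_AE)
  show "AE x in lebesgue_on \<Omega>. f x \<bullet> g x = f' x \<bullet> g' x"
    using assms(5,6) by eventually_elim simp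
qed (use assms(1-4)[THEN L2_measurable] in measurable)

text \<open>Used for the Cauchy--Schwarz inequality and, with \<open>a = 0\<close>, to derive orthogonality from minimality.\<close>

lemma quadratic_nonneg_imp_discriminant:
  fixes a b c :: real
  assumes "\<And>t. 0 \<le> a + 2 * t * b + t\<^sup>2 * c" "0 \<le> c"
  shows "b\<^sup>2 \<le> a * c"
proof (cases "c = 0")
  case True
  have "b = 0"
  proof (rule ccontr)
    assume "b \<noteq> 0"
    with assms(1)[of "-(a + 1) / (2 * b)"] True show False
      by (simp add: field_simps)
  qed
  with True show ?thesis by simp
next
  case False
  with assms have "c > 0" by simp
  have "0 \<le> c * (a + 2 * (- b / c) * b + (- b / c)\<^sup>2 * c)"
    using assms(1)[of "- b / c"] \<open>c > 0\<close> by (intro mult_nonneg_nonneg) auto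
  also have "\<dots> = a * c - b\<^sup>2"
    using \<open>c > 0\<close> by (simp add: field_simps power2_eq_square)
  finally show ?thesis by simp
qed

lemma ip_expand:
  assumes "f \<in> L2" "g \<in> L2"
  shows "sqnorm (\<lambda>x. f x + t *\<^sub>R g x) = sqnorm f + 2 * t * ip f g + t\<^sup>2 * sqnorm g"
  using assms by (simp add: ip_linear ip_commute[of g f] power2_eq_square algebra_simps)

lemma ip_Cauchy_Schwarz:
  assumes "f \<in> L2" "g \<in> L2"
  shows "(ip f g)\<^sup>2 \<le> sqnorm f * sqnorm g"
proof (rule quadratic_nonneg_imp_discriminant)
  show "0 \<le> sqnorm f + 2 * t * ip f g + t\<^sup>2 * sqnorm g" for t
    unfolding ip_expand[OF assms, symmetric] by (rule ip_self_nonneg)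
qed (rule ip_self_nonneg)

lemma ip_Cauchy_Schwarz_sqrt:
  assumes "f \<in> L2" "g \<in> L2"
  shows "\<bar>ip f g\<bar> \<le> sqrt (sqnorm f) * sqrt (sqnorm g)"
  using ip_Cauchy_Schwarz[OF assms] by (metis real_sqrt_abs real_sqrt_le_iff real_sqrt_mult)

lemma ip_self_add_le:
  assumes "f \<in> L2" "g \<in> L2"
  shows "sqnorm (\<lambda>x. f x + g x) \<le> 2 * sqnorm f + 2 * sqnorm g"
  using ip_expand[OF assms, of 1] ip_expand[OF assms, of "-1"]
    ip_self_nonneg[of "\<lambda>x. f x + (-1) *\<^sub>R g x"]
  by simp

lemma L2_norm_eq:
  assumes "f \<in> L2"
  shows "L2_norm f = ennreal (sqrt (sqnorm f))"
proof -
  have "(\<integral>\<^sup>+ x. ennreal ((norm (f x))\<^sup>2) \<partial>lebesgue_on \<Omega>) = ennreal (sqnorm f)"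
    unfolding ip_def power2_norm_eq_inner
    using assms by (intro nn_integral_eq_integral) (auto simp: L2_iff)
  then show ?thesis
    by (simp add: L2_norm_def ennreal_sqrt_def ip_self_nonneg)
qed

lemma ennreal_sqrt_less_top: "ennreal_sqrt x < \<infinity> \<longleftrightarrow> x < \<infinity>"
  by (simp add: ennreal_sqrt_def less_top)

lemma L2_norm_finite_iff:
  assumes "f \<in> borel_measurable (lebesgue_on \<Omega>)"
  shows "L2_norm f < \<infinity> \<longleftrightarrow> f \<in> L2"
  using assms by (simp add: L2_norm_def ennreal_sqrt_less_top[unfolded infinity_ennreal_def]
    L2_def integrable_iff_bounded)

definition L2lim :: "(nat \<Rightarrow> real ^ 'n \<Rightarrow> 'b::euclidean_space) \<Rightarrow> (real ^ 'n \<Rightarrow> 'b) \<Rightarrow> bool" where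
  "L2lim fs f \<longleftrightarrow> (\<forall>n. fs n \<in> L2) \<and> f \<in> L2 \<and>
     (\<lambda>n. sqnorm (\<lambda>x. fs n x - f x)) \<longlonglongrightarrow> 0"

lemma L2lim_ip_const:
  assumes "L2lim fs f" "g \<in> L2"
  shows "(\<lambda>n. ip (\<lambda>x. fs n x - f x) g) \<longlonglongrightarrow> 0"
proof (rule tendsto_rabs_zero_cancel, rule tendsto_sandwich[OF _ _ tendsto_const])
  let ?d = "\<lambda>n. sqnorm (\<lambda>x. fs n x - f x)"
  have "?d \<longlonglongrightarrow> 0" using assms by (simp add: L2lim_def)
  then have "(\<lambda>n. sqrt (?d n) * sqrt (sqnorm g)) \<longlonglongrightarrow> sqrt 0 * sqrt (sqnorm g)"
    by (intro tendsto_intros)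
  then show "(\<lambda>n. sqrt (?d n) * sqrt (sqnorm g)) \<longlonglongrightarrow> 0" by simp
  show "\<forall>\<^sub>F n in sequentially. \<bar>ip (\<lambda>x. fs n x - f x) g\<bar> \<le> sqrt (?d n) * sqrt (sqnorm g)"
    using assms by (auto simp: L2lim_def intro!: always_eventually ip_Cauchy_Schwarz_sqrt L2_diff)
qed auto

lemma L2lim_ip:
  assumes "L2lim fs f" "L2lim gs g"
  shows "(\<lambda>n. ip (fs n) (gs n)) \<longlonglongrightarrow> ip f g"
proof -
  let ?df = "\<lambda>n x. fs n x - f x" and ?dg = "\<lambda>n x. gs n x - g x"
  have mem: "\<And>n. fs n \<in> L2" "\<And>n. gs n \<in> L2" "f \<in> L2" "g \<in> L2"
    using assms by (auto simp: L2lim_def)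
  have "(\<lambda>n. ip (?df n) (?dg n)) \<longlonglongrightarrow> 0"
  proof (rule tendsto_rabs_zero_cancel, rule tendsto_sandwich[OF _ _ tendsto_const])
    have "(\<lambda>n. sqrt (sqnorm (?df n)) * sqrt (sqnorm (?dg n))) \<longlonglongrightarrow> sqrt 0 * sqrt 0"
      using assms by (intro tendsto_intros) (auto simp: L2lim_def)
    then show "(\<lambda>n. sqrt (sqnorm (?df n)) * sqrt (sqnorm (?dg n))) \<longlonglongrightarrow> 0" by simp
    show "\<forall>\<^sub>F n in sequentially. \<bar>ip (?df n) (?dg n)\<bar> \<le> sqrt (sqnorm (?df n)) * sqrt (sqnorm (?dg n))"
      using mem by (auto intro!: always_eventually ip_Cauchy_Schwarz_sqrt L2_diff)
  qed auto
  then have "(\<lambda>n. ip (?df n) (?dg n) + ip (?df n) g + ip (?dg n) f + ip f g) \<longlonglongrightarrow> 0 + 0 + 0 + ip f g"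
    using L2lim_ip_const[OF assms(1) mem(4)] L2lim_ip_const[OF assms(2) mem(3)]
    by (intro tendsto_intros)
  moreover have "ip (?df n) (?dg n) + ip (?df n) g + ip (?dg n) f + ip f g = ip (fs n) (gs n)" for n
    using mem by (simp add: ip_linear ip_commute[of _ f])
  ultimately show ?thesis by simp
qed

lemma L2lim_const: "f \<in> L2 \<Longrightarrow> L2lim (\<lambda>n. f) f"
  by (simp add: L2lim_def ip_def)

lemma L2lim_mem: "L2lim fs f \<Longrightarrow> f \<in> L2" "L2lim fs f \<Longrightarrow> fs n \<in> L2"
  by (auto simp: L2lim_def)

lemma L2limI:
  assumes "\<And>n. fs n \<in> L2" "f \<in> L2"
    "\<And>n. sqnorm (\<lambda>x. fs n x - f x) \<le> b n" "b \<longlonglongrightarrow> 0"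
  shows "L2lim fs f"
  unfolding L2lim_def using assms
  by (auto intro!: tendsto_sandwich[OF _ _ tendsto_const assms(4)] always_eventually ip_self_nonneg)

lemma L2lim_add:
  assumes "L2lim fs f" "L2lim gs g"
  shows "L2lim (\<lambda>n x. fs n x + gs n x) (\<lambda>x. f x + g x)"
proof (rule L2limI)
  let ?df = "\<lambda>n x. fs n x - f x" and ?dg = "\<lambda>n x. gs n x - g x"
  have mem: "\<And>n. fs n \<in> L2" "\<And>n. gs n \<in> L2" "f \<in> L2" "g \<in> L2"
    using assms by (auto simp: L2lim_def)
  then show "(\<lambda>x. fs n x + gs n x) \<in> L2" "(\<lambda>x. f x + g x) \<in> L2" for n
    by (auto intro: L2_add)
  have "(\<lambda>n. 2 * sqnorm (?df n) + 2 * sqnorm (?dg n)) \<longlonglongrightarrow> 2 * 0 + 2 * 0"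
    using assms by (intro tendsto_intros) (auto simp: L2lim_def)
  then show "(\<lambda>n. 2 * sqnorm (?df n) + 2 * sqnorm (?dg n)) \<longlonglongrightarrow> 0" by simp
  show "sqnorm (\<lambda>x. fs n x + gs n x - (f x + g x))
      \<le> 2 * sqnorm (?df n) + 2 * sqnorm (?dg n)" for n
    using ip_self_add_le[OF L2_diff[OF mem(1,3), of n] L2_diff[OF mem(2,4), of n]]
    by (simp add: algebra_simps)
qed

lemma L2lim_bounded_mult:
  assumes "L2lim fs f" "b \<in> borel_measurable (lebesgue_on \<Omega>)" "\<And>x. x \<in> \<Omega> \<Longrightarrow> \<bar>b x\<bar> \<le> K"
  shows "L2lim (\<lambda>n x. b x *\<^sub>R fs n x) (\<lambda>x. b x *\<^sub>R f x)"
proof (rule L2limI)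
  let ?df = "\<lambda>n x. fs n x - f x"
  have mem: "\<And>n. fs n \<in> L2" "f \<in> L2"
    using assms by (auto simp: L2lim_def)
  show "(\<lambda>x. b x *\<^sub>R fs n x) \<in> L2" "(\<lambda>x. b x *\<^sub>R f x) \<in> L2" for n
    using mem assms by (auto intro: L2_bounded_mult)
  have "(\<lambda>n. K\<^sup>2 * sqnorm (?df n)) \<longlonglongrightarrow> K\<^sup>2 * 0"
    using assms by (intro tendsto_intros) (auto simp: L2lim_def)
  then show "(\<lambda>n. K\<^sup>2 * sqnorm (?df n)) \<longlonglongrightarrow> 0" by simp
  show "sqnorm (\<lambda>x. b x *\<^sub>R fs n x - b x *\<^sub>R f x)
      \<le> K\<^sup>2 * sqnorm (?df n)" for n
  proof -
    have d: "?df n \<in> L2" using mem by (auto intro: L2_diff)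
    have "(LINT x|lebesgue_on \<Omega>. b x *\<^sub>R ?df n x \<bullet> b x *\<^sub>R ?df n x)
      \<le> (LINT x|lebesgue_on \<Omega>. K\<^sup>2 * (?df n x \<bullet> ?df n x))"
    proof (rule integral_mono)
      show "integrable (lebesgue_on \<Omega>) (\<lambda>x. b x *\<^sub>R ?df n x \<bullet> b x *\<^sub>R ?df n x)"
        using L2_bounded_mult[OF d assms(2,3)] by (simp add: L2_iff)
      show "integrable (lebesgue_on \<Omega>) (\<lambda>x. K\<^sup>2 * (?df n x \<bullet> ?df n x))"
        using d unfolding L2_iff by auto
      show "b x *\<^sub>R ?df n x \<bullet> b x *\<^sub>R ?df n x \<le> K\<^sup>2 * (?df n x \<bullet> ?df n x)"
        if "x \<in> space (lebesgue_on \<Omega>)" for x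
        using power_mono[OF assms(3), of x 2] that
        by (auto simp: power2_eq_square space_restrict_space mult.assoc[symmetric] intro!: mult_right_mono)
    qed
    then show ?thesis by (simp add: ip_def scaleR_diff_right)
  qed
qed

lemma L2lim_scale: "L2lim fs f \<Longrightarrow> L2lim (\<lambda>n x. c *\<^sub>R fs n x) (\<lambda>x. c *\<^sub>R f x)"
  by (rule L2lim_bounded_mult[where K = "\<bar>c\<bar>"]) auto

text \<open>The Riesz--Fischer theorem. The increments of a rapidly Cauchy sequence have a convergent sum of \<open>L\<^sup>1\<close>
  norms, so the sequence converges almost everywhere; Fatou's lemma, applied to the differences with a fixed
  member, turns this into convergence in \<open>L\<^sup>2\<close>. Rapid convergence spares the passage to a subsequence, and
  the minimizing sequences below can be chosen with this rate.\<close>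

lemma L2_complete_rapid:
  fixes fs :: "nat \<Rightarrow> real ^ 'n \<Rightarrow> 'b::euclidean_space"
  assumes mem: "\<And>n. fs n \<in> L2"
    and cau: "\<And>m n. n \<le> m \<Longrightarrow> sqnorm (\<lambda>x. fs m x - fs n x) \<le> c * (1/4) ^ n"
  obtains f where "L2lim fs f"
proof -
  let ?M = "lebesgue_on (\<Omega> :: (real ^ 'n) set)"
  interpret finite_measure ?M by (rule finite_measure_Omega)
  have c: "c \<ge> 0"
    using cau[of 0 0] ip_self_nonneg[of "\<lambda>x. fs 0 x - fs 0 x"] by simp
  have meas[measurable]: "fs n \<in> borel_measurable ?M" for n
    using mem by (rule L2_measurable)
  define d where "d n x = norm (fs (Suc n) x - fs n x)" for n x
  have [measurable]: "d n \<in> borel_measurable ?M" for n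
    unfolding d_def by measurable
  have dL2: "d n \<in> L2" for n
    using L2_diff[OF mem mem, of "Suc n" n] by (simp add: L2_def) (simp add: d_def)
  have one: "(\<lambda>x. 1 :: real) \<in> (L2 :: (real ^ 'n \<Rightarrow> real) set)"
    by (rule L2_bounded[where K = 1]) auto
  define B where "B = sqrt (ip (\<lambda>x :: real ^ 'n. 1 :: real) (\<lambda>x. 1))"
  have int_d: "integrable ?M (d n)" for n
    using L2_integrable_inner[OF dL2 one] by simp
  have le_d: "(LINT x|?M. d n x) \<le> sqrt c * B * (1/2) ^ n" for n
  proof -
    have "(LINT x|?M. d n x) = ip (d n) (\<lambda>x. 1)" by (simp add: ip_def)
    also have "\<dots> \<le> sqrt (sqnorm (d n)) * B"
      unfolding B_def using ip_Cauchy_Schwarz_sqrt[OF dL2 one] by (rule order_trans[OF abs_ge_self])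
    also have "sqnorm (d n) \<le> c * (1/4) ^ n"
      using cau[of n "Suc n"]
      by (simp add: ip_def d_def power2_norm_eq_inner flip: power2_eq_square)
    also have "sqrt (c * (1/4) ^ n) = sqrt c * (1/2) ^ n"
      by (simp add: real_sqrt_mult real_sqrt_power real_sqrt_divide)
    finally show ?thesis
      by (simp add: B_def ip_self_nonneg mult_right_mono mult.commute mult.left_commute)
  qed
  have "AE x in ?M. (\<Sum>n. ennreal (d n x)) \<noteq> \<infinity>"
  proof (rule nn_integral_PInf_AE)
    show "(\<lambda>x. \<Sum>n. ennreal (d n x)) \<in> borel_measurable ?M"
      unfolding d_def by measurable
    have "(\<integral>\<^sup>+x. (\<Sum>n. ennreal (d n x)) \<partial>?M) = (\<Sum>n. \<integral>\<^sup>+x. ennreal (d n x) \<partial>?M)"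
      by (rule nn_integral_suminf) (simp add: d_def)
    also have "\<dots> = (\<Sum>n. ennreal (LINT x|?M. d n x))"
      by (intro suminf_cong nn_integral_eq_integral int_d) (simp add: d_def)
    also have "\<dots> \<le> (\<Sum>n. ennreal (sqrt c * B * (1/2) ^ n))"
      by (intro suminf_le ennreal_leI le_d) auto
    also have "\<dots> = ennreal (\<Sum>n. sqrt c * B * (1/2) ^ n)"
      by (intro suminf_ennreal2 summable_mult summable_geometric mult_nonneg_nonneg)
        (auto simp: c B_def ip_self_nonneg)
    also have "\<dots> < \<infinity>" by simp
    finally show "(\<integral>\<^sup>+x. (\<Sum>n. ennreal (d n x)) \<partial>?M) \<noteq> \<infinity>" by simp
  qed
  then have "AE x in ?M. convergent (\<lambda>n. fs n x)"
  proof eventually_elim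
    case (elim x)
    have "summable (\<lambda>n. d n x)"
      by (rule summable_suminf_not_top) (use elim in \<open>auto simp: d_def\<close>)
    then have "summable (\<lambda>n. fs (Suc n) x - fs n x)"
      unfolding d_def by (rule summable_norm_cancel)
    then have "convergent (\<lambda>n. \<Sum>i<n. fs (Suc i) x - fs i x)"
      by (simp add: summable_iff_convergent)
    then have "convergent (\<lambda>n. fs n x - fs 0 x)"
      by (simp add: sum_lessThan_telescope[of "\<lambda>i. fs i x"])
    then show ?case
      using convergent_diff_const_right_iff[of "\<lambda>n. fs n x" "fs 0 x"] by simp
  qed
  then have lim: "AE x in ?M. (\<lambda>n. fs n x) \<longlonglongrightarrow> lim (\<lambda>n. fs n x)"
    by (simp add: convergent_LIMSEQ_iff)
  define f where "f x = lim (\<lambda>n. fs n x)" for x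
  have f[measurable]: "f \<in> borel_measurable ?M"
    unfolding f_def by (rule borel_measurable_lim_metric) measurable
  have fatou: "(\<integral>\<^sup>+x. ennreal ((norm (fs n x - f x))\<^sup>2) \<partial>?M) \<le> ennreal (c * (1/4) ^ n)" for n
  proof -
    have "(\<integral>\<^sup>+x. ennreal ((norm (fs n x - f x))\<^sup>2) \<partial>?M) \<le>
        (\<integral>\<^sup>+x. liminf (\<lambda>m. ennreal ((norm (fs n x - fs m x))\<^sup>2)) \<partial>?M)"
    proof (rule nn_integral_mono_AE)
      show "AE x in ?M. ennreal ((norm (fs n x - f x))\<^sup>2) \<le> liminf (\<lambda>m. ennreal ((norm (fs n x - fs m x))\<^sup>2))"
        using lim
      proof eventually_elim
        case (elim x)
        have "(\<lambda>m. ennreal ((norm (fs n x - fs m x))\<^sup>2)) \<longlonglongrightarrow> ennreal ((norm (fs n x - f x))\<^sup>2)"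
          using elim unfolding f_def by (intro tendsto_intros)
        then show ?case
          by (intro order_eq_refl lim_imp_Liminf[symmetric]) auto
      qed
    qed
    also have "\<dots> \<le> liminf (\<lambda>m. \<integral>\<^sup>+x. ennreal ((norm (fs n x - fs m x))\<^sup>2) \<partial>?M)"
      by (rule nn_integral_liminf) measurable
    also have "\<dots> \<le> liminf (\<lambda>m::nat. ennreal (c * (1/4) ^ n))"
    proof (rule Liminf_mono)
      have "(\<integral>\<^sup>+x. ennreal ((norm (fs n x - fs m x))\<^sup>2) \<partial>?M) \<le> ennreal (c * (1/4) ^ n)" if "m \<ge> n" for m
      proof -
        have "(\<integral>\<^sup>+x. ennreal ((norm (fs n x - fs m x))\<^sup>2) \<partial>?M)
            = ennreal (sqnorm (\<lambda>x. fs n x - fs m x))"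
          unfolding ip_def power2_norm_eq_inner
          using L2_diff[OF mem mem] by (intro nn_integral_eq_integral) (auto simp: L2_iff)
        also have "sqnorm (\<lambda>x. fs n x - fs m x)
            = sqnorm (\<lambda>x. fs m x - fs n x)"
          unfolding ip_def by (simp add: norm_minus_commute flip: power2_norm_eq_inner)
        finally show ?thesis
          using cau[OF that] by (simp add: ennreal_leI)
      qed
      then show "\<forall>\<^sub>F m in sequentially. (\<integral>\<^sup>+x. ennreal ((norm (fs n x - fs m x))\<^sup>2) \<partial>?M) \<le> ennreal (c * (1/4) ^ n)"
        using eventually_ge_at_top[of n] by (rule eventually_mono[rotated])
    qed
    also have "\<dots> = ennreal (c * (1/4) ^ n)" by (simp add: Liminf_const)
    finally show ?thesis .
  qed
  have diffL2: "(\<lambda>x. fs n x - f x) \<in> L2" for n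
  proof -
    have "integrable ?M (\<lambda>x. (norm (fs n x - f x))\<^sup>2)"
      unfolding integrable_iff_bounded using fatou[of n] by (auto simp: less_top[symmetric] top_unique)
    then show ?thesis by (simp add: L2_def)
  qed
  have fL2: "f \<in> L2"
    using L2_diff[OF mem diffL2, of 0 0] by simp
  have "L2lim fs f"
  proof (rule L2limI[OF mem fL2])
    have "(\<lambda>n. c * (1/4) ^ n) \<longlonglongrightarrow> c * 0" by (intro tendsto_intros LIMSEQ_power_zero) auto
    then show "(\<lambda>n. c * (1/4) ^ n) \<longlonglongrightarrow> 0" by simp
    show "sqnorm (\<lambda>x. fs n x - f x) \<le> c * (1/4) ^ n" for n
    proof -
      have "(\<integral>\<^sup>+x. ennreal ((norm (fs n x - f x))\<^sup>2) \<partial>?M)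
            = ennreal (sqnorm (\<lambda>x. fs n x - f x))"
        unfolding ip_def power2_norm_eq_inner
        using diffL2 by (intro nn_integral_eq_integral) (auto simp: L2_iff)
      with fatou[of n] show ?thesis
        using c by (simp add: ip_self_nonneg)
    qed
  qed
  then show ?thesis by (rule that)
qed

section \<open>Smooth bumps\<close>

lemma GDERIV_unique:
  assumes "GDERIV f x :> a" "GDERIV f x :> b"
  shows "a = b"
proof -
  have "(\<lambda>h. h \<bullet> a) = (\<lambda>h. h \<bullet> b)"
    using assms unfolding gderiv_def by (rule has_derivative_unique)
  then have "(a - b) \<bullet> a = (a - b) \<bullet> b" by (rule fun_cong)
  then have "(a - b) \<bullet> (a - b) = 0" by (simp add: inner_simps)
  then show ?thesis by simp
qed

lemma GDERIV_isCont: "GDERIV f x :> D \<Longrightarrow> isCont f x"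
  unfolding gderiv_def by (rule has_derivative_continuous)

lemma C_k_cont: "C_k k f \<Longrightarrow> continuous_on UNIV f"
  by (cases k) (auto intro!: continuous_at_imp_continuous_on intro: GDERIV_isCont)

lemma C_k_SucI: "(\<And>x. GDERIV f x :> G x) \<Longrightarrow> (\<And>j. C_k k (\<lambda>x. G x $ j)) \<Longrightarrow> C_k (Suc k) f"
  by auto

lemma C_k_SucD: "C_k (Suc k) f \<Longrightarrow> (\<And>x. GDERIV f x :> G x) \<Longrightarrow> C_k k (\<lambda>x. G x $ j)"
proof -
  assume "C_k (Suc k) f" and G: "\<And>x. GDERIV f x :> G x"
  then obtain G' where G': "\<And>x. GDERIV f x :> G' x" "\<And>j. C_k k (\<lambda>x. G' x $ j)" by auto
  have "G' = G" using GDERIV_unique[OF G'(1) G] by auto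
  with G' show "C_k k (\<lambda>x. G x $ j)" by simp
qed

lemma C_k_const: "C_k k (\<lambda>x. c)"
proof (induction k arbitrary: c)
  case (Suc k)
  then show ?case using GDERIV_const by (intro C_k_SucI[of _ "\<lambda>x. 0"]) auto
qed simp

lemma C_k_add: "C_k k f \<Longrightarrow> C_k k g \<Longrightarrow> C_k k (\<lambda>x. f x + g x)"
proof (induction k arbitrary: f g)
  case (Suc k)
  then obtain F G where "\<And>x. GDERIV f x :> F x" "\<And>j. C_k k (\<lambda>x. F x $ j)"
     "\<And>x. GDERIV g x :> G x" "\<And>j. C_k k (\<lambda>x. G x $ j)" by auto
  with Suc.IH show ?case
    by (intro C_k_SucI[of _ "\<lambda>x. F x + G x"] GDERIV_add) auto
qed (auto intro: continuous_intros)

lemma C_k_Suc_imp: "C_k (Suc k) f \<Longrightarrow> C_k k f"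
proof (induction k arbitrary: f)
  case 0
  then show ?case by (simp only: C_k.simps(1)) (rule C_k_cont)
next
  case (Suc k)
  then obtain F where F: "\<And>x. GDERIV f x :> F x" "\<And>j. C_k (Suc k) (\<lambda>x. F x $ j)"
    by (subst (asm) C_k.simps) auto
  show ?case by (rule C_k_SucI[of _ F]) (rule F Suc.IH)+
qed

lemma C_k_mult: "C_k k f \<Longrightarrow> C_k k g \<Longrightarrow> C_k k (\<lambda>x. f x * g x)"
proof (induction k arbitrary: f g)
  case (Suc k)
  from Suc.prems obtain F G where *: "\<And>x. GDERIV f x :> F x" "\<And>j. C_k k (\<lambda>x. F x $ j)"
     "\<And>x. GDERIV g x :> G x" "\<And>j. C_k k (\<lambda>x. G x $ j)" by auto
  show ?case
  proof (rule C_k_SucI[of _ "\<lambda>x. f x *\<^sub>R G x + g x *\<^sub>R F x"])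
    show "GDERIV (\<lambda>x. f x * g x) x :> f x *\<^sub>R G x + g x *\<^sub>R F x" for x
      using * by (intro GDERIV_mult)
    show "C_k k (\<lambda>x. (f x *\<^sub>R G x + g x *\<^sub>R F x) $ j)" for j
      using * Suc.prems[THEN C_k_Suc_imp] Suc.IH by (auto intro!: C_k_add)
  qed
qed (auto intro: continuous_intros)

lemma C_k_prod: "finite S \<Longrightarrow> (\<And>i. i \<in> S \<Longrightarrow> C_k k (f i)) \<Longrightarrow> C_k k (\<lambda>x. \<Prod>i\<in>S. f i x)"
  by (induction S rule: finite_induct) (auto intro: C_k_const C_k_mult)

text \<open>The classical functions \<open>exp (- 1 / x)\<close>, extended by zero to \<open>x \<le> 0\<close>, with a polynomial factor in \<open>1 / x\<close>:
  in this form they are a class closed under differentiation, hence consist of smooth functions.\<close>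

definition flat :: "real poly \<Rightarrow> real \<Rightarrow> real" where
  "flat p x = (if x > 0 then poly p (1 / x) * exp (- (1 / x)) else 0)"

lemma poly_times_exp_tendsto_0: "((\<lambda>y. poly p y * exp (- y)) \<longlongrightarrow> (0::real)) at_top"
proof -
  have "((\<lambda>y. \<Sum>i\<le>degree p. coeff p i * (y ^ i / exp y)) \<longlongrightarrow> (\<Sum>i\<le>degree p. coeff p i * 0)) at_top"
    by (intro tendsto_intros tendsto_power_div_exp_0)
  then show ?thesis
    by (simp add: poly_altdef sum_distrib_right exp_minus divide_inverse mult.assoc)
qed

lemma flat_tendsto_0: "(flat p \<longlongrightarrow> 0) (at 0)"
proof -
  have "((\<lambda>x. poly p (1 / x) * exp (- (1 / x))) \<longlongrightarrow> 0) (at_right (0::real))"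
    using filterlim_compose[OF poly_times_exp_tendsto_0 filterlim_inverse_at_top_right, of p]
    by (simp add: inverse_eq_divide)
  then have "(flat p \<longlongrightarrow> 0) (at_right 0)"
    by (rule Lim_transform_eventually)
      (auto simp: flat_def eventually_at_filter)
  moreover have "(flat p \<longlongrightarrow> 0) (at_left 0)"
    by (rule Lim_transform_eventually[OF tendsto_const])
      (auto simp: flat_def eventually_at_filter)
  ultimately show ?thesis
    by (simp add: filterlim_at_split)
qed

lemma flat_pCons_0: "flat (pCons 0 p) x = flat p x / x"
  by (simp add: flat_def)

text \<open>At the origin the difference quotient of \<open>flat p\<close> is again a function of this class, which tends to zero.\<close>

lemma flat_DERIV: "(flat p has_real_derivative flat ([:0, 0, 1:] * (p - pderiv p)) x) (at x)"
proof (cases x "0::real" rule: linorder_cases)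
  case less
  then have "\<forall>\<^sub>F y in nhds x. flat p y = 0"
    using eventually_nhds_in_open[of "{..<0}" x] by (auto simp: flat_def elim!: eventually_mono)
  then show ?thesis
    using less by (subst DERIV_cong_ev[OF refl _ refl]) (auto simp: flat_def)
next
  case equal
  have "((\<lambda>h. flat p h / h) \<longlongrightarrow> 0) (at 0)"
    using flat_tendsto_0[of "pCons 0 p"] by (simp add: flat_pCons_0 [abs_def])
  with equal show ?thesis
    by (simp add: DERIV_def flat_def)
next
  case greater
  then have ev: "\<forall>\<^sub>F y in nhds x. flat p y = poly p (1 / y) * exp (- (1 / y))"
    using eventually_nhds_in_open[of "{0<..}" x] by (auto simp: flat_def elim!: eventually_mono)
  have "((\<lambda>y. poly p (1 / y) * exp (- (1 / y))) has_real_derivative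
      flat ([:0, 0, 1:] * (p - pderiv p)) x) (at x)"
    using greater
    by (auto intro!: derivative_eq_intros DERIV_chain2[OF poly_DERIV]
        simp: flat_def field_simps power2_eq_square)
  with ev show ?thesis
    by (subst DERIV_cong_ev[OF refl _ refl])
qed

lemma C_k_flat: "C_k k (\<lambda>x :: real ^ 'n. flat p (c * (x $ j) + b))"
proof (induction k arbitrary: p)
  case 0
  have "continuous_on UNIV (flat p)"
    using flat_DERIV by (intro continuous_at_imp_continuous_on ballI DERIV_isCont)
  then have "continuous_on UNIV (\<lambda>x :: real ^ 'n. flat p (c * (x $ j) + b))"
    by (rule continuous_on_compose2) (auto intro!: continuous_intros)
  then show ?case by simp
next
  case (Suc k)
  let ?q = "[:0, 0, 1:] * (p - pderiv p)"
  show ?case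
  proof (rule C_k_SucI[of _ "\<lambda>x. flat ?q (c * (x $ j) + b) *\<^sub>R axis j c"])
    show "GDERIV (\<lambda>x :: real ^ 'n. flat p (c * (x $ j) + b)) x :> flat ?q (c * (x $ j) + b) *\<^sub>R axis j c" for x
    proof (rule GDERIV_DERIV_compose[OF _ flat_DERIV])
      show "GDERIV (\<lambda>x :: real ^ 'n. c * (x $ j) + b) x :> axis j c"
        unfolding gderiv_def
        by (auto intro!: derivative_eq_intros bounded_linear.has_derivative[OF bounded_linear_vec_nth]
            simp: inner_axis mult.commute)
    qed
    show "C_k k (\<lambda>x. (flat ?q (c * (x $ j) + b) *\<^sub>R axis j c) $ i)" for i
      using Suc by (auto simp: axis_def intro!: C_k_mult C_k_const)
  qed
qed

definition bump :: "real \<Rightarrow> real ^ 'n \<Rightarrow> real ^ 'n \<Rightarrow> real ^ 'n \<Rightarrow> real" where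
  "bump c a b x = (\<Prod>k\<in>UNIV. flat 1 (c * (x $ k - a $ k)) * flat 1 (c * (b $ k - x $ k)))"

lemma C_k_bump: "C_k k (bump c a b)"
proof -
  have "C_k k (\<lambda>x. flat 1 (c * (x $ j - a $ j)))" for j
    using C_k_flat[of k 1 c j "- (c * a $ j)"] by (simp add: algebra_simps)
  moreover have "C_k k (\<lambda>x. flat 1 (c * (b $ j - x $ j)))" for j
    using C_k_flat[of k 1 "-c" j "c * b $ j"] by (simp add: algebra_simps)
  ultimately show ?thesis
    unfolding bump_def[abs_def] by (intro C_k_prod C_k_mult) auto
qed

lemma flat_1_bounds: "0 \<le> flat 1 x" "flat 1 x \<le> 1" "flat 1 x > 0 \<longleftrightarrow> x > 0" "flat 1 x = 0 \<longleftrightarrow> x \<le> 0"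
  by (auto simp: flat_def)

lemma bump_pos: "c > 0 \<Longrightarrow> x \<in> box a b \<Longrightarrow> bump c a b x > 0"
  unfolding bump_def by (intro prod_pos mult_pos_pos ballI) (auto simp: flat_1_bounds mem_box_cart)

lemma bump_zero: "c > 0 \<Longrightarrow> x \<notin> box a b \<Longrightarrow> bump c a b x = 0"
  by (force simp: bump_def prod_zero_iff flat_1_bounds mem_box_cart mult_le_0_iff not_less)

lemma bump_le_1: "0 \<le> bump c a b x" "bump c a b x \<le> 1"
  unfolding bump_def by (auto intro!: prod_nonneg prod_le_1 mult_le_one simp: flat_1_bounds)

text \<open>The box shrinks by \<open>1 / Suc n\<close> on each side to keep the supports compact in its interior; the steepness
  \<open>Suc n\<close> outgrows the shrinking at every fixed point, so the limit is the indicator of the whole open box.\<close>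

lemma bump_tendsto_indicator:
  fixes x :: "real ^ 'n"
  shows "(\<lambda>n. bump (real (Suc n)) (a + (\<chi> k. 1 / real (Suc n))) (b - (\<chi> k. 1 / real (Suc n))) x)
    \<longlonglongrightarrow> indicator (box a b) x"
proof (cases "x \<in> box a b")
  case True
  have "((\<lambda>y. exp (- (1 / y))) \<longlongrightarrow> exp (- (0::real))) at_top"
    by (intro tendsto_intros tendsto_divide_0[OF tendsto_const] filterlim_at_top_imp_at_infinity filterlim_ident)
  then have "((\<lambda>y. exp (- (1 / y))) \<longlongrightarrow> (1::real)) at_top" by simp
  then have flat: "(flat 1 \<longlongrightarrow> 1) at_top"
    by (rule Lim_transform_eventually)
      (use eventually_gt_at_top[of 0] in \<open>auto simp: flat_def elim!: eventually_mono\<close>)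
  have *: "(\<lambda>n. flat 1 (real (Suc n) * (r - 1 / real (Suc n)))) \<longlonglongrightarrow> 1" if "r > 0" for r
  proof -
    have "filterlim (\<lambda>n. (- 1) + r * real (Suc n)) at_top sequentially"
      by (intro filterlim_tendsto_add_at_top[OF tendsto_const]
         filterlim_tendsto_pos_mult_at_top[OF tendsto_const that]
         filterlim_compose[OF filterlim_real_sequentially filterlim_Suc])
    then have "filterlim (\<lambda>n. real (Suc n) * (r - 1 / real (Suc n))) at_top sequentially"
      by (rule filterlim_cong[THEN iffD1, rotated 3]) (auto simp: field_simps)
    then show ?thesis by (rule filterlim_compose[OF flat])
  qed
  have "(\<lambda>n. bump (real (Suc n)) (a + (\<chi> k. 1 / real (Suc n))) (b - (\<chi> k. 1 / real (Suc n))) x)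
      \<longlonglongrightarrow> (\<Prod>k\<in>(UNIV :: 'n set). 1 * 1)"
    unfolding bump_def
  proof (intro tendsto_prod tendsto_mult)
    fix k
    show "(\<lambda>n. flat 1 (real (Suc n) * (x $ k - (a + (\<chi> k. 1 / real (Suc n))) $ k))) \<longlonglongrightarrow> 1"
      using *[of "x $ k - a $ k"] True by (simp add: mem_box_cart algebra_simps)
    show "(\<lambda>n. flat 1 (real (Suc n) * ((b - (\<chi> k. 1 / real (Suc n))) $ k - x $ k))) \<longlonglongrightarrow> 1"
      using *[of "b $ k - x $ k"] True by (simp add: mem_box_cart algebra_simps)
  qed
  with True show ?thesis by simp
next
  case False
  have "x \<notin> box (a + (\<chi> k. 1 / real (Suc n))) (b - (\<chi> k. 1 / real (Suc n)))" for n
  proof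
    assume "x \<in> box (a + (\<chi> k. 1 / real (Suc n))) (b - (\<chi> k. 1 / real (Suc n)))"
    then have "a $ k + 1 / real (Suc n) < x $ k \<and> x $ k < b $ k - 1 / real (Suc n)" for k
      by (auto simp: mem_box_cart)
    moreover have "1 / real (Suc n) > 0" by simp
    ultimately have "x \<in> box a b"
      unfolding mem_box_cart by (smt (verit))
    with False show False ..
  qed
  with False show ?thesis by (simp add: bump_zero)
qed

lemma bump_test_function:
  assumes "c > 0" "cbox a b \<subseteq> box 0 1"
  shows "bump c a b \<in> test_functions"
proof -
  have "closure {x. bump c a b x \<noteq> 0} \<subseteq> cbox a b"
    using bump_zero[OF assms(1)] box_subset_cbox by (intro closure_minimal) blast+
  then show ?thesis
    using assms C_k_bump closure_subset[of "{x. bump c a b x \<noteq> 0}"]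
    unfolding test_functions_def Omega_def mem_Collect_eq interior_cbox compact_closure
    by (auto intro!: bounded_subset[OF bounded_cbox, of _ a b])
qed

section \<open>Test functions and weak gradients\<close>

text \<open>The classical gradient; meaningful only where one exists, as for test functions everywhere.\<close>

definition grad :: "(real ^ 'n \<Rightarrow> real) \<Rightarrow> real ^ 'n \<Rightarrow> real ^ 'n" where
  "grad f x = (SOME D. GDERIV f x :> D)"

lemma grad_eq: "GDERIV f x :> D \<Longrightarrow> grad f x = D"
  unfolding grad_def by (rule some_equality) (auto intro: GDERIV_unique)

lemma grad_zero_on_open:
  fixes f :: "real ^ 'n \<Rightarrow> real"
  assumes "open S" "x \<in> S" "\<And>y. y \<in> S \<Longrightarrow> f y = 0"
  shows "grad f x = 0"
proof -
  have "((\<lambda>x. 0) has_derivative (\<lambda>h. h \<bullet> (0 :: real ^ 'n))) (at x)" by simp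
  then have "(f has_derivative (\<lambda>h. h \<bullet> (0 :: real ^ 'n))) (at x)"
    by (rule has_derivative_transform_within_open[OF _ assms(1,2)]) (simp add: assms(3))
  then show ?thesis by (intro grad_eq) (simp add: gderiv_def)
qed

lemma test_GDERIV:
  assumes "\<phi> \<in> test_functions"
  shows "GDERIV \<phi> x :> grad \<phi> x"
proof -
  have "C_k (Suc 0) \<phi>" using assms unfolding test_functions_def by blast
  then obtain G where "\<And>x. GDERIV \<phi> x :> G x" by auto
  then show ?thesis using grad_eq by metis
qed

lemma test_continuous: "\<phi> \<in> test_functions \<Longrightarrow> continuous_on UNIV \<phi>"
  by (intro continuous_at_imp_continuous_on ballI GDERIV_isCont[OF test_GDERIV])

lemma test_grad_continuous:
  assumes "\<phi> \<in> test_functions"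
  shows "continuous_on UNIV (grad \<phi>)"
proof -
  have "C_k (Suc 0) \<phi>" using assms unfolding test_functions_def by blast
  from C_k_SucD[OF this test_GDERIV[OF assms]]
  have "continuous_on UNIV (\<lambda>x. \<chi> j. grad \<phi> x $ j)"
    by (intro continuous_on_vec_lambda) simp
  then show ?thesis by simp
qed

lemma test_zero:
  fixes \<phi> :: "real ^ 'n \<Rightarrow> real"
  assumes "\<phi> \<in> test_functions" "x \<notin> interior \<Omega>"
  shows "\<phi> x = 0" "grad \<phi> x = 0"
proof -
  let ?K = "closure {x. \<phi> x \<noteq> 0}"
  have "?K \<subseteq> interior \<Omega>" using assms by (auto simp: test_functions_def)
  then have x: "x \<in> - ?K" using assms by auto
  then show "\<phi> x = 0" using closure_subset[of "{x. \<phi> x \<noteq> 0}"] by blast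
  show "grad \<phi> x = 0"
    by (rule grad_zero_on_open[OF _ x]) (use closure_subset[of "{x. \<phi> x \<noteq> 0}"] in auto)
qed

lemma test_zero_Omega: "\<phi> \<in> test_functions \<Longrightarrow> x \<notin> \<Omega> \<Longrightarrow> \<phi> x = 0 \<and> grad \<phi> x = 0"
  using test_zero[of \<phi> x] interior_subset by blast

lemma continuous_zero_bounded:
  fixes f :: "real ^ 'n \<Rightarrow> 'b::real_normed_vector"
  assumes "continuous_on UNIV f" "\<And>x. x \<notin> \<Omega> \<Longrightarrow> f x = 0"
  obtains B where "B \<ge> 0" "\<And>x. norm (f x) \<le> B"
proof -
  have "compact (f ` \<Omega>)"
    using assms by (intro compact_continuous_image) (auto simp: Omega_def intro: continuous_on_subset)
  then obtain B where B: "\<And>x. x \<in> \<Omega> \<Longrightarrow> norm (f x) \<le> B"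
    using compact_imp_bounded bounded_iff by (metis imageI)
  show ?thesis
  proof (rule that[of "max B 0"])
    show "norm (f x) \<le> max B 0" for x
      using B[of x] assms(2)[of x] by (cases "x \<in> \<Omega>") auto
  qed simp
qed

lemma test_bounded:
  assumes "\<phi> \<in> test_functions"
  obtains B where "B \<ge> 0" "\<And>x. norm (\<phi> x) \<le> B" "\<And>x. norm (grad \<phi> x) \<le> B"
proof -
  obtain B1 where B1: "B1 \<ge> 0" "\<And>x. norm (\<phi> x) \<le> B1"
    using continuous_zero_bounded[OF test_continuous[OF assms]] test_zero_Omega[OF assms] by metis
  obtain B2 where B2: "B2 \<ge> 0" "\<And>x. norm (grad \<phi> x) \<le> B2"
    using continuous_zero_bounded[OF test_grad_continuous[OF assms]] test_zero_Omega[OF assms] by metis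
  show ?thesis
    using B1 B2 by (intro that[of "max B1 B2"]) (auto intro: max.coboundedI1 max.coboundedI2)
qed

lemma continuous_measurable_Omega:
  "continuous_on UNIV f \<Longrightarrow> f \<in> borel_measurable (lebesgue_on \<Omega>)"
  using borel_measurable_continuous_onI[of f] by (simp add: measurable_restrict_space1 measurable_completion)

lemma test_L2: "\<phi> \<in> test_functions \<Longrightarrow> \<phi> \<in> L2"
  by (metis test_bounded L2_bounded continuous_measurable_Omega test_continuous)

lemma test_grad_L2: "\<phi> \<in> test_functions \<Longrightarrow> grad \<phi> \<in> L2"
  by (metis test_bounded L2_bounded continuous_measurable_Omega test_grad_continuous)

lemma test_add:
  assumes "\<phi> \<in> test_functions" "\<psi> \<in> test_functions"
  shows "(\<lambda>x. \<phi> x + \<psi> x) \<in> test_functions" "grad (\<lambda>x. \<phi> x + \<psi> x) x = grad \<phi> x + grad \<psi> x"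
proof -
  have "{x. \<phi> x + \<psi> x \<noteq> 0} \<subseteq> {x. \<phi> x \<noteq> 0} \<union> {x. \<psi> x \<noteq> 0}" by auto
  then have sub: "closure {x. \<phi> x + \<psi> x \<noteq> 0} \<subseteq> closure {x. \<phi> x \<noteq> 0} \<union> closure {x. \<psi> x \<noteq> 0}"
    unfolding closure_Un[symmetric] by (rule closure_mono)
  moreover have "compact (closure {x. \<phi> x \<noteq> 0} \<union> closure {x. \<psi> x \<noteq> 0})"
    using assms unfolding test_functions_def by (auto intro: compact_Un)
  ultimately have "compact (closure {x. \<phi> x + \<psi> x \<noteq> 0})"
    by (meson bounded_subset closed_closure compact_eq_bounded_closed)
  moreover have "closure {x. \<phi> x + \<psi> x \<noteq> 0} \<subseteq> interior \<Omega>"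
    using assms sub by (auto simp: test_functions_def)
  ultimately show "(\<lambda>x. \<phi> x + \<psi> x) \<in> test_functions"
    using assms by (auto simp: test_functions_def intro!: C_k_add)
  show "grad (\<lambda>x. \<phi> x + \<psi> x) x = grad \<phi> x + grad \<psi> x"
    using assms by (intro grad_eq GDERIV_add test_GDERIV)
qed

lemma test_scale:
  assumes "\<phi> \<in> test_functions"
  shows "(\<lambda>x. c *\<^sub>R \<phi> x) \<in> test_functions" "grad (\<lambda>x. c *\<^sub>R \<phi> x) x = c *\<^sub>R grad \<phi> x"
proof -
  have *: "closure {x. c *\<^sub>R \<phi> x \<noteq> 0} \<subseteq> closure {x. \<phi> x \<noteq> 0}"
    by (intro closure_mono) auto
  have "compact (closure {x. c *\<^sub>R \<phi> x \<noteq> 0})"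
    using assms * unfolding test_functions_def
    by (auto simp: compact_eq_bounded_closed intro: bounded_subset)
  then show "(\<lambda>x. c *\<^sub>R \<phi> x) \<in> test_functions"
    using assms * unfolding test_functions_def by (auto intro!: C_k_mult C_k_const)
  have "GDERIV (\<lambda>x. c * \<phi> x) x :> c *\<^sub>R grad \<phi> x + \<phi> x *\<^sub>R 0"
    using assms by (intro GDERIV_mult GDERIV_const test_GDERIV)
  then show "grad (\<lambda>x. c *\<^sub>R \<phi> x) x = c *\<^sub>R grad \<phi> x"
    by (intro grad_eq) simp
qed

lemma integral_Omega_lborel:
  fixes F :: "real ^ 'n \<Rightarrow> 'b::{banach, second_countable_topology}"
  assumes [measurable]: "F \<in> borel_measurable borel" and "\<And>x. x \<notin> \<Omega> \<Longrightarrow> F x = 0"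
  shows "(LINT x|lebesgue_on \<Omega>. F x) = (LINT x|lborel. F x)"
proof -
  have "(LINT x|lebesgue_on \<Omega>. F x) = (LINT x|lebesgue. indicator \<Omega> x *\<^sub>R F x)"
    using lmeasurable_Omega by (intro integral_restrict_space) auto
  also have "(\<lambda>x. indicator \<Omega> x *\<^sub>R F x) = F"
    using assms(2) by (auto simp: indicator_def fun_eq_iff)
  finally show ?thesis by (simp add: integral_completion)
qed

lemma integral_translation_lborel:
  fixes F :: "real ^ 'n \<Rightarrow> 'b::{banach, second_countable_topology}"
  assumes [measurable]: "F \<in> borel_measurable borel"
  shows "(LINT x|lborel. F (c + x)) = (LINT x|lborel. F x)"
proof -
  have "(LINT x|lborel. F x) = (LINT x|distr lborel borel ((+) c). F x)"
    by (simp add: lborel_distr_plus)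
  also have "\<dots> = (LINT x|lborel. F (c + x))"
    by (rule integral_distr) auto
  finally show ?thesis by simp
qed

text \<open>Translation invariance replaces integration by parts: difference quotients of a compactly supported function
  have integral zero, they are bounded by a Lipschitz estimate and supported in a fixed ball, and they converge to the
  directional derivative.\<close>

lemma integral_derivative_zero:
  fixes f :: "real ^ 'n \<Rightarrow> real"
  assumes G: "\<And>x. GDERIV f x :> G x" "continuous_on UNIV G"
    and zero: "\<And>x. x \<notin> \<Omega> \<Longrightarrow> f x = 0 \<and> G x = 0"
  shows "(LINT x|lebesgue_on \<Omega>. G x \<bullet> e) = 0"
proof -
  obtain B where B: "B \<ge> 0" "\<And>x. norm (G x) \<le> B"
    using continuous_zero_bounded[OF G(2)] zero by metis
  have cf: "continuous_on UNIV f"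
    by (intro continuous_at_imp_continuous_on ballI GDERIV_isCont[OF G(1)])
  have [measurable]: "f \<in> borel_measurable borel" "G \<in> borel_measurable borel"
    using cf G(2) by (auto intro: borel_measurable_continuous_onI)
  have lip: "norm (f y - f x) \<le> B * norm (y - x)" for x y
  proof (rule differentiable_bound[of UNIV f "\<lambda>x h. h \<bullet> G x"])
    show "(f has_derivative (\<lambda>h. h \<bullet> G x)) (at x within UNIV)" for x
      using G(1) by (simp add: gderiv_def)
    show "onorm (\<lambda>h. h \<bullet> G x) \<le> B" for x
    proof (rule onorm_le)
      show "norm (h \<bullet> G x) \<le> B * norm h" for h
        using Cauchy_Schwarz_ineq2[of h "G x"] mult_left_mono[OF B(2)[of x], of "norm h"]
        by (simp add: mult.commute)
    qed
  qed auto
  define t where "t n = 1 / real (Suc n)" for n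
  have t: "t n > 0" "t n \<le> 1" for n by (auto simp: t_def)
  define q where "q n x = (f (t n *\<^sub>R e + x) - f x) / t n" for n x
  have q0: "(LINT x|lborel. q n x) = 0" for n
  proof -
    have int: "integrable lborel f"
    proof -
      have "integrable lborel (\<lambda>x. indicator \<Omega> x *\<^sub>R f x)"
        by (rule borel_integrable_compact) (auto simp: Omega_def intro: continuous_on_subset[OF cf])
      also have "(\<lambda>x. indicator \<Omega> x *\<^sub>R f x) = f"
        using zero by (auto simp: indicator_def fun_eq_iff)
      finally show ?thesis .
    qed
    have "integrable (distr lborel borel ((+) (t n *\<^sub>R e))) f"
      using int by (simp add: lborel_distr_plus)
    then have int': "integrable lborel (\<lambda>x. f (t n *\<^sub>R e + x))"
      by (subst (asm) integrable_distr_eq) auto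
    have "(LINT x|lborel. q n x) = ((LINT x|lborel. f (t n *\<^sub>R e + x)) - (LINT x|lborel. f x)) / t n"
      unfolding q_def using int int' by simp
    then show ?thesis by (simp add: integral_translation_lborel)
  qed
  obtain R where R: "\<And>x :: real ^ 'n. x \<in> \<Omega> \<Longrightarrow> norm x \<le> R"
    using bounded_cbox unfolding Omega_def bounded_iff by blast
  have "(\<lambda>n. LINT x|lborel. q n x) \<longlonglongrightarrow> (LINT x|lborel. G x \<bullet> e)"
  proof (rule integral_dominated_convergence[where w = "\<lambda>x. indicator (cball 0 (R + norm e)) x * (B * norm e)"])
    show "integrable lborel (\<lambda>x. indicator (cball 0 (R + norm e)) x * (B * norm e))"
      by (intro integrable_mult_left integrable_real_indicator) (use emeasure_bounded_finite[OF bounded_cball] in auto)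
    show "AE x in lborel. (\<lambda>n. q n x) \<longlonglongrightarrow> G x \<bullet> e"
    proof (rule AE_I2)
      fix x
      have "((\<lambda>s. f (x + s *\<^sub>R e)) has_derivative (\<lambda>s. (s *\<^sub>R e) \<bullet> G x)) (at 0)"
        using G(1)[of x] unfolding gderiv_def
        by (intro has_derivative_compose[where g = f and f = "\<lambda>s. x + s *\<^sub>R e"])
           (auto intro!: derivative_eq_intros)
      then have "((\<lambda>s. f (x + s *\<^sub>R e)) has_real_derivative G x \<bullet> e) (at 0)"
        unfolding has_field_derivative_def by (simp add: mult_commute_abs inner_commute)
      then have "((\<lambda>s. (f (x + s *\<^sub>R e) - f x) / s) \<longlongrightarrow> G x \<bullet> e) (at 0)"
        by (simp add: DERIV_def)
      moreover have "filterlim t (at 0) sequentially"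
        unfolding filterlim_at t_def using LIMSEQ_inverse_real_of_nat
        by (auto simp: divide_inverse)
      ultimately show "(\<lambda>n. q n x) \<longlonglongrightarrow> G x \<bullet> e"
        unfolding q_def using filterlim_compose[of "\<lambda>s. (f (x + s *\<^sub>R e) - f x) / s" _ "at 0" t]
        by (simp add: add.commute)
    qed
    show "AE x in lborel. norm (q n x) \<le> indicator (cball 0 (R + norm e)) x * (B * norm e)" for n
    proof (rule AE_I2)
      fix x
      have "norm (q n x) \<le> B * norm e"
        using lip[of "t n *\<^sub>R e + x" x] t[of n] by (simp add: q_def field_simps abs_mult)
      moreover have "q n x = 0" if "x \<notin> cball 0 (R + norm e)"
      proof -
        have "x \<notin> \<Omega>" using R[of x] that norm_ge_zero[of e] by (auto simp del: norm_ge_zero)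
        moreover have "t n *\<^sub>R e + x \<notin> \<Omega>"
        proof
          assume "t n *\<^sub>R e + x \<in> \<Omega>"
          then have "norm (t n *\<^sub>R e + x) \<le> R" by (rule R)
          moreover have "norm x \<le> norm (t n *\<^sub>R e + x) + norm (t n *\<^sub>R e)"
            using norm_triangle_ineq4[of "t n *\<^sub>R e + x" "t n *\<^sub>R e"] by simp
          moreover have "norm (t n *\<^sub>R e) \<le> norm e"
            using t[of n] by (simp add: mult_left_le_one_le)
          ultimately show False using that by simp
        qed
        ultimately show ?thesis using zero by (simp add: q_def)
      qed
      ultimately show "norm (q n x) \<le> indicator (cball 0 (R + norm e)) x * (B * norm e)"
        by (auto simp: indicator_def)
    qed
  qed (auto simp: q_def)
  then have "(LINT x|lborel. G x \<bullet> e) = 0"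
    using q0 LIMSEQ_unique[OF tendsto_const] by fastforce
  then show ?thesis
    using zero by (subst integral_Omega_lborel) auto
qed

lemma L2_integrable:
  assumes "f \<in> L2"
  shows "integrable (lebesgue_on \<Omega>) f"
proof (rule Bochner_Integration.integrable_bound)
  interpret finite_measure "lebesgue_on (\<Omega> :: (real ^ 'a) set)" by (rule finite_measure_Omega)
  show "integrable (lebesgue_on \<Omega>) (\<lambda>x. 1 + (norm (f x))\<^sup>2)"
    using assms by (auto simp: L2_def)
  show "f \<in> borel_measurable (lebesgue_on \<Omega>)" using assms by (rule L2_measurable)
  have "r \<le> 1 + r\<^sup>2" for r :: real
  proof -
    have "2 * r \<le> 1 + r\<^sup>2"
      using zero_le_power2[of "r - 1"] by (simp add: power2_diff)
    then show ?thesis using zero_le_power2[of r] by linarith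
  qed
  then show "AE x in lebesgue_on \<Omega>. norm (f x) \<le> norm (1 + (norm (f x))\<^sup>2)"
    by (auto simp: abs_of_nonneg)
qed

lemma L2_dominated:
  assumes "g \<in> L2" "f \<in> borel_measurable (lebesgue_on \<Omega>)" "\<And>x. x \<in> \<Omega> \<Longrightarrow> norm (f x) \<le> norm (g x)"
  shows "f \<in> L2"
  unfolding L2_def mem_Collect_eq
proof (intro conjI assms(2))
  show "integrable (lebesgue_on \<Omega>) (\<lambda>x. (norm (f x))\<^sup>2)"
  proof (rule Bochner_Integration.integrable_bound)
    show "integrable (lebesgue_on \<Omega>) (\<lambda>x. (norm (g x))\<^sup>2)"
      using assms by (simp add: L2_def)
    show "AE x in lebesgue_on \<Omega>. norm ((norm (f x))\<^sup>2) \<le> norm ((norm (g x))\<^sup>2)"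
      using assms(3) by (auto simp: space_restrict_space intro!: AE_I2 power_mono)
  qed (use assms in measurable)
qed

lemma L2_scaleR_test:
  assumes "\<phi> \<in> test_functions" "g \<in> L2"
  shows "(\<lambda>x. \<phi> x *\<^sub>R g x) \<in> L2"
proof -
  obtain B where B: "\<And>x. norm (\<phi> x) \<le> B" using test_bounded[OF assms(1)] by metis
  show ?thesis
    by (rule L2_bounded_mult[OF assms(2) continuous_measurable_Omega[OF test_continuous[OF assms(1)]], of B])
      (use B in simp)
qed

lemma L2_scaleR_grad:
  fixes u :: "real ^ 'n \<Rightarrow> real"
  assumes "\<phi> \<in> test_functions" "u \<in> L2"
  shows "(\<lambda>x. u x *\<^sub>R grad \<phi> x) \<in> L2"
proof -
  obtain B where B: "B \<ge> 0" "\<And>x. norm (grad \<phi> x) \<le> B" using test_bounded[OF assms(1)] by metis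
  show ?thesis
  proof (rule L2_dominated[OF L2_scale[OF assms(2), of B]])
    show "(\<lambda>x. u x *\<^sub>R grad \<phi> x) \<in> borel_measurable (lebesgue_on \<Omega>)"
      using test_grad_L2[OF assms(1), THEN L2_measurable] assms(2)[THEN L2_measurable] by measurable
    show "norm (u x *\<^sub>R grad \<phi> x) \<le> norm (B *\<^sub>R u x)" for x
      using B mult_left_mono[OF B(2), of "\<bar>u x\<bar>" x] by (simp add: abs_mult mult.commute)
  qed
qed

lemma L2_inner_const: "f \<in> L2 \<Longrightarrow> (\<lambda>x. f x \<bullet> e) \<in> L2"
proof -
  assume f: "f \<in> L2"
  show ?thesis
  proof (rule L2_dominated[OF L2_scale[OF f, of "norm e"]])
    show "(\<lambda>x. f x \<bullet> e) \<in> borel_measurable (lebesgue_on \<Omega>)"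
      using f[THEN L2_measurable] by measurable
    show "norm (f x \<bullet> e) \<le> norm (norm e *\<^sub>R f x)" for x
      using Cauchy_Schwarz_ineq2[of "f x" e] by (simp add: mult.commute)
  qed
qed

text \<open>Testing against all directions \<open>e\<close> turns the vector identity into inner products, which pass to limits in
  \<open>L\<^sup>2\<close> and are visibly linear.\<close>

lemma is_weak_grad_iff:
  fixes u :: "real ^ 'n \<Rightarrow> real"
  assumes "u \<in> L2"
  shows "is_weak_grad u g \<longleftrightarrow> g \<in> L2 \<and>
    (\<forall>\<phi>\<in>test_functions. \<forall>e. ip u (\<lambda>x. grad \<phi> x \<bullet> e) = - ip g (\<lambda>x. \<phi> x *\<^sub>R e))"
proof -
  have *: "(LINT x|lebesgue_on \<Omega>. u x *\<^sub>R G x) = - (LINT x|lebesgue_on \<Omega>. \<phi> x *\<^sub>R g x) \<longleftrightarrow>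
    (\<forall>e. ip u (\<lambda>x. grad \<phi> x \<bullet> e) = - ip g (\<lambda>x. \<phi> x *\<^sub>R e))"
    if \<phi>: "\<phi> \<in> test_functions" and G: "\<forall>x. GDERIV \<phi> x :> G x" and g: "g \<in> L2" for \<phi> G
  proof -
    have "G = grad \<phi>" using G by (auto simp: fun_eq_iff intro!: grad_eq[symmetric])
    have "(LINT x|lebesgue_on \<Omega>. u x *\<^sub>R grad \<phi> x) \<bullet> e = ip u (\<lambda>x. grad \<phi> x \<bullet> e)" for e
      unfolding ip_def
      using L2_integrable[OF L2_scaleR_grad[OF \<phi> assms]]
      by (subst integral_inner_left[symmetric]) auto
    moreover have "(LINT x|lebesgue_on \<Omega>. \<phi> x *\<^sub>R g x) \<bullet> e = ip g (\<lambda>x. \<phi> x *\<^sub>R e)" for e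
      unfolding ip_def
      using L2_integrable[OF L2_scaleR_test[OF \<phi> g]]
      by (subst integral_inner_left[symmetric]) auto
    ultimately show ?thesis
      using vector_eq_rdot[of "LINT x|lebesgue_on \<Omega>. u x *\<^sub>R G x" "- (LINT x|lebesgue_on \<Omega>. \<phi> x *\<^sub>R g x)"]
      by (simp only: \<open>G = grad \<phi>\<close> inner_minus_left)
  qed
  show ?thesis
  proof (cases "g \<in> L2")
    case True
    then show ?thesis
      unfolding is_weak_grad_def using *[OF _ _ True] test_GDERIV by blast
  qed (simp add: is_weak_grad_def)
qed

text \<open>The derivative of the product of two test functions has integral zero.\<close>

lemma test_is_weak_grad:
  fixes \<phi> :: "real ^ 'n \<Rightarrow> real"
  assumes "\<phi> \<in> test_functions"
  shows "is_weak_grad \<phi> (grad \<phi>)"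
  unfolding is_weak_grad_iff[OF test_L2[OF assms]]
proof (intro conjI test_grad_L2 assms ballI allI)
  fix \<psi> :: "real ^ 'n \<Rightarrow> real" and e :: "real ^ 'n"
  assume \<psi>: "\<psi> \<in> test_functions"
  have "(LINT x|lebesgue_on \<Omega>. (\<phi> x *\<^sub>R grad \<psi> x + \<psi> x *\<^sub>R grad \<phi> x) \<bullet> e) = 0"
  proof (rule integral_derivative_zero)
    show "GDERIV (\<lambda>x. \<phi> x * \<psi> x) x :> \<phi> x *\<^sub>R grad \<psi> x + \<psi> x *\<^sub>R grad \<phi> x" for x
      by (rule GDERIV_mult[OF test_GDERIV[OF assms] test_GDERIV[OF \<psi>]])
    show "continuous_on UNIV (\<lambda>x. \<phi> x *\<^sub>R grad \<psi> x + \<psi> x *\<^sub>R grad \<phi> x)"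
      by (rule continuous_on_add; rule continuous_on_scaleR)
        (use assms \<psi> in \<open>simp_all add: test_continuous test_grad_continuous\<close>)
    show "\<phi> x * \<psi> x = 0 \<and> \<phi> x *\<^sub>R grad \<psi> x + \<psi> x *\<^sub>R grad \<phi> x = 0" if "x \<notin> \<Omega>" for x
      using test_zero_Omega[OF assms that] by simp
  qed
  moreover have "integrable (lebesgue_on \<Omega>) (\<lambda>x. \<phi> x * (grad \<psi> x \<bullet> e))"
    using L2_integrable_inner[OF test_L2[OF assms] L2_inner_const[OF test_grad_L2[OF \<psi>], of e]] by simp
  moreover have "integrable (lebesgue_on \<Omega>) (\<lambda>x. \<psi> x * (grad \<phi> x \<bullet> e))"
    using L2_integrable_inner[OF test_L2[OF \<psi>] L2_inner_const[OF test_grad_L2[OF assms], of e]] by simp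
  ultimately show "ip \<phi> (\<lambda>x. grad \<psi> x \<bullet> e) = - ip (grad \<phi>) (\<lambda>x. \<psi> x *\<^sub>R e)"
    unfolding ip_def by (simp add: inner_add_left)
qed

lemma is_weak_grad_limit:
  fixes u :: "real ^ 'n \<Rightarrow> real"
  assumes "\<And>n. is_weak_grad (us n) (gs n)" "L2lim us u" "L2lim gs g"
  shows "is_weak_grad u g"
  unfolding is_weak_grad_iff[OF L2lim_mem(1)[OF assms(2)]]
proof (intro conjI L2lim_mem(1)[OF assms(3)] ballI allI)
  fix \<psi> :: "real ^ 'n \<Rightarrow> real" and e :: "real ^ 'n"
  assume \<psi>: "\<psi> \<in> test_functions"
  have 1: "(\<lambda>n. ip (us n) (\<lambda>x. grad \<psi> x \<bullet> e)) \<longlonglongrightarrow> ip u (\<lambda>x. grad \<psi> x \<bullet> e)"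
    by (rule L2lim_ip[OF assms(2) L2lim_const[OF L2_inner_const[OF test_grad_L2[OF \<psi>]]]])
  have "(\<lambda>x :: real ^ 'n. e) \<in> L2" by (rule L2_bounded[where K = "norm e"]) auto
  then have "(\<lambda>n. - ip (gs n) (\<lambda>x. \<psi> x *\<^sub>R e)) \<longlonglongrightarrow> - ip g (\<lambda>x. \<psi> x *\<^sub>R e)"
    by (intro tendsto_minus L2lim_ip[OF assms(3) L2lim_const[OF L2_scaleR_test[OF \<psi>]]])
  moreover have "ip (us n) (\<lambda>x. grad \<psi> x \<bullet> e) = - ip (gs n) (\<lambda>x. \<psi> x *\<^sub>R e)" for n
    using assms(1)[of n] \<psi> by (simp add: is_weak_grad_iff L2lim_mem(2)[OF assms(2)])
  ultimately show "ip u (\<lambda>x. grad \<psi> x \<bullet> e) = - ip g (\<lambda>x. \<psi> x *\<^sub>R e)"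
    by (intro LIMSEQ_unique[OF 1]) simp
qed

lemma AE_not_negligible:
  assumes "negligible (S :: (real ^ 'n) set)"
  shows "AE x in lebesgue_on \<Omega>. x \<notin> S"
proof -
  have "S \<in> null_sets lebesgue" using assms by (simp add: negligible_iff_null_sets)
  from AE_not_in[OF this] have "AE x in lebesgue. x \<in> \<Omega> \<longrightarrow> x \<notin> S" by eventually_elim blast
  moreover have "\<Omega> \<inter> space lebesgue \<in> sets (lebesgue :: (real ^ 'n) measure)"
    using lmeasurable_Omega[THEN fmeasurableD] by simp
  ultimately show ?thesis by (subst AE_restrict_space_iff)
qed

lemma AE_Omega_interior: "AE x in lebesgue_on (\<Omega> :: (real ^ 'n) set). x \<in> box 0 1"
proof -
  have "AE x in lebesgue_on \<Omega>. x \<notin> cbox 0 1 - box 0 (1 :: real ^ 'n)"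
    by (intro AE_not_negligible negligible_frontier_interval)
  moreover have "AE x in lebesgue_on (\<Omega> :: (real ^ 'n) set). x \<in> \<Omega>"
    by (intro AE_I2) (simp add: space_restrict_space)
  ultimately show ?thesis
    by eventually_elim (simp add: Omega_def)
qed

text \<open>The fundamental lemma of the calculus of variations. Dominated convergence along bumps gives a vanishing
  integral over every open box inside the unit cube. Boxes are stable under intersection and generate the
  Borel sets, and Lebesgue sets differ from Borel sets by null sets, so the integral vanishes over every
  measurable set.\<close>

lemma test_orthogonal_imp_AE_zero:
  fixes w :: "real ^ 'n \<Rightarrow> 'b::euclidean_space"
  assumes w: "w \<in> L2" and orth: "\<And>\<phi>. \<phi> \<in> test_functions \<Longrightarrow> (LINT x|lebesgue_on \<Omega>. \<phi> x *\<^sub>R w x) = 0"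
  shows "AE x in lebesgue_on \<Omega>. w x = 0"
proof -
  let ?M = "lebesgue_on (\<Omega> :: (real ^ 'n) set)"
  have wm[measurable]: "w \<in> borel_measurable ?M" and wi: "integrable ?M w"
    using w by (auto intro: L2_measurable L2_integrable)
  have ind: "(indicator A :: _ \<Rightarrow> real) \<in> borel_measurable ?M" if "A \<in> sets borel" for A
  proof (rule measurable_restrict_space1)
    show "(indicator A :: _ \<Rightarrow> real) \<in> borel_measurable lebesgue"
      using that by (intro borel_measurable_indicator) simp
  qed
  have indw: "(\<lambda>x. indicator A x *\<^sub>R w x) \<in> borel_measurable ?M" if "A \<in> sets borel" for A
    using ind[OF that] wm by (rule borel_measurable_scaleR)
  have box_small: "(LINT x|?M. indicator (box a b) x *\<^sub>R w x) = 0" if sub: "box a b \<subseteq> box 0 1" for a b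
  proof -
    let ?\<phi> = "\<lambda>n. bump (real (Suc n)) (a + (\<chi> k. 1 / real (Suc n))) (b - (\<chi> k. 1 / real (Suc n)))"
    have t: "?\<phi> n \<in> test_functions" for n
    proof (rule bump_test_function)
      have pos: "1 / real (Suc n) > 0" by simp
      have "cbox (a + (\<chi> k. 1 / real (Suc n))) (b - (\<chi> k. 1 / real (Suc n))) \<subseteq> box a b"
      proof
        fix x assume "x \<in> cbox (a + (\<chi> k. 1 / real (Suc n))) (b - (\<chi> k. 1 / real (Suc n)))"
        then have "a $ k + 1 / real (Suc n) \<le> x $ k \<and> x $ k \<le> b $ k - 1 / real (Suc n)" for k
          by (auto simp: mem_box_cart)
        with pos show "x \<in> box a b" unfolding mem_box_cart by (smt (verit))
      qed
      with sub show "cbox (a + (\<chi> k. 1 / real (Suc n))) (b - (\<chi> k. 1 / real (Suc n))) \<subseteq> box 0 1" by blast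
    qed simp
    have "(\<lambda>n. LINT x|?M. ?\<phi> n x *\<^sub>R w x) \<longlonglongrightarrow> (LINT x|?M. indicator (box a b) x *\<^sub>R w x)"
    proof (rule integral_dominated_convergence[where w = "\<lambda>x. norm (w x)"])
      show "AE x in ?M. norm (?\<phi> n x *\<^sub>R w x) \<le> norm (w x)" for n
        by (intro AE_I2) (simp add: abs_of_nonneg bump_le_1 mult_left_le_one_le)
      show "AE x in ?M. (\<lambda>n. ?\<phi> n x *\<^sub>R w x) \<longlonglongrightarrow> indicator (box a b) x *\<^sub>R w x"
        by (intro AE_I2 tendsto_scaleR bump_tendsto_indicator tendsto_const)
      show "(\<lambda>x. ?\<phi> n x *\<^sub>R w x) \<in> borel_measurable ?M" for n
        using L2_scaleR_test[OF t w, of n] by (rule L2_measurable)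
      show "(\<lambda>x. indicator (box a b) x *\<^sub>R w x) \<in> borel_measurable ?M"
        by (rule indw) simp
      show "integrable ?M (\<lambda>x. norm (w x))" using wi by simp
    qed
    then show ?thesis by (simp only: orth[OF t] LIMSEQ_const_iff)
  qed
  have int: "integrable ?M (\<lambda>x. indicator A x *\<^sub>R w x)" if "A \<in> sets borel" for A
    by (rule Bochner_Integration.integrable_bound[OF wi indw[OF that]]) (simp add: indicator_def)
  have box: "(LINT x|?M. indicator (box a b) x *\<^sub>R w x) = 0" for a b
  proof -
    obtain c d where cd: "box a b \<inter> box 0 1 = box c d" using box_Int_box by blast
    have "(LINT x|?M. indicator (box a b) x *\<^sub>R w x) = (LINT x|?M. indicator (box c d) x *\<^sub>R w x)"
    proof (rule integral_cong_AE)
      show "AE x in ?M. indicator (box a b) x *\<^sub>R w x = indicator (box c d) x *\<^sub>R w x"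
        using AE_Omega_interior by eventually_elim (auto simp: cd[symmetric] indicator_def)
    qed (intro indw; simp)+
    moreover have "box c d \<subseteq> box 0 1" using cd by blast
    ultimately show ?thesis using box_small[of c d] by (simp only:)
  qed
  have borel: "(LINT x|?M. indicator A x *\<^sub>R w x) = 0" if A: "A \<in> sets borel" for A :: "(real ^ 'n) set"
  proof -
    have "Int_stable (range (\<lambda>(a, b). box a b :: (real ^ 'n) set))"
      by (auto simp: Int_stable_def box_Int_box)
    moreover have "(range (\<lambda>(a, b). box a b :: (real ^ 'n) set)) \<subseteq> Pow UNIV"
      by auto
    moreover have "A \<in> sigma_sets UNIV (range (\<lambda>(a, b). box a b))"
       using A unfolding borel_eq_box by simp
    ultimately show ?thesis
    proof (induction rule: sigma_sets_induct_disjoint)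
      case (basic A) then show ?case using box by auto
    next
      case empty then show ?case by simp
    next
      case (compl A)
      then have A: "A \<in> sets borel" by (simp add: borel_eq_box)
      have "(LINT x|?M. w x) = (LINT x|?M. indicator (box 0 1) x *\<^sub>R w x)"
      proof (rule integral_cong_AE)
        show "AE x in ?M. w x = indicator (box 0 1) x *\<^sub>R w x"
          using AE_Omega_interior by eventually_elim auto
      qed (intro indw wm; simp)+
      then have "(LINT x|?M. w x) = 0" using box by simp
      moreover have "(LINT x|?M. indicator (UNIV - A) x *\<^sub>R w x)
          = (LINT x|?M. w x - indicator A x *\<^sub>R w x)"
        by (intro Bochner_Integration.integral_cong) (auto simp: indicator_def)
      ultimately show ?case using compl int[OF A] wi by simp
    next
      case (union F)
      then have F: "F i \<in> sets borel" for i by (auto simp: borel_eq_box)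
      have "(\<lambda>n. LINT x|?M. indicator (\<Union>i<n. F i) x *\<^sub>R w x) \<longlonglongrightarrow> (LINT x|?M. indicator (\<Union>i. F i) x *\<^sub>R w x)"
      proof (rule integral_dominated_convergence[where w = "\<lambda>x. norm (w x)"])
        show "AE x in ?M. (\<lambda>n. indicator (\<Union>i<n. F i) x *\<^sub>R w x) \<longlonglongrightarrow> indicator (\<Union>i. F i) x *\<^sub>R w x"
          by (intro AE_I2 tendsto_scaleR LIMSEQ_indicator_UN tendsto_const)
        show "(\<lambda>x. indicator (\<Union>i. F i) x *\<^sub>R w x) \<in> borel_measurable ?M"
          by (intro indw sets.countable_UN) (use F in auto)
        show "(\<lambda>x. indicator (\<Union>i<n. F i) x *\<^sub>R w x) \<in> borel_measurable ?M" for n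
          by (intro indw sets.finite_UN) (use F in auto)
        show "integrable ?M (\<lambda>x. norm (w x))" using wi by simp
        show "AE x in ?M. norm ((indicator (\<Union>i<n. F i) x :: real) *\<^sub>R w x) \<le> norm (w x)" for n
          by (intro AE_I2) (simp add: indicator_def)
      qed
      moreover have "(LINT x|?M. indicator (\<Union>i<n. F i) x *\<^sub>R w x) = 0" for n
      proof -
        have "(LINT x|?M. indicator (\<Union>i<n. F i) x *\<^sub>R w x) = (LINT x|?M. (\<Sum>i<n. indicator (F i) x *\<^sub>R w x))"
          using union(1)
          by (intro Bochner_Integration.integral_cong refl)
            (simp add: indicator_UN_disjoint[OF finite_lessThan disjoint_family_on_mono[OF subset_UNIV]]
              flip: scaleR_sum_left)
        also have "\<dots> = 0"
          by (subst Bochner_Integration.integral_sum[OF int[OF F]]) (simp only: union(3) sum.neutral_const)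
        finally show ?thesis .
      qed
      ultimately show ?case by (simp add: LIMSEQ_const_iff)
    qed
  qed
  interpret finite_measure ?M by (rule finite_measure_Omega)
  show ?thesis
  proof (rule density_zero[OF wi])
    fix A assume "A \<in> sets ?M"
    have Om: "\<Omega> \<in> sets (lebesgue :: (real ^ 'n) measure)"
      using lmeasurable_Omega by (rule fmeasurableD)
    from \<open>A \<in> sets ?M\<close> obtain B where "B \<in> sets lebesgue" "A = \<Omega> \<inter> B"
      unfolding sets_restrict_space by blast
    with Om have "A \<in> sets lebesgue" by (simp only: sets.Int)
    then obtain S N N' where A: "A = S \<union> N" "N \<subseteq> N'" "N' \<in> null_sets lborel" "S \<in> sets lborel"
      by (rule sets_completionE)
    have "N' \<in> null_sets lebesgue" using A(3) by (rule null_sets_completionI)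
    from AE_not_in[OF this] have "AE x in lebesgue. x \<in> \<Omega> \<longrightarrow> x \<notin> N'" by eventually_elim blast
    then have "AE x in ?M. x \<notin> N'"
      using Om by (subst AE_restrict_space_iff) simp_all
    then have AE: "AE x in ?M. indicator A x *\<^sub>R w x = indicator S x *\<^sub>R w x"
      by eventually_elim (use A in \<open>auto simp: indicator_def\<close>)
    have "S \<in> sets borel" using A by simp
    have "(indicator A :: _ \<Rightarrow> real) \<in> borel_measurable ?M"
      using \<open>A \<in> sets ?M\<close> by (rule borel_measurable_indicator)
    then have "(LINT x|?M. indicator A x *\<^sub>R w x) = (LINT x|?M. indicator S x *\<^sub>R w x)"
      by (intro integral_cong_AE AE indw borel_measurable_scaleR wm \<open>S \<in> sets borel\<close>)
    also have "\<dots> = 0" by (rule borel) fact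
    finally show "set_lebesgue_integral ?M A w = 0" by (simp add: set_lebesgue_integral_def)
  qed
qed

lemma is_weak_grad_unique:
  fixes u :: "real ^ 'n \<Rightarrow> real"
  assumes "is_weak_grad u g" "is_weak_grad u g'"
  shows "AE x in lebesgue_on \<Omega>. g x = g' x"
proof -
  have L2: "g \<in> L2" "g' \<in> L2" using assms by (auto simp: is_weak_grad_def)
  have "AE x in lebesgue_on \<Omega>. g x - g' x = 0"
  proof (rule test_orthogonal_imp_AE_zero)
    show "(\<lambda>x. g x - g' x) \<in> L2" using L2 by (rule L2_diff)
    fix \<phi> :: "real ^ 'n \<Rightarrow> real" assume \<phi>: "\<phi> \<in> test_functions"
    have "- (LINT x|lebesgue_on \<Omega>. \<phi> x *\<^sub>R g x) = - (LINT x|lebesgue_on \<Omega>. \<phi> x *\<^sub>R g' x)"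
      using assms \<phi> test_GDERIV[OF \<phi>] unfolding is_weak_grad_def by fastforce
    then have "(LINT x|lebesgue_on \<Omega>. \<phi> x *\<^sub>R g x) = (LINT x|lebesgue_on \<Omega>. \<phi> x *\<^sub>R g' x)"
      by simp
    then show "(LINT x|lebesgue_on \<Omega>. \<phi> x *\<^sub>R (g x - g' x)) = 0"
      unfolding scaleR_diff_right
      by (subst Bochner_Integration.integral_diff)
        (simp_all add: L2_integrable L2_scaleR_test \<phi> L2)
  qed
  then show ?thesis by simp
qed

section \<open>The space \<open>H\<^sup>1\<^sub>0\<close>\<close>

text \<open>Approximation by test functions, in \<open>L\<^sup>2\<close> together with the gradients. Carrying the gradient \<open>g\<close> as an
  explicit argument avoids the arbitrary choice in \<^const>\<open>weak_grad\<close>, which respects linear operations only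
  up to null sets.\<close>

definition H10_grad :: "(real ^ 'n \<Rightarrow> real) \<Rightarrow> (real ^ 'n \<Rightarrow> real ^ 'n) \<Rightarrow> bool" where
  "H10_grad u g \<longleftrightarrow>
    (\<exists>\<phi>. (\<forall>n. \<phi> n \<in> test_functions) \<and> L2lim \<phi> u \<and> L2lim (\<lambda>n. grad (\<phi> n)) g)"

lemma H10_grad_L2: "H10_grad u g \<Longrightarrow> u \<in> L2" "H10_grad u g \<Longrightarrow> g \<in> L2"
  by (auto simp: H10_grad_def dest: L2lim_mem)

lemma H10_grad_is_weak_grad: "H10_grad u g \<Longrightarrow> is_weak_grad u g"
  unfolding H10_grad_def using is_weak_grad_limit[OF test_is_weak_grad] by blast

lemma ip_diff_swap: "sqnorm (\<lambda>x. f x - g x) = sqnorm (\<lambda>x. g x - f x)"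
  unfolding ip_def power2_norm_eq_inner[symmetric] by (simp only: norm_minus_commute)

lemma is_weak_grad_add:
  fixes u v :: "real ^ 'n \<Rightarrow> real"
  assumes "u \<in> L2" "v \<in> L2" "is_weak_grad u g" "is_weak_grad v k"
  shows "is_weak_grad (\<lambda>x. u x + v x) (\<lambda>x. g x + k x)"
proof -
  have L2: "g \<in> L2" "k \<in> L2" using assms by (auto simp: is_weak_grad_def)
  have c: "(\<lambda>x. \<phi> x *\<^sub>R e) \<in> L2" if "\<phi> \<in> test_functions" for \<phi> and e :: "real ^ 'n"
    using that by (intro L2_scaleR_test L2_bounded[where K = "norm e"]) auto
  show ?thesis
    using assms L2 unfolding is_weak_grad_iff[OF L2_add[OF assms(1,2)]]
    by (auto simp: is_weak_grad_iff ip_add_left c L2_inner_const test_grad_L2 intro: L2_add)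
qed

lemma is_weak_grad_scale:
  fixes u :: "real ^ 'n \<Rightarrow> real"
  assumes "u \<in> L2" "is_weak_grad u g"
  shows "is_weak_grad (\<lambda>x. c *\<^sub>R u x) (\<lambda>x. c *\<^sub>R g x)"
  using assms unfolding is_weak_grad_iff[OF L2_scale[OF assms(1)]]
  by (auto simp: is_weak_grad_iff ip_scale_left intro: L2_scale simp del: real_scaleR_def)

lemma is_weak_grad_diff:
  fixes u v :: "real ^ 'n \<Rightarrow> real"
  assumes "u \<in> L2" "v \<in> L2" "is_weak_grad u g" "is_weak_grad v k"
  shows "is_weak_grad (\<lambda>x. u x - v x) (\<lambda>x. g x - k x)"
  using is_weak_grad_add[OF assms(1) L2_scale[OF assms(2)] assms(3) is_weak_grad_scale[OF assms(2,4)], of "-1"]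
  by simp

lemma is_weak_grad_L2: "is_weak_grad u g \<Longrightarrow> g \<in> L2"
  by (simp add: is_weak_grad_def)

lemma is_weak_grad_imp_weak_grad: "is_weak_grad u g \<Longrightarrow> is_weak_grad u (weak_grad u)"
  unfolding weak_grad_def by (rule someI[of "is_weak_grad u"])

lemma H1_is_weak_grad: "u \<in> H1 \<Longrightarrow> is_weak_grad u (weak_grad u)"
  by (auto simp: H1_def dest: is_weak_grad_imp_weak_grad)

text \<open>Uniqueness of the weak gradient makes the \<open>H\<^sup>1\<close> norm, defined through an arbitrarily chosen weak gradient,
  computable from any given one.\<close>

lemma H1_norm_diff_test:
  fixes u :: "real ^ 'n \<Rightarrow> real"
  assumes u: "u \<in> L2" "is_weak_grad u g" and \<phi>: "\<phi> \<in> test_functions"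
  shows "H1_norm (\<lambda>x. u x - \<phi> x) =
    ennreal (sqrt (sqnorm (\<lambda>x. \<phi> x - u x) + sqnorm (\<lambda>x. grad \<phi> x - g x)))"
proof -
  let ?v = "\<lambda>x. u x - \<phi> x" and ?g = "\<lambda>x. g x - grad \<phi> x"
  have vL2: "?v \<in> L2" using u(1) test_L2[OF \<phi>] by (rule L2_diff)
  have gw: "is_weak_grad ?v ?g"
    by (intro is_weak_grad_diff u test_L2 \<phi> test_is_weak_grad)
  have ww: "is_weak_grad ?v (weak_grad ?v)" using gw by (rule is_weak_grad_imp_weak_grad)
  have ae: "AE x in lebesgue_on \<Omega>. weak_grad ?v x = ?g x" using ww gw by (rule is_weak_grad_unique)
  note gL2 = is_weak_grad_L2[OF gw] and wL2 = is_weak_grad_L2[OF ww]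
  have "sqnorm (weak_grad ?v) = sqnorm ?g"
    by (rule ip_AE_cong[OF wL2 wL2 gL2 gL2 ae ae])
  then have "H1_norm ?v = ennreal (sqrt (sqnorm ?v + sqnorm ?g))"
    unfolding H1_norm_def L2_norm_eq[OF vL2] L2_norm_eq[OF wL2]
    by (simp add: ennreal_power ip_self_nonneg ennreal_sqrt_def flip: ennreal_plus)
  then show ?thesis
    by (simp only: ip_diff_swap[of u \<phi>] ip_diff_swap[of g "grad \<phi>"])
qed

lemma H10_imp_H10_grad:
  fixes u :: "real ^ 'n \<Rightarrow> real"
  assumes "u \<in> H10"
  shows "H10_grad u (weak_grad u)"
proof -
  have uL2: "u \<in> L2" and wg: "is_weak_grad u (weak_grad u)"
    using assms H1_is_weak_grad by (auto simp: H10_def H1_def)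
  have "\<exists>\<phi>\<in>test_functions. H1_norm (\<lambda>x. u x - \<phi> x) < ennreal (1 / real (Suc n))" for n
    using assms unfolding H10_def by auto
  then obtain \<phi> where \<phi>: "\<And>n. \<phi> n \<in> test_functions"
    "\<And>n. H1_norm (\<lambda>x. u x - \<phi> n x) < ennreal (1 / real (Suc n))" by metis
  have est: "sqnorm (\<lambda>x. \<phi> n x - u x) \<le> (1 / real (Suc n))\<^sup>2 \<and>
      sqnorm (\<lambda>x. grad (\<phi> n) x - weak_grad u x) \<le> (1 / real (Suc n))\<^sup>2" for n
  proof -
    let ?v = "\<lambda>x. \<phi> n x - u x" and ?g = "\<lambda>x. grad (\<phi> n) x - weak_grad u x"
    from \<phi>(2)[of n] have "sqrt (sqnorm ?v + sqnorm ?g) < 1 / real (Suc n)"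
      unfolding H1_norm_diff_test[OF uL2 wg \<phi>(1)] by (simp add: ip_self_nonneg ennreal_less_iff)
    then have "sqnorm ?v + sqnorm ?g < (1 / real (Suc n))\<^sup>2"
      using real_sqrt_less_iff[of "sqnorm ?v + sqnorm ?g" "(1 / real (Suc n))\<^sup>2"]
      by (simp only: real_sqrt_abs abs_of_nonneg of_nat_0_le_iff zero_le_divide_1_iff)
    then show ?thesis
      using ip_self_nonneg[of ?v] ip_self_nonneg[of ?g] by linarith
  qed
  have lim: "(\<lambda>n. (1 / real (Suc n))\<^sup>2) \<longlonglongrightarrow> 0"
    using tendsto_power[OF LIMSEQ_inverse_real_of_nat, of 2] by (simp add: divide_inverse)
  have "L2lim \<phi> u"
    by (rule L2limI[OF _ uL2 _ lim]) (use \<phi> est in \<open>auto intro: test_L2\<close>)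
  moreover have "L2lim (\<lambda>n. grad (\<phi> n)) (weak_grad u)"
    by (rule L2limI[OF _ is_weak_grad_L2[OF wg] _ lim]) (use \<phi> est in \<open>auto intro: test_grad_L2\<close>)
  ultimately show ?thesis using \<phi> unfolding H10_grad_def by blast
qed

lemma H10_gradD:
  fixes u :: "real ^ 'n \<Rightarrow> real"
  assumes "H10_grad u g"
  shows "u \<in> H10" "AE x in lebesgue_on \<Omega>. weak_grad u x = g x"
proof -
  note uL2 = H10_grad_L2(1)[OF assms]
  note wg = H10_grad_is_weak_grad[OF assms]
  show "AE x in lebesgue_on \<Omega>. weak_grad u x = g x"
    using is_weak_grad_imp_weak_grad[OF wg] wg by (rule is_weak_grad_unique)
  obtain \<phi> where \<phi>: "\<And>n. \<phi> n \<in> test_functions" and l: "L2lim \<phi> u" "L2lim (\<lambda>n. grad (\<phi> n)) g"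
    using assms unfolding H10_grad_def by blast
  have "\<exists>\<phi>\<in>test_functions. H1_norm (\<lambda>x. u x - \<phi> x) < ennreal \<epsilon>" if "\<epsilon> > 0" for \<epsilon>
  proof -
    have "(\<lambda>n. sqnorm (\<lambda>x. \<phi> n x - u x) + sqnorm (\<lambda>x. grad (\<phi> n) x - g x)) \<longlonglongrightarrow> 0 + 0"
      using l by (intro tendsto_add) (auto simp: L2lim_def)
    then have "\<forall>\<^sub>F n in sequentially. sqnorm (\<lambda>x. \<phi> n x - u x) + sqnorm (\<lambda>x. grad (\<phi> n) x - g x) < \<epsilon>\<^sup>2"
      using that by (intro order_tendstoD(2)) auto
    then obtain n where "sqnorm (\<lambda>x. \<phi> n x - u x) + sqnorm (\<lambda>x. grad (\<phi> n) x - g x) < \<epsilon>\<^sup>2"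
      using eventually_happens'[OF sequentially_bot] by blast
    then have "sqrt (sqnorm (\<lambda>x. \<phi> n x - u x) + sqnorm (\<lambda>x. grad (\<phi> n) x - g x)) < \<epsilon>"
      using that by (intro real_less_lsqrt) (auto simp: ip_self_nonneg)
    then have "H1_norm (\<lambda>x. u x - \<phi> n x) < ennreal \<epsilon>"
      unfolding H1_norm_diff_test[OF uL2 wg \<phi>] using that by (simp add: ennreal_less_iff ip_self_nonneg)
    then show ?thesis using \<phi> by blast
  qed
  then show "u \<in> H10" using uL2 wg by (auto simp: H10_def H1_def)
qed

lemma H10_grad_add:
  assumes "H10_grad u g" "H10_grad v k"
  shows "H10_grad (\<lambda>x. u x + v x) (\<lambda>x. g x + k x)"
proof -
  obtain \<phi> \<psi> where *: "\<And>n. \<phi> n \<in> test_functions" "L2lim \<phi> u" "L2lim (\<lambda>n. grad (\<phi> n)) g"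
    "\<And>n. \<psi> n \<in> test_functions" "L2lim \<psi> v" "L2lim (\<lambda>n. grad (\<psi> n)) k"
    using assms unfolding H10_grad_def by blast
  have "(\<lambda>n. grad (\<lambda>x. \<phi> n x + \<psi> n x)) = (\<lambda>n x. grad (\<phi> n) x + grad (\<psi> n) x)"
    using test_add(2)[OF *(1) *(4)] by (intro ext)
  then show ?thesis
    unfolding H10_grad_def
    using test_add(1)[OF *(1) *(4)] L2lim_add[OF *(2) *(5)] L2lim_add[OF *(3) *(6)]
    by (intro exI[of _ "\<lambda>n x. \<phi> n x + \<psi> n x"]) auto
qed

lemma H10_grad_scale:
  assumes "H10_grad u g"
  shows "H10_grad (\<lambda>x. c *\<^sub>R u x) (\<lambda>x. c *\<^sub>R g x)"
proof -
  obtain \<phi> where *: "\<And>n. \<phi> n \<in> test_functions" "L2lim \<phi> u" "L2lim (\<lambda>n. grad (\<phi> n)) g"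
    using assms unfolding H10_grad_def by blast
  have "(\<lambda>n. grad (\<lambda>x. c *\<^sub>R \<phi> n x)) = (\<lambda>n x. c *\<^sub>R grad (\<phi> n) x)"
    using test_scale(2)[OF *(1)] by (intro ext)
  then show ?thesis
    unfolding H10_grad_def
    using test_scale(1)[OF *(1)] L2lim_scale[OF *(2)] L2lim_scale[OF *(3)]
    by (intro exI[of _ "\<lambda>n x. c *\<^sub>R \<phi> n x"]) auto
qed

lemma H10_grad_diff:
  assumes "H10_grad u g" "H10_grad v k"
  shows "H10_grad (\<lambda>x. u x - v x) (\<lambda>x. g x - k x)"
  using H10_grad_add[OF assms(1) H10_grad_scale[OF assms(2), of "-1"]] by simp

lemma H10_grad_test: "\<phi> \<in> test_functions \<Longrightarrow> H10_grad \<phi> (grad \<phi>)"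
  unfolding H10_grad_def by (intro exI[of _ "\<lambda>n. \<phi>"]) (auto intro: L2lim_const test_L2 test_grad_L2)

lemma H10_grad_zero: "H10_grad (\<lambda>x :: real ^ 'n. 0) (\<lambda>x. 0)"
proof -
  have "(\<lambda>x :: real ^ 'n. 0) \<in> test_functions" by (auto simp: test_functions_def C_k_const)
  moreover have "grad (\<lambda>x :: real ^ 'n. 0) = (\<lambda>x. 0)" by (intro ext grad_eq GDERIV_const)
  ultimately show ?thesis using H10_grad_test by metis
qed

text \<open>A diagonal argument: approximate the \<open>n\<close>-th member of the sequence by a test function to within \<open>1 / Suc n\<close>.\<close>

lemma H10_grad_limit:
  assumes "\<And>n. H10_grad (us n) (gs n)" "L2lim us u" "L2lim gs g"
  shows "H10_grad u g"
proof -
  have "\<exists>\<phi>\<in>test_functions. sqnorm (\<lambda>x. \<phi> x - us n x) < 1 / real (Suc n) \<and>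
      sqnorm (\<lambda>x. grad \<phi> x - gs n x) < 1 / real (Suc n)" for n
  proof -
    obtain \<phi> where *: "\<And>m. \<phi> m \<in> test_functions" "L2lim \<phi> (us n)" "L2lim (\<lambda>m. grad (\<phi> m)) (gs n)"
      using assms(1)[of n] unfolding H10_grad_def by blast
    have "\<forall>\<^sub>F m in sequentially. sqnorm (\<lambda>x. \<phi> m x - us n x) < 1 / real (Suc n)"
      using *(2) by (intro order_tendstoD(2)[of _ 0]) (auto simp: L2lim_def)
    moreover have "\<forall>\<^sub>F m in sequentially. sqnorm (\<lambda>x. grad (\<phi> m) x - gs n x) < 1 / real (Suc n)"
      using *(3) by (intro order_tendstoD(2)[of _ 0]) (auto simp: L2lim_def)
    ultimately have "\<forall>\<^sub>F m in sequentially. sqnorm (\<lambda>x. \<phi> m x - us n x) < 1 / real (Suc n) \<and>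
      sqnorm (\<lambda>x. grad (\<phi> m) x - gs n x) < 1 / real (Suc n)"
      by (rule eventually_conj)
    from eventually_happens'[OF sequentially_bot this] show ?thesis using *(1) by blast
  qed
  then have "\<forall>n. \<exists>\<phi>. \<phi> \<in> test_functions \<and> sqnorm (\<lambda>x. \<phi> x - us n x) < 1 / real (Suc n) \<and>
      sqnorm (\<lambda>x. grad \<phi> x - gs n x) < 1 / real (Suc n)"
    by blast
  from choice[OF this] obtain \<phi> where \<phi>: "\<And>n. \<phi> n \<in> test_functions"
    "\<And>n. sqnorm (\<lambda>x. \<phi> n x - us n x) < 1 / real (Suc n)"
    "\<And>n. sqnorm (\<lambda>x. grad (\<phi> n) x - gs n x) < 1 / real (Suc n)"
    by blast
  have lim: "(\<lambda>n. 1 / real (Suc n)) \<longlonglongrightarrow> 0"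
    using LIMSEQ_inverse_real_of_nat by (simp add: divide_inverse)
  note uL2 = H10_grad_L2(1)[OF assms(1)] and gL2 = H10_grad_L2(2)[OF assms(1)]
  have "(\<lambda>x. \<phi> n x - us n x) \<in> L2" "(\<lambda>x. grad (\<phi> n) x - gs n x) \<in> L2" for n
    by (rule L2_diff[OF test_L2[OF \<phi>(1)] uL2]) (rule L2_diff[OF test_grad_L2[OF \<phi>(1)] gL2])
  note d = this
  have a: "L2lim (\<lambda>n x. \<phi> n x - us n x) (\<lambda>x. 0)"
    by (rule L2limI[OF d(1) L2_zero _ lim]) (use \<phi>(2) in \<open>simp add: less_imp_le\<close>)
  have b: "L2lim (\<lambda>n x. grad (\<phi> n) x - gs n x) (\<lambda>x. 0)"
    by (rule L2limI[OF d(2) L2_zero _ lim]) (use \<phi>(3) in \<open>simp add: less_imp_le\<close>)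
  have "L2lim \<phi> u" using L2lim_add[OF a assms(2)] by simp
  moreover have "L2lim (\<lambda>n. grad (\<phi> n)) g" using L2lim_add[OF b assms(3)] by simp
  ultimately show ?thesis using \<phi>(1) unfolding H10_grad_def by blast
qed

section \<open>The Poincare inequality on convex sets\<close>

text \<open>Integrate the derivative along the segment from \<open>y\<close> to \<open>x\<close>; the square of a mean over the unit interval is at
  most the mean of the squares.\<close>

lemma segment_estimate:
  fixes f :: "real ^ 'n \<Rightarrow> real"
  assumes G: "\<And>x. GDERIV f x :> G x" and cont: "continuous_on UNIV G"
  shows "ennreal ((f x - f y)\<^sup>2) \<le>
    (\<integral>\<^sup>+s. indicator {0..1} s * ennreal ((norm (x - y))\<^sup>2 * (norm (G (y + s *\<^sub>R (x - y))))\<^sup>2) \<partial>lborel)"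
proof -
  define h where "h s = (x - y) \<bullet> G (y + s *\<^sub>R (x - y))" for s :: real
  define k where "k s = (norm (x - y))\<^sup>2 * (norm (G (y + s *\<^sub>R (x - y))))\<^sup>2" for s :: real
  have cG: "continuous_on {0..1} (\<lambda>s. G (y + s *\<^sub>R (x - y)))"
    by (rule continuous_on_compose2[OF cont]) (auto intro!: continuous_intros)
  then have ch: "continuous_on {0..1} h" and ck: "continuous_on {0..1} k"
    unfolding h_def k_def by (intro continuous_intros; assumption)+
  have "(h has_integral f (y + 1 *\<^sub>R (x - y)) - f (y + 0 *\<^sub>R (x - y))) {0..1}"
  proof (rule fundamental_theorem_of_calculus)
    show "((\<lambda>s. f (y + s *\<^sub>R (x - y))) has_vector_derivative h s) (at s within {0..1})" for s
    proof -
      have "((\<lambda>s. f (y + s *\<^sub>R (x - y))) has_derivative (\<lambda>r. (r *\<^sub>R (x - y)) \<bullet> G (y + s *\<^sub>R (x - y)))) (at s within {0..1})"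
        using G[of "y + s *\<^sub>R (x - y)"] unfolding gderiv_def
        by (intro has_derivative_compose[where g = f and f = "\<lambda>s. y + s *\<^sub>R (x - y)"])
           (auto intro!: derivative_eq_intros)
      then show ?thesis
        by (simp add: has_vector_derivative_def h_def)
    qed
  qed simp
  then have I: "(h has_integral (f x - f y)) {0..1}" by simp
  define m where "m = f x - f y"
  have ih: "h integrable_on {0..1}" and ih2: "(\<lambda>s. (h s)\<^sup>2) integrable_on {0..1}" and ik: "k integrable_on {0..1}"
    using ch ck by (auto intro!: integrable_continuous_real continuous_intros)
  have "0 \<le> integral {0..1} (\<lambda>s. (h s - m)\<^sup>2)"
    by (intro integral_nonneg integrable_continuous_real continuous_intros ch) auto
  also have "\<dots> = integral {0..1} (\<lambda>s. ((h s)\<^sup>2 - (2 * m) * h s) + m\<^sup>2)"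
    by (intro integral_cong) (simp add: power2_diff)
  also have "\<dots> = integral {0..1} (\<lambda>s. (h s)\<^sup>2) - (2 * m) * m + m\<^sup>2"
    using I ih ih2 by (subst Henstock_Kurzweil_Integration.integral_add Henstock_Kurzweil_Integration.integral_diff
       integral_mult_right; auto intro!: Henstock_Kurzweil_Integration.integrable_diff integrable_on_mult_right
       simp: m_def integral_unique)+
  also have "\<dots> = integral {0..1} (\<lambda>s. (h s)\<^sup>2) - m\<^sup>2"
    by (simp add: power2_eq_square)
  also have "integral {0..1} (\<lambda>s. (h s)\<^sup>2) \<le> integral {0..1} k"
  proof (rule integral_le[OF ih2 ik])
    show "(h s)\<^sup>2 \<le> k s" for s
      using power_mono[OF Cauchy_Schwarz_ineq2[of "x - y" "G (y + s *\<^sub>R (x - y))"], of 2]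
      by (simp add: h_def k_def power_mult_distrib)
  qed
  finally have le: "m\<^sup>2 \<le> integral {0..1} k" by simp
  have "(\<integral>\<^sup>+s. indicator {0..1} s * ennreal (k s) \<partial>lborel) = (\<integral>\<^sup>+s. ennreal (indicator {0..1} s * k s) \<partial>lborel)"
    by (intro nn_integral_cong) (auto simp: indicator_def)
  also have "\<dots> = ennreal (integral {0..1} k)"
    using nn_integral_has_integral_lebesgue[of "{0..1}" k "integral {0..1} k"] ik
    by (simp add: k_def integrable_integral nn_integral_completion)
  finally show ?thesis
    using le by (simp add: m_def k_def ennreal_leI)
qed

lemma nn_integral_affine_le:
  fixes F :: "real ^ 'n \<Rightarrow> ennreal"
  assumes [measurable]: "F \<in> borel_measurable borel" and c: "c \<ge> 1 / 2"
  shows "(\<integral>\<^sup>+x. F (t + c *\<^sub>R x) \<partial>lborel) \<le> 2 ^ CARD('n) * (\<integral>\<^sup>+x. F x \<partial>lborel)"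
proof -
  have "(\<integral>\<^sup>+x. F x \<partial>lborel) = (\<integral>\<^sup>+x. F x \<partial>density (distr lborel borel (\<lambda>x. t + c *\<^sub>R x)) (\<lambda>_. \<bar>c\<bar> ^ CARD('n)))"
    using lborel_affine[of c t] c by simp
  also have "\<dots> = ennreal (c ^ CARD('n)) * (\<integral>\<^sup>+x. F (t + c *\<^sub>R x) \<partial>lborel)"
    using c by (simp add: nn_integral_density nn_integral_distr nn_integral_cmult)
  finally have eq: "(\<integral>\<^sup>+x. F x \<partial>lborel) = ennreal (c ^ CARD('n)) * (\<integral>\<^sup>+x. F (t + c *\<^sub>R x) \<partial>lborel)" .
  have "1 \<le> (2 * c) ^ CARD('n)"
    by (rule one_le_power) (use c in simp)
  from ennreal_leI[OF this] have "1 \<le> ennreal ((2 * c) ^ CARD('n))"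
    by (simp only: ennreal_1)
  then have "1 * (\<integral>\<^sup>+x. F (t + c *\<^sub>R x) \<partial>lborel) \<le> ennreal ((2 * c) ^ CARD('n)) * (\<integral>\<^sup>+x. F (t + c *\<^sub>R x) \<partial>lborel)"
    by (rule mult_right_mono) simp
  also have "ennreal ((2 * c) ^ CARD('n)) = 2 ^ CARD('n) * ennreal (c ^ CARD('n))"
    using c by (simp add: power_mult_distrib ennreal_mult flip: ennreal_power)
  finally show ?thesis by (simp add: eq mult.assoc)
qed

text \<open>The substitution \<open>z = y + s * (x - y)\<close> in \<open>x\<close> costs a Jacobian \<open>s\<close> to the power of minus the dimension, which
  is harmless for \<open>s \<ge> 1/2\<close>. For smaller \<open>s\<close> the roles of \<open>x\<close> and \<open>y\<close> are exchanged. Convexity keeps \<open>z\<close>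
  inside \<open>Q\<close>.\<close>

lemma convex_average_estimate:
  fixes F :: "real ^ 'n \<Rightarrow> ennreal" and Q :: "(real ^ 'n) set"
  assumes F[measurable]: "F \<in> borel_measurable borel" and Q[measurable]: "Q \<in> sets borel" and conv: "convex Q"
    and s: "0 \<le> s" "s \<le> 1"
  shows "(\<integral>\<^sup>+x. \<integral>\<^sup>+y. indicator Q x * indicator Q y * F (y + s *\<^sub>R (x - y)) \<partial>lborel \<partial>lborel)
    \<le> 2 ^ CARD('n) * emeasure lborel Q * (\<integral>\<^sup>+x. indicator Q x * F x \<partial>lborel)"
proof -
  let ?I = "\<integral>\<^sup>+x. indicator Q x * F x \<partial>lborel"
  have in_Q: "y + s *\<^sub>R (x - y) \<in> Q" if "x \<in> Q" "y \<in> Q" for x y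
    using convexD_alt[OF conv that(2,1) s] by (simp add: algebra_simps)
  have half: "(\<integral>\<^sup>+x. \<integral>\<^sup>+y. indicator Q x * indicator Q y * F ((1 - c) *\<^sub>R x + c *\<^sub>R y) \<partial>lborel \<partial>lborel)
      \<le> 2 ^ CARD('n) * emeasure lborel Q * ?I" if c: "1/2 \<le> c" "c \<le> 1" for c
  proof -
    have "(\<integral>\<^sup>+y. indicator Q x * indicator Q y * F ((1 - c) *\<^sub>R x + c *\<^sub>R y) \<partial>lborel)
      \<le> indicator Q x * (2 ^ CARD('n) * ?I)" for x
    proof -
      have "(\<integral>\<^sup>+y. indicator Q x * indicator Q y * F ((1 - c) *\<^sub>R x + c *\<^sub>R y) \<partial>lborel)
        \<le> (\<integral>\<^sup>+y. indicator Q x * (indicator Q ((1 - c) *\<^sub>R x + c *\<^sub>R y) * F ((1 - c) *\<^sub>R x + c *\<^sub>R y)) \<partial>lborel)"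
        using convexD_alt[OF conv, of x _ c] c
        by (intro nn_integral_mono) (auto simp: indicator_def)
      also have "\<dots> = indicator Q x * (\<integral>\<^sup>+y. indicator Q ((1 - c) *\<^sub>R x + c *\<^sub>R y) * F ((1 - c) *\<^sub>R x + c *\<^sub>R y) \<partial>lborel)"
        by (intro nn_integral_cmult) measurable
      also have "\<dots> \<le> indicator Q x * (2 ^ CARD('n) * ?I)"
        by (intro mult_left_mono nn_integral_affine_le[where F = "\<lambda>z. indicator Q z * F z"] c(1)) auto
      finally show ?thesis .
    qed
    then have "(\<integral>\<^sup>+x. \<integral>\<^sup>+y. indicator Q x * indicator Q y * F ((1 - c) *\<^sub>R x + c *\<^sub>R y) \<partial>lborel \<partial>lborel)
      \<le> (\<integral>\<^sup>+x. indicator Q x * (2 ^ CARD('n) * ?I) \<partial>lborel)"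
      by (rule nn_integral_mono)
    also have "\<dots> = 2 ^ CARD('n) * emeasure lborel Q * ?I"
      by (simp add: nn_integral_multc mult_ac)
    finally show ?thesis .
  qed
  show ?thesis
  proof (cases "s \<le> 1/2")
    case True
    have "y + s *\<^sub>R (x - y) = (1 - (1 - s)) *\<^sub>R x + (1 - s) *\<^sub>R y" for x y :: "real ^ 'n"
      by (simp add: algebra_simps)
    then show ?thesis using half[of "1 - s"] True s by simp
  next
    case False
    have "(\<integral>\<^sup>+x. \<integral>\<^sup>+y. indicator Q x * indicator Q y * F (y + s *\<^sub>R (x - y)) \<partial>lborel \<partial>lborel)
       = (\<integral>\<^sup>+y. \<integral>\<^sup>+x. indicator Q x * indicator Q y * F (y + s *\<^sub>R (x - y)) \<partial>lborel \<partial>lborel)"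
      by (rule lborel_pair.Fubini') measurable
    moreover have "indicator Q x * indicator Q y * F (y + s *\<^sub>R (x - y)) = indicator Q y * indicator Q x * F ((1 - s) *\<^sub>R y + s *\<^sub>R x)" for x y :: "real ^ 'n"
      by (simp add: algebra_simps)
    ultimately show ?thesis using half[of s] False s by simp
  qed
qed

text \<open>Integrate the segment estimate over both end points and exchange the order of integration.\<close>

lemma Poincare_double_integral:
  fixes f :: "real ^ 'n \<Rightarrow> real" and Q :: "(real ^ 'n) set"
  assumes G: "\<And>x. GDERIV f x :> G x" and cont: "continuous_on UNIV G"
    and Q[measurable]: "Q \<in> sets borel" and conv: "convex Q" and diam: "\<And>x y. x \<in> Q \<Longrightarrow> y \<in> Q \<Longrightarrow> (norm (x - y))\<^sup>2 \<le> D"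
  shows "(\<integral>\<^sup>+x. \<integral>\<^sup>+y. indicator Q x * indicator Q y * ennreal ((f x - f y)\<^sup>2) \<partial>lborel \<partial>lborel)
    \<le> ennreal D * (2 ^ CARD('n) * emeasure lborel Q * (\<integral>\<^sup>+x. indicator Q x * ennreal ((norm (G x))\<^sup>2) \<partial>lborel))"
proof -
  have [measurable]: "G \<in> borel_measurable borel" using cont by (rule borel_measurable_continuous_onI)
  have "continuous_on UNIV f" by (intro continuous_at_imp_continuous_on ballI GDERIV_isCont[OF G])
  then have [measurable]: "f \<in> borel_measurable borel" by (rule borel_measurable_continuous_onI)
  define F where "F z = ennreal ((norm (G z))\<^sup>2)" for z
  have [measurable]: "F \<in> borel_measurable borel" unfolding F_def by measurable
  define g where "g s x y = indicator Q x * indicator Q y * F (y + s *\<^sub>R (x - y))" for s :: real and x y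
  have [measurable (raw)]: "(\<lambda>z. g (a z) (b z) (c z)) \<in> borel_measurable N"
    if [measurable]: "a \<in> N \<rightarrow>\<^sub>M borel" "b \<in> N \<rightarrow>\<^sub>M borel" "c \<in> N \<rightarrow>\<^sub>M borel"
    for a b c and N :: "'c measure"
    unfolding g_def by measurable
  have *: "indicator Q x * indicator Q y * ennreal ((f x - f y)\<^sup>2)
     \<le> (\<integral>\<^sup>+s. ennreal D * (indicator {0..1} s * g s x y) \<partial>lborel)" for x y
  proof (cases "x \<in> Q \<and> y \<in> Q")
    case True
    have "ennreal ((f x - f y)\<^sup>2) \<le>
        (\<integral>\<^sup>+s. indicator {0..1} s * ennreal ((norm (x - y))\<^sup>2 * (norm (G (y + s *\<^sub>R (x - y))))\<^sup>2) \<partial>lborel)"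
      by (rule segment_estimate[OF G cont])
    also have "\<dots> \<le> (\<integral>\<^sup>+s. ennreal D * (indicator {0..1} s * F (y + s *\<^sub>R (x - y))) \<partial>lborel)"
    proof (rule nn_integral_mono)
      fix s :: real
      have "ennreal ((norm (x - y))\<^sup>2 * (norm (G (y + s *\<^sub>R (x - y))))\<^sup>2) \<le> ennreal D * F (y + s *\<^sub>R (x - y))"
        unfolding F_def using True diam[of x y] order_trans[OF zero_le_power2 diam[of x y]]
        by (simp add: ennreal_mult mult_right_mono)
      then show "indicator {0..1} s * ennreal ((norm (x - y))\<^sup>2 * (norm (G (y + s *\<^sub>R (x - y))))\<^sup>2)
         \<le> ennreal D * (indicator {0..1} s * F (y + s *\<^sub>R (x - y)))"
        by (simp add: indicator_def)
    qed
    finally show ?thesis using True by (simp add: g_def)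
  qed auto
  have "(\<integral>\<^sup>+x. \<integral>\<^sup>+y. indicator Q x * indicator Q y * ennreal ((f x - f y)\<^sup>2) \<partial>lborel \<partial>lborel)
    \<le> (\<integral>\<^sup>+x. \<integral>\<^sup>+y. (\<integral>\<^sup>+s. ennreal D * (indicator {0..1} s * g s x y) \<partial>lborel) \<partial>lborel \<partial>lborel)"
    by (intro nn_integral_mono *)
  also have "\<dots> = (\<integral>\<^sup>+x. \<integral>\<^sup>+s. (\<integral>\<^sup>+y. ennreal D * (indicator {0..1} s * g s x y) \<partial>lborel) \<partial>lborel \<partial>lborel)"
    by (intro nn_integral_cong lborel_pair.Fubini') measurable
  also have "\<dots> = (\<integral>\<^sup>+s. \<integral>\<^sup>+x. (\<integral>\<^sup>+y. ennreal D * (indicator {0..1} s * g s x y) \<partial>lborel) \<partial>lborel \<partial>lborel)"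
    by (intro lborel_pair.Fubini') measurable
  also have "\<dots> = (\<integral>\<^sup>+s. ennreal D * (indicator {0..1} s * (\<integral>\<^sup>+x. (\<integral>\<^sup>+y. g s x y \<partial>lborel) \<partial>lborel)) \<partial>lborel)"
    by (simp add: nn_integral_cmult)
  also have "\<dots> \<le> (\<integral>\<^sup>+(s::real). ennreal D * (indicator {0..1} s * (2 ^ CARD('n) * emeasure lborel Q * (\<integral>\<^sup>+x. indicator Q x * F x \<partial>lborel))) \<partial>lborel)"
  proof (rule nn_integral_mono, rule mult_left_mono)
    fix s :: real
    show "indicator {0..1} s * (\<integral>\<^sup>+x. (\<integral>\<^sup>+y. g s x y \<partial>lborel) \<partial>lborel) \<le>
      indicator {0..1} s * (2 ^ CARD('n) * emeasure lborel Q * (\<integral>\<^sup>+x. indicator Q x * F x \<partial>lborel))"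
      unfolding g_def using convex_average_estimate[OF _ Q conv, of F s]
      by (auto simp: indicator_def)
  qed simp
  also have "\<dots> = ennreal D * (2 ^ CARD('n) * emeasure lborel Q * (\<integral>\<^sup>+x. indicator Q x * F x \<partial>lborel))"
    by (simp add: nn_integral_cmult nn_integral_multc)
  finally show ?thesis by (simp add: F_def)
qed

lemma integrable_indicator_bounded:
  fixes h :: "real ^ 'n \<Rightarrow> real"
  assumes "Q \<in> sets borel" "emeasure lborel Q < \<infinity>" "h \<in> borel_measurable borel" "\<And>x. \<bar>h x\<bar> \<le> B"
  shows "integrable lborel (\<lambda>x. indicator Q x * h x)"
proof -
  have "integrable lborel (\<lambda>x. indicator Q x *\<^sub>R h x)"
    by (rule integrableI_bounded_set_indicator[where B = B]) (use assms in auto)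
  then show ?thesis by simp
qed

text \<open>The double integral of \<open>(\<phi> x - \<phi> y)\<^sup>2\<close> over \<open>Q \<times> Q\<close> is twice the left-hand side.\<close>

lemma Poincare_test:
  fixes \<phi> :: "real ^ 'n \<Rightarrow> real" and Q :: "(real ^ 'n) set"
  assumes \<phi>: "\<phi> \<in> test_functions" and Q: "Q \<in> sets borel" "emeasure lborel Q < \<infinity>" and conv: "convex Q"
    and D: "0 \<le> D" and diam: "\<And>x y. x \<in> Q \<Longrightarrow> y \<in> Q \<Longrightarrow> (norm (x - y))\<^sup>2 \<le> D"
  shows "measure lborel Q * sqnorm_on Q \<phi> - (ip (indicator Q) \<phi>)\<^sup>2
    \<le> D * 2 ^ CARD('n) * measure lborel Q * sqnorm_on Q (grad \<phi>)"
proof -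
  obtain B where B: "B \<ge> 0" "\<And>x. norm (\<phi> x) \<le> B" "\<And>x. norm (grad \<phi> x) \<le> B"
    using test_bounded[OF \<phi>] by blast
  have m\<phi>[measurable]: "\<phi> \<in> borel_measurable borel"
    by (rule borel_measurable_continuous_onI[OF test_continuous[OF \<phi>]])
  have mg[measurable]: "grad \<phi> \<in> borel_measurable borel"
    by (rule borel_measurable_continuous_onI[OF test_grad_continuous[OF \<phi>]])
  note [measurable] = Q(1)
  define q where "q = (indicator Q :: real ^ 'n \<Rightarrow> real)"
  define \<mu> where "\<mu> = measure lborel Q"
  define m where "m = (LINT x|lborel. q x * \<phi> x)"
  define s where "s = (LINT x|lborel. q x * (\<phi> x)\<^sup>2)"
  define k where "k = (LINT x|lborel. q x * (norm (grad \<phi> x))\<^sup>2)"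
  have i0: "integrable lborel q" unfolding q_def using Q by (intro integrable_real_indicator) simp_all
  have i1: "integrable lborel (\<lambda>x. q x * \<phi> x)"
    unfolding q_def by (rule integrable_indicator_bounded[OF Q m\<phi>]) (use B in auto)
  have i2: "integrable lborel (\<lambda>x. q x * (\<phi> x)\<^sup>2)"
    unfolding q_def
    by (rule integrable_indicator_bounded[OF Q, where B = "B\<^sup>2"]) (use B power_mono[OF B(2), of _ 2] in auto)
  have i3: "integrable lborel (\<lambda>x. q x * (norm (grad \<phi> x))\<^sup>2)"
    unfolding q_def
    by (rule integrable_indicator_bounded[OF Q, where B = "B\<^sup>2"]) (use B power_mono[OF B(3), of _ 2] in auto)
  have int_q: "(LINT x|lborel. q x) = \<mu>" unfolding q_def \<mu>_def by simp
  define w where "w x = \<mu> * (\<phi> x)\<^sup>2 - 2 * m * \<phi> x + s" for x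
  have inner_int: "integrable lborel (\<lambda>y. q y * (\<phi> x - \<phi> y)\<^sup>2)"
    and inner_eq: "(LINT y|lborel. q y * (\<phi> x - \<phi> y)\<^sup>2) = w x" for x
  proof -
    have eq: "(\<lambda>y. q y * (\<phi> x - \<phi> y)\<^sup>2) = (\<lambda>y. (\<phi> x)\<^sup>2 * q y - (2 * \<phi> x) * (q y * \<phi> y) + q y * (\<phi> y)\<^sup>2)"
      by (simp add: fun_eq_iff power2_diff algebra_simps)
    show "integrable lborel (\<lambda>y. q y * (\<phi> x - \<phi> y)\<^sup>2)"
      unfolding eq by (intro Bochner_Integration.integrable_add Bochner_Integration.integrable_diff integrable_mult_right i0 i1 i2)
    show "(LINT y|lborel. q y * (\<phi> x - \<phi> y)\<^sup>2) = w x"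
      unfolding eq
      by (subst Bochner_Integration.integral_add Bochner_Integration.integral_diff;
          (intro Bochner_Integration.integrable_diff integrable_mult_right i0 i1 i2)?)+
        (simp add: w_def int_q m_def s_def)
  qed
  have q0: "0 \<le> q x" for x by (simp add: q_def)
  have w0: "0 \<le> w x" for x unfolding inner_eq[symmetric] using q0 by simp
  have "(\<integral>\<^sup>+x. \<integral>\<^sup>+y. indicator Q x * indicator Q y * ennreal ((\<phi> x - \<phi> y)\<^sup>2) \<partial>lborel \<partial>lborel)
      = (\<integral>\<^sup>+x. ennreal (q x * w x) \<partial>lborel)"
  proof (rule nn_integral_cong)
    fix x
    have "(\<integral>\<^sup>+y. indicator Q x * indicator Q y * ennreal ((\<phi> x - \<phi> y)\<^sup>2) \<partial>lborel)
       = (\<integral>\<^sup>+y. ennreal (q x) * ennreal (q y * (\<phi> x - \<phi> y)\<^sup>2) \<partial>lborel)"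
      by (intro nn_integral_cong) (auto simp: q_def indicator_def)
    also have "\<dots> = ennreal (q x) * (\<integral>\<^sup>+y. ennreal (q y * (\<phi> x - \<phi> y)\<^sup>2) \<partial>lborel)"
      unfolding q_def by (intro nn_integral_cmult) measurable
    also have "(\<integral>\<^sup>+y. ennreal (q y * (\<phi> x - \<phi> y)\<^sup>2) \<partial>lborel) = ennreal (w x)"
      unfolding inner_eq[symmetric] using q0 by (intro nn_integral_eq_integral inner_int) simp
    also have "ennreal (q x) * ennreal (w x) = ennreal (q x * w x)"
      using q0 w0 by (simp add: ennreal_mult)
    finally show "(\<integral>\<^sup>+y. indicator Q x * indicator Q y * ennreal ((\<phi> x - \<phi> y)\<^sup>2) \<partial>lborel) = ennreal (q x * w x)" .
  qed
  also have "\<dots> = ennreal (2 * (\<mu> * s - m\<^sup>2))"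
  proof -
    have eq: "(\<lambda>x. q x * w x) = (\<lambda>x. \<mu> * (q x * (\<phi> x)\<^sup>2) - (2 * m) * (q x * \<phi> x) + s * q x)"
      by (simp add: fun_eq_iff w_def algebra_simps)
    have "integrable lborel (\<lambda>x. q x * w x)"
      unfolding eq by (intro Bochner_Integration.integrable_add Bochner_Integration.integrable_diff integrable_mult_right i0 i1 i2)
    then have "(\<integral>\<^sup>+x. ennreal (q x * w x) \<partial>lborel) = ennreal (LINT x|lborel. q x * w x)"
      using q0 w0 by (intro nn_integral_eq_integral) auto
    also have "(LINT x|lborel. q x * w x) = 2 * (\<mu> * s - m\<^sup>2)"
      unfolding eq
      by (subst Bochner_Integration.integral_add Bochner_Integration.integral_diff;
          (intro Bochner_Integration.integrable_diff integrable_mult_right i0 i1 i2)?)+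
        (simp add: int_q flip: m_def s_def, simp add: power2_eq_square)
    finally show ?thesis .
  qed
  finally have "ennreal (2 * (\<mu> * s - m\<^sup>2)) \<le>
    ennreal D * (2 ^ CARD('n) * emeasure lborel Q * (\<integral>\<^sup>+x. indicator Q x * ennreal ((norm (grad \<phi> x))\<^sup>2) \<partial>lborel))"
    using Poincare_double_integral[OF test_GDERIV[OF \<phi>] test_grad_continuous[OF \<phi>] Q(1) conv diam]
    by simp
  also have "(\<integral>\<^sup>+x. indicator Q x * ennreal ((norm (grad \<phi> x))\<^sup>2) \<partial>lborel)
      = (\<integral>\<^sup>+x. ennreal (q x * (norm (grad \<phi> x))\<^sup>2) \<partial>lborel)"
    by (intro nn_integral_cong) (auto simp: q_def indicator_def)
  also have "\<dots> = ennreal k"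
    unfolding k_def using q0 by (intro nn_integral_eq_integral i3) simp
  also have "emeasure lborel Q = ennreal \<mu>"
    unfolding \<mu>_def using Q(2) by (intro emeasure_eq_ennreal_measure) simp
  also have "(2::ennreal) ^ CARD('n) = ennreal (2 ^ CARD('n))"
    by (simp flip: ennreal_power)
  finally have le1: "ennreal (2 * (\<mu> * s - m\<^sup>2)) \<le> ennreal D * (ennreal (2 ^ CARD('n)) * ennreal \<mu> * ennreal k)" .
  have k0: "0 \<le> k" unfolding k_def using q0 by (intro Bochner_Integration.integral_nonneg) simp
  have \<mu>0: "0 \<le> \<mu>" by (simp add: \<mu>_def)
  have "ennreal D * (ennreal (2 ^ CARD('n)) * ennreal \<mu> * ennreal k) = ennreal (D * (2 ^ CARD('n) * \<mu> * k))"
    using D k0 \<mu>0 by (simp add: ennreal_mult)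
  with le1 have "ennreal (2 * (\<mu> * s - m\<^sup>2)) \<le> ennreal (D * (2 ^ CARD('n) * \<mu> * k))"
    by (simp only:)
  then have "2 * (\<mu> * s - m\<^sup>2) \<le> D * (2 ^ CARD('n) * \<mu> * k)"
    using D k0 \<mu>0 by (subst (asm) ennreal_le_iff) auto
  moreover have "0 \<le> D * (2 ^ CARD('n) * \<mu> * k)" using D k0 \<mu>0 by simp
  moreover have "a \<le> b" if "2 * a \<le> b" "0 \<le> b" for a b :: real using that by linarith
  ultimately have le: "\<mu> * s - m\<^sup>2 \<le> D * (2 ^ CARD('n) * \<mu> * k)" by blast
  have "sqnorm_on Q \<phi> = s"
    unfolding ip_def s_def q_def
    by (subst integral_Omega_lborel) (use test_zero_Omega[OF \<phi>] in \<open>auto simp: power2_eq_square mult_ac\<close>)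
  moreover have "ip (indicator Q) \<phi> = m"
    unfolding ip_def m_def q_def
    by (subst integral_Omega_lborel) (use test_zero_Omega[OF \<phi>] in \<open>auto simp: power2_eq_square mult_ac\<close>)
  moreover have "sqnorm_on Q (grad \<phi>) = k"
    unfolding ip_def k_def q_def
    by (subst integral_Omega_lborel) (use test_zero_Omega[OF \<phi>] in \<open>auto simp: power2_norm_eq_inner\<close>)
  ultimately show ?thesis using le by (simp add: \<mu>_def mult.assoc)
qed

lemma indicator_L2:
  assumes "Q \<in> sets borel"
  shows "(indicator Q :: real ^ 'n \<Rightarrow> real) \<in> borel_measurable (lebesgue_on \<Omega>)" "(indicator Q :: real ^ 'n \<Rightarrow> real) \<in> L2"
proof -
  have "(indicator Q :: real ^ 'n \<Rightarrow> real) \<in> borel_measurable lebesgue"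
    using assms by (intro borel_measurable_indicator) simp
  then show m: "(indicator Q :: real ^ 'n \<Rightarrow> real) \<in> borel_measurable (lebesgue_on \<Omega>)"
    by (rule measurable_restrict_space1)
  show "(indicator Q :: real ^ 'n \<Rightarrow> real) \<in> L2"
    by (rule L2_bounded[OF m, of 1]) (simp add: indicator_def)
qed

lemma L2_restrict:
  assumes "Q \<in> sets borel" "f \<in> L2"
  shows "(\<lambda>x. indicator Q x *\<^sub>R f x) \<in> L2"
  by (rule L2_bounded_mult[OF assms(2) indicator_L2(1)[OF assms(1)], of 1]) (simp add: indicator_def)

text \<open>Both sides are continuous for the convergence that defines \<^const>\<open>H10_grad\<close>. The weight must not enter
  before this step: the approximating test functions need not have bounded weighted energy.\<close>

lemma Poincare_H10:
  fixes u :: "real ^ 'n \<Rightarrow> real" and Q :: "(real ^ 'n) set"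
  assumes u: "H10_grad u g" and Q: "Q \<in> sets borel" "emeasure lborel Q < \<infinity>" and conv: "convex Q"
    and D: "0 \<le> D" "\<And>x y. x \<in> Q \<Longrightarrow> y \<in> Q \<Longrightarrow> (norm (x - y))\<^sup>2 \<le> D"
  shows "measure lborel Q * sqnorm_on Q u - (ip (indicator Q) u)\<^sup>2
    \<le> D * 2 ^ CARD('n) * measure lborel Q * sqnorm_on Q g"
proof -
  obtain \<phi> where \<phi>: "\<And>n. \<phi> n \<in> test_functions" and l: "L2lim \<phi> u" "L2lim (\<lambda>n. grad (\<phi> n)) g"
    using u unfolding H10_grad_def by blast
  have ind: "\<bar>indicator Q x :: real\<bar> \<le> 1" for x by (simp add: indicator_def)
  note restr = L2lim_bounded_mult[OF _ indicator_L2(1)[OF Q(1)] ind]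
  show ?thesis
  proof (rule LIMSEQ_le)
    show "(\<lambda>n. measure lborel Q * sqnorm_on Q (\<phi> n) - (ip (indicator Q) (\<phi> n))\<^sup>2)
      \<longlonglongrightarrow> measure lborel Q * sqnorm_on Q u - (ip (indicator Q) u)\<^sup>2"
      by (intro tendsto_diff tendsto_mult tendsto_const tendsto_power
          L2lim_ip[OF restr[OF l(1)] l(1)] L2lim_ip[OF L2lim_const[OF indicator_L2(2)[OF Q(1)]] l(1)])
    show "(\<lambda>n. D * 2 ^ CARD('n) * measure lborel Q * sqnorm_on Q (grad (\<phi> n)))
      \<longlonglongrightarrow> D * 2 ^ CARD('n) * measure lborel Q * sqnorm_on Q g"
      by (intro tendsto_mult[OF tendsto_const] L2lim_ip[OF restr[OF l(2)] l(2)])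
    show "\<exists>N. \<forall>n\<ge>N. measure lborel Q * sqnorm_on Q (\<phi> n) - (ip (indicator Q) (\<phi> n))\<^sup>2
       \<le> D * 2 ^ CARD('n) * measure lborel Q * sqnorm_on Q (grad (\<phi> n))"
      using Poincare_test[OF \<phi> Q conv D] by blast
  qed
qed

definition avg :: "(real ^ 'n) set \<Rightarrow> (real ^ 'n \<Rightarrow> real) \<Rightarrow> real" where
  "avg Q u = ip (indicator Q) u / measure lborel Q"

lemma ip_indicator_subset:
  assumes "R \<subseteq> Q"
  shows "ip (indicator R) (\<lambda>x. indicator Q x *\<^sub>R u x) = ip (indicator R) u"
  unfolding ip_def using assms by (intro Bochner_Integration.integral_cong) (auto simp: indicator_def)

lemma ip_indicator_self:
  fixes Q :: "(real ^ 'n) set"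
  assumes "Q \<in> sets borel" "Q \<subseteq> \<Omega>"
  shows "ip (indicator Q) (indicator Q :: real ^ 'n \<Rightarrow> real) = measure lborel Q"
proof -
  have "ip (indicator Q) (indicator Q :: real ^ 'n \<Rightarrow> real) = (LINT x|lebesgue_on \<Omega>. indicator Q x)"
    unfolding ip_def by (intro Bochner_Integration.integral_cong) (auto simp: indicator_def)
  also have "\<dots> = (LINT x|lborel. indicator Q x)"
    using assms by (intro integral_Omega_lborel) (auto simp: indicator_def)
  finally show ?thesis by simp
qed

text \<open>The left-hand side is the integral of \<open>(u - avg Q u)\<^sup>2\<close> over \<open>Q\<close>.\<close>

lemma Poincare_variance:
  fixes u :: "real ^ 'n \<Rightarrow> real" and Q :: "(real ^ 'n) set"
  assumes u: "H10_grad u g" and Q: "Q \<in> sets borel" "Q \<subseteq> \<Omega>" "measure lborel Q > 0" and conv: "convex Q"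
    and D: "0 \<le> D" "\<And>x y. x \<in> Q \<Longrightarrow> y \<in> Q \<Longrightarrow> (norm (x - y))\<^sup>2 \<le> D"
  shows "sqnorm_on Q u - measure lborel Q * (avg Q u)\<^sup>2
    \<le> D * 2 ^ CARD('n) * sqnorm_on Q g"
proof -
  have fin: "emeasure lborel Q < \<infinity>"
    using Q(3) by (cases "emeasure lborel Q = \<infinity>") (auto simp: measure_def less_top)
  have mu: "measure lborel Q * (sqnorm_on Q u - measure lborel Q * (avg Q u)\<^sup>2)
     = measure lborel Q * sqnorm_on Q u - (ip (indicator Q) u)\<^sup>2"
    using Q(3) unfolding avg_def power_divide power2_eq_square right_diff_distrib by simp
  have "measure lborel Q * sqnorm_on Q u - (ip (indicator Q) u)\<^sup>2
    \<le> D * 2 ^ CARD('n) * measure lborel Q * sqnorm_on Q g"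
    by (rule Poincare_H10[OF u Q(1) fin conv D])
  also have "\<dots> = measure lborel Q * (D * 2 ^ CARD('n) * sqnorm_on Q g)"
    by (simp only: mult_ac)
  finally have "measure lborel Q * (sqnorm_on Q u - measure lborel Q * (avg Q u)\<^sup>2)
     \<le> measure lborel Q * (D * 2 ^ CARD('n) * sqnorm_on Q g)"
    by (simp only: mu)
  then show ?thesis using Q(3) by (rule mult_left_le_imp_le)
qed

text \<open>Apply Cauchy--Schwarz on \<open>R\<close> to the deviation of \<open>u\<close> from its mean over \<open>Q\<close>.\<close>

lemma avg_diff_estimate:
  fixes u :: "real ^ 'n \<Rightarrow> real" and Q :: "(real ^ 'n) set"
  assumes u: "H10_grad u g" and Q: "Q \<in> sets borel" "Q \<subseteq> \<Omega>" "measure lborel Q > 0" and conv: "convex Q"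
    and D: "0 \<le> D" "\<And>x y. x \<in> Q \<Longrightarrow> y \<in> Q \<Longrightarrow> (norm (x - y))\<^sup>2 \<le> D"
    and R: "R \<in> sets borel" "R \<subseteq> Q" "measure lborel R > 0"
  shows "measure lborel R * (avg R u - avg Q u)\<^sup>2 \<le> D * 2 ^ CARD('n) * sqnorm_on Q g"
proof -
  let ?q = "indicator Q :: real ^ 'n \<Rightarrow> real" and ?r = "indicator R :: real ^ 'n \<Rightarrow> real"
  let ?c = "avg Q u"
  let ?qu = "\<lambda>x. ?q x *\<^sub>R u x"
  define v where "v x = ?qu x - ?c *\<^sub>R ?q x" for x
  note uL2 = H10_grad_L2(1)[OF u]
  note L2 = indicator_L2(2)[OF Q(1)] indicator_L2(2)[OF R(1)] L2_restrict[OF Q(1) uL2]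
  have vL2: "v \<in> L2" unfolding v_def using L2 by (intro L2_diff L2_scale)
  have qq: "sqnorm ?q = measure lborel Q" by (rule ip_indicator_self[OF Q(1,2)])
  have rr: "sqnorm ?r = measure lborel R" using R Q by (intro ip_indicator_self) auto
  have rq: "ip ?r ?q = measure lborel R"
  proof -
    have "ip ?r ?q = sqnorm ?r"
      unfolding ip_def using R(2) by (intro Bochner_Integration.integral_cong) (auto simp: indicator_def)
    then show ?thesis using rr by simp
  qed
  have "ip ?q ?qu = ip ?q u" by (rule ip_indicator_subset) simp
  moreover have "sqnorm ?qu = ip ?qu u"
    unfolding ip_def by (intro Bochner_Integration.integral_cong) (auto simp: indicator_def)
  moreover have "sqnorm v = sqnorm ?qu + 2 * (- ?c) * ip ?qu ?q + (- ?c)\<^sup>2 * sqnorm ?q"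
    unfolding v_def using ip_expand[OF L2(3,1), of "- ?c"]
    by (simp only: scaleR_minus_left add_uminus_conv_diff)
  moreover have "ip ?qu ?q = ip ?q ?qu" by (rule ip_commute)
  moreover have "ip ?q u = measure lborel Q * ?c" using Q(3) by (simp add: avg_def)
  ultimately have "sqnorm v = ip ?qu u + 2 * (- ?c) * (measure lborel Q * ?c) + (- ?c)\<^sup>2 * measure lborel Q"
    using qq by (simp only:)
  also have "\<dots> = ip ?qu u - measure lborel Q * ?c\<^sup>2"
    by (simp add: power2_eq_square)
  finally have "sqnorm v = ip ?qu u - measure lborel Q * ?c\<^sup>2" .
  with Poincare_variance[OF u Q conv D]
  have vv: "sqnorm v \<le> D * 2 ^ CARD('n) * ip (\<lambda>x. ?q x *\<^sub>R g x) g" by simp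
  have "ip ?r v = ip ?r ?qu - ?c * ip ?r ?q"
    unfolding v_def using L2 by (simp only: ip_diff_right L2_scale ip_scale_right)
  also have "ip ?r ?qu = ip ?r u" by (rule ip_indicator_subset[OF R(2)])
  also have "ip ?r u = measure lborel R * avg R u"
    using R(3) by (simp add: avg_def)
  finally have "ip ?r v = measure lborel R * (avg R u - ?c)"
    unfolding rq by (simp only: right_diff_distrib mult.commute)
  with ip_Cauchy_Schwarz[OF L2(2) vL2] rr
  have "measure lborel R * (measure lborel R * (avg R u - ?c)\<^sup>2) \<le> measure lborel R * sqnorm v"
    by (simp add: power_mult_distrib power2_eq_square mult_ac)
  then have "measure lborel R * (avg R u - ?c)\<^sup>2 \<le> sqnorm v"
    using R(3) by (rule mult_left_le_imp_le)
  with vv show ?thesis by linarith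
qed

section \<open>The grid of cubes and its weight\<close>

lemma mem_subcube: "x \<in> subcube t H i \<longleftrightarrow> (\<forall>k. \<bar>x $ k - center H i $ k\<bar> \<le> t / 2)"
proof -
  have "(center H i - (\<chi> k. t / 2)) $ k \<le> x $ k \<and> x $ k \<le> (center H i + (\<chi> k. t / 2)) $ k \<longleftrightarrow>
      \<bar>x $ k - center H i $ k\<bar> \<le> t / 2" for k
    unfolding vector_minus_component vector_add_component vec_lambda_beta by linarith
  then show ?thesis unfolding subcube_def mem_box_cart by blast
qed

lemma norm_sq_vec: "(norm (x :: real ^ 'n))\<^sup>2 = (\<Sum>k\<in>UNIV. (x $ k)\<^sup>2)"
  by (simp add: norm_vec_def L2_set_def sum_nonneg)

lemma subcube_mono: "s \<le> t \<Longrightarrow> subcube s H i \<subseteq> subcube t H i"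
  unfolding mem_subcube subset_iff by (meson divide_right_mono order_trans zero_le_numeral)

lemma subcube_sets: "subcube t H i \<in> sets borel"
  by (simp add: subcube_def)

lemma convex_subcube: "convex (subcube t H i)"
  by (simp add: subcube_def)

lemma measure_subcube:
  assumes "0 \<le> t"
  shows "measure lborel (subcube t H i :: (real ^ 'n) set) = t ^ CARD('n)"
proof -
  have "subcube t H i \<noteq> {}"
    using assms by (auto simp: mem_subcube intro!: exI[of _ "center H i"] simp flip: ex_in_conv)
  then show ?thesis
    unfolding subcube_def by (subst content_cbox_cart) auto
qed

lemma subcube_diameter:
  fixes x y :: "real ^ 'n"
  assumes "x \<in> subcube t H i" "y \<in> subcube t H i"
  shows "(norm (x - y))\<^sup>2 \<le> real CARD('n) * t\<^sup>2"
proof -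
  have "(x $ k - y $ k)\<^sup>2 \<le> t\<^sup>2" for k
  proof (rule power2_le_iff_abs_le[THEN iffD2])
    have "\<bar>x $ k - center H i $ k\<bar> \<le> t / 2" "\<bar>y $ k - center H i $ k\<bar> \<le> t / 2"
      using assms by (auto simp: mem_subcube)
    then show "\<bar>x $ k - y $ k\<bar> \<le> t" "0 \<le> t" by linarith+
  qed
  then have "(\<Sum>k\<in>UNIV. (x $ k - y $ k)\<^sup>2) \<le> (\<Sum>k\<in>(UNIV :: 'n set). t\<^sup>2)"
    by (intro sum_mono)
  then show ?thesis
    by (simp add: norm_sq_vec)
qed

lemma dist_center_le:
  fixes x :: "real ^ 'n"
  assumes "x \<in> subcube t H i"
  shows "dist x (center H i) \<le> sqrt (real CARD('n)) * t / 2"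
proof -
  have k: "\<bar>x $ k - center H i $ k\<bar> \<le> t / 2" for k using assms by (simp add: mem_subcube)
  then have t: "0 \<le> t" using order_trans[OF abs_ge_zero k] by simp
  have "(x $ k - center H i $ k)\<^sup>2 \<le> (t / 2)\<^sup>2" for k
    using power_mono[OF k[of k], of 2] by simp
  then have "(\<Sum>k\<in>UNIV. (x $ k - center H i $ k)\<^sup>2) \<le> (\<Sum>k\<in>(UNIV :: 'n set). (t / 2)\<^sup>2)"
    by (intro sum_mono)
  then have "(norm (x - center H i))\<^sup>2 \<le> real CARD('n) * (t / 2)\<^sup>2"
    by (simp add: norm_sq_vec)
  then have "norm (x - center H i) \<le> sqrt (real CARD('n) * (t / 2)\<^sup>2)"
    by (rule real_le_rsqrt)
  then show ?thesis
    using t by (simp add: dist_norm real_sqrt_mult)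
qed

lemma finite_indices: "finite (indices H :: (nat ^ 'n) set)"
proof -
  have "finite {n :: nat. real n < 1 / H}"
  proof (rule finite_subset)
    show "{n :: nat. real n < 1 / H} \<subseteq> {..nat \<lceil>1 / H\<rceil>}"
      by (auto simp: le_nat_iff) linarith
  qed simp
  then have "finite (vec_lambda ` (UNIV \<rightarrow>\<^sub>E {n :: nat. real n < 1 / H}) :: (nat ^ 'n) set)"
    by (intro finite_imageI finite_PiE) auto
  moreover have "{i :: nat ^ 'n. \<forall>k. real (i $ k) < 1 / H}
      \<subseteq> vec_lambda ` (UNIV \<rightarrow>\<^sub>E {n :: nat. real n < 1 / H})"
  proof
    fix i :: "nat ^ 'n" assume "i \<in> {i. \<forall>k. real (i $ k) < 1 / H}"
    then have "vec_nth i \<in> (UNIV \<rightarrow>\<^sub>E {n :: nat. real n < 1 / H})" by auto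
    then have "vec_lambda (vec_nth i) \<in> vec_lambda ` (UNIV \<rightarrow>\<^sub>E {n :: nat. real n < 1 / H})"
      by (rule imageI)
    then show "i \<in> vec_lambda ` (UNIV \<rightarrow>\<^sub>E {n :: nat. real n < 1 / H})" by simp
  qed
  ultimately show ?thesis unfolding indices_def by (rule finite_subset[rotated])
qed

lemma grid_number:
  assumes "1 / H \<in> \<nat>" "0 < (H::real)"
  obtains N :: nat where "N > 0" "H = 1 / real N" "1 / H = real N"
proof -
  obtain N :: nat where "1 / H = real N" using assms(1) by (auto elim: Nats_cases)
  moreover have "H = 1 / (1 / H)" by simp
  moreover have "N > 0" using \<open>1 / H = real N\<close> assms(2) by (cases N) auto
  ultimately show ?thesis using that[of N] by metis
qed

lemma subcube_coordinate:
  assumes "0 < H"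
  shows "x \<in> subcube H H i \<longleftrightarrow> (\<forall>k. real (i $ k) * H \<le> x $ k \<and> x $ k \<le> (real (i $ k) + 1) * H)"
proof -
  have "\<bar>x $ k - center H i $ k\<bar> \<le> H / 2 \<longleftrightarrow> real (i $ k) * H \<le> x $ k \<and> x $ k \<le> (real (i $ k) + 1) * H" for k
    unfolding center_def vec_lambda_beta distrib_right by linarith
  then show ?thesis unfolding mem_subcube by blast
qed

lemma subcube_subset_Omega:
  fixes i :: "nat ^ 'n"
  assumes "1 / H \<in> \<nat>" "0 < H" "i \<in> indices H"
  shows "subcube H H i \<subseteq> \<Omega>"
proof
  obtain N :: nat where N: "N > 0" "H = 1 / real N" "1 / H = real N" using assms(1,2) by (rule grid_number)
  fix x assume x: "x \<in> subcube H H i"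
  have "0 \<le> x $ k \<and> x $ k \<le> 1" for k
  proof -
    have "i $ k < N" using assms(3) N by (auto simp: indices_def)
    then have "(real (i $ k) + 1) * H \<le> real N * H" using assms(2) by (intro mult_right_mono) auto
    also have "\<dots> = 1" using N(1,2) by simp
    finally have "(real (i $ k) + 1) * H \<le> 1" .
    moreover have "0 \<le> real (i $ k) * H" using assms(2) by simp
    ultimately show ?thesis using x unfolding subcube_coordinate[OF assms(2)] by (meson order_trans)
  qed
  then show "x \<in> \<Omega>" by (simp add: Omega_def mem_box_cart)
qed

lemma subcubes_cover:
  fixes x :: "real ^ 'n"
  assumes "1 / H \<in> \<nat>" "0 < H" "x \<in> \<Omega>"
  obtains i where "i \<in> indices H" "x \<in> subcube H H i"
proof -
  obtain N :: nat where N: "N > 0" "H = 1 / real N" "1 / H = real N" using assms(1,2) by (rule grid_number)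
  have x: "0 \<le> x $ k" "x $ k \<le> 1" for k using assms(3) by (auto simp: Omega_def mem_box_cart)
  have "\<exists>n. n < N \<and> real n * H \<le> x $ k \<and> x $ k \<le> (real n + 1) * H" for k
  proof (cases "x $ k = 1")
    case True
    have NH: "real N * H = 1" using N(1,2) by simp
    have "N - 1 < N" "real (N - 1) = real N - 1" using N(1) by auto
    with True NH assms(2) show ?thesis
      by (intro exI[of _ "N - 1"]) (simp add: left_diff_distrib)
  next
    case False
    then have lt: "x $ k * real N < real N" using x[of k] N(1) by simp
    have nn: "0 \<le> x $ k * real N" using x[of k] by simp
    define n where "n = nat \<lfloor>x $ k * real N\<rfloor>"
    have n: "real n \<le> x $ k * real N" "x $ k * real N < real n + 1"
      using nn unfolding n_def by (simp_all add: of_nat_floor)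
    have "n < N" using n lt by linarith
    have "real n * H \<le> x $ k * real N * H" "x $ k * real N * H \<le> (real n + 1) * H"
      using n assms(2) by (auto intro!: mult_right_mono)
    moreover have "x $ k * real N * H = x $ k" using N(1,2) by simp
    ultimately show ?thesis using \<open>n < N\<close> by (intro exI[of _ n]) simp
  qed
  then obtain j where j: "\<And>k. j k < N \<and> real (j k) * H \<le> x $ k \<and> x $ k \<le> (real (j k) + 1) * H" by metis
  show ?thesis
  proof (rule that[of "\<chi> k. j k"])
    show "(\<chi> k. j k) \<in> indices H" using j N by (simp add: indices_def)
    show "x \<in> subcube H H (\<chi> k. j k)" using j by (simp add: subcube_coordinate[OF assms(2)])
  qed
qed

lemma subcube_unique:
  fixes x :: "real ^ 'n"
  assumes "0 < H" and i: "\<And>k. \<bar>x $ k - center H i $ k\<bar> < H / 2" and j: "x \<in> subcube H H j"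
  shows "j = i"
proof -
  have "j $ k = i $ k" for k
  proof -
    have tri: "\<bar>a - b\<bar> < r" if "\<bar>y - a\<bar> \<le> r / 2" "\<bar>y - b\<bar> < r / 2" for a b y r :: real
      using that by linarith
    have "\<bar>x $ k - center H j $ k\<bar> \<le> H / 2" using j by (simp add: mem_subcube)
    from tri[OF this i[of k]]
    have "\<bar>(real (j $ k) + 1/2) * H - (real (i $ k) + 1/2) * H\<bar> < H"
      unfolding center_def by simp
    then have "\<bar>real (j $ k) - real (i $ k)\<bar> * H < 1 * H"
      using assms(1) by (simp add: abs_mult_pos left_diff_distrib[symmetric] flip: abs_mult_pos)
    then have "\<bar>real (j $ k) - real (i $ k)\<bar> < 1"
      using assms(1) by (simp only: mult_less_cancel_right_pos)
    then show ?thesis by linarith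
  qed
  then show ?thesis by (simp add: vec_eq_iff)
qed

text \<open>The closed cubes overlap only in their boundaries.\<close>

lemma sum_indicator_subcubes:
  assumes H: "1 / H \<in> \<nat>" "0 < H"
  shows "AE x in lebesgue_on \<Omega>. (\<Sum>i\<in>indices H. indicator (subcube H H i) (x :: real ^ 'n)) = (1 :: real)"
proof -
  let ?b = "\<lambda>i. box (center H i - (\<chi> k. H / 2)) (center H i + (\<chi> k. H / 2)) :: (real ^ 'n) set"
  have "negligible (\<Union>i\<in>indices H. subcube H H i - ?b i)"
  proof (rule negligible_Union)
    show "finite ((\<lambda>i. subcube H H i - ?b i) ` indices H)" by (intro finite_imageI finite_indices)
    show "negligible S" if "S \<in> (\<lambda>i. subcube H H i - ?b i) ` indices H" for S
      using that negligible_frontier_interval unfolding subcube_def by blast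
  qed
  then have "AE x in lebesgue_on \<Omega>. x \<notin> (\<Union>i\<in>indices H. subcube H H i - ?b i)"
    by (rule AE_not_negligible)
  moreover have "AE x in lebesgue_on (\<Omega> :: (real ^ 'n) set). x \<in> \<Omega>"
    by (intro AE_I2) (simp add: space_restrict_space)
  ultimately show ?thesis
  proof eventually_elim
    case (elim x)
    obtain i where i: "i \<in> indices H" "x \<in> subcube H H i" using subcubes_cover[OF H elim(2)] .
    have mem: "\<bar>x $ k - center H j $ k\<bar> < H / 2" if "j \<in> indices H" "x \<in> subcube H H j" for j k
    proof -
      have "x \<in> ?b j" using elim(1) that by blast
      then have "(center H j - (\<chi> k. H / 2)) $ k < x $ k \<and> x $ k < (center H j + (\<chi> k. H / 2)) $ k"
        unfolding mem_box_cart by blast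
      then show ?thesis
        unfolding vector_minus_component vector_add_component vec_lambda_beta by linarith
    qed
    have uniq: "j = i" if j: "j \<in> indices H" "x \<in> subcube H H j" for j
      by (rule subcube_unique[OF H(2) mem[OF i] j(2)])
    have "(\<Sum>j\<in>indices H. indicator (subcube H H j) x) = (\<Sum>j\<in>indices H. if j = i then 1 else (0 :: real))"
    proof (rule sum.cong[OF refl])
      fix j :: "nat ^ 'n" assume j: "j \<in> indices H"
      show "indicator (subcube H H j) x = (if j = i then 1 else (0 :: real))"
      proof (cases "x \<in> subcube H H j")
        case True
        then show ?thesis using uniq[OF j True] i(2) by simp
      next
        case False
        then have "j \<noteq> i" using i(2) by blast
        then show ?thesis using False by simp
      qed
    qed
    also have "\<dots> = 1"
      using sum.delta[OF finite_indices[of H], of i "\<lambda>_. 1 :: real"] i(1) by simp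
    finally show ?case .
  qed
qed

lemma weight_measurable: "weight \<gamma> H \<in> borel_measurable borel"
proof -
  have "(\<lambda>x :: real ^ 'n. infdist x (center H ` indices H)) \<in> borel_measurable borel"
    by (intro borel_measurable_continuous_onI continuous_on_infdist continuous_intros)
  then show ?thesis unfolding weight_def[abs_def] by measurable
qed

lemma weight_nonneg: "0 \<le> weight \<gamma> H x"
  by (simp add: weight_def)

lemma indices_nonempty:
  assumes "1 / H \<in> \<nat>" "0 < (H::real)"
  shows "(indices H :: (nat ^ 'n) set) \<noteq> {}"
proof -
  have "(\<chi> k. 0) \<in> (indices H :: (nat ^ 'n) set)" using assms by (simp add: indices_def)
  then show ?thesis by blast
qed

text \<open>On the cube of side \<open>t\<close> the distance to the centers is at most half a diagonal, so the weight is at least of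
  order \<open>(H / t)\<close> to the power \<open>d - 2 + \<gamma>\<close>. This growth controls the means over small cubes.\<close>

lemma weight_lower:
  fixes x :: "real ^ 'n"
  assumes "0 < H" "i \<in> indices H" "x \<in> subcube t H i" "x \<notin> center H ` indices H"
    and p: "0 \<le> real CARD('n) - 2 + \<gamma>"
  shows "0 < t" "1 \<le> (sqrt (real CARD('n)) / 2 * (t / H)) powr (real CARD('n) - 2 + \<gamma>) * weight \<gamma> H x"
proof -
  let ?C = "center H ` indices H :: (real ^ 'n) set"
  have C: "finite ?C" "?C \<noteq> {}" using finite_indices assms(2) by auto
  define r where "r = infdist x ?C"
  have "r \<noteq> 0" unfolding r_def
    using in_closed_iff_infdist_zero[OF finite_imp_closed[OF C(1)] C(2)] assms(4) by blast
  then have r: "r > 0" unfolding r_def using infdist_nonneg[of x ?C] by simp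
  have "r \<le> dist x (center H i)" unfolding r_def using assms(2) by (intro infdist_le) auto
  also have "\<dots> \<le> sqrt (real CARD('n)) * t / 2" using assms(3) by (rule dist_center_le)
  finally have le: "r \<le> sqrt (real CARD('n)) * t / 2" .
  then have "0 < sqrt (real CARD('n)) * t" using r by linarith
  then show t: "0 < t" by (simp add: zero_less_mult_iff)
  have "1 \<le> (sqrt (real CARD('n)) / 2 * (t / H)) * (H / r)"
    using le r assms(1) by (simp add: field_simps)
  then have "1 powr (real CARD('n) - 2 + \<gamma>) \<le> ((sqrt (real CARD('n)) / 2 * (t / H)) * (H / r)) powr (real CARD('n) - 2 + \<gamma>)"
    using p by (intro powr_mono2) auto
  also have "\<dots> = (sqrt (real CARD('n)) / 2 * (t / H)) powr (real CARD('n) - 2 + \<gamma>) * (H / r) powr (real CARD('n) - 2 + \<gamma>)"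
    by (rule powr_mult)
  finally show "1 \<le> (sqrt (real CARD('n)) / 2 * (t / H)) powr (real CARD('n) - 2 + \<gamma>) * weight \<gamma> H x"
    by (simp add: weight_def r_def)
qed

lemma AE_not_center: "AE x in lebesgue_on (\<Omega> :: (real ^ 'n) set). x \<notin> center H ` indices H"
  by (intro AE_not_negligible negligible_finite finite_imageI finite_indices)

text \<open>Half of the weight is moved into the gradient, so that the energy of \<open>u\<close> is the squared \<open>L\<^sup>2\<close> norm of the flux
  of its gradient.\<close>

definition flux :: "real \<Rightarrow> real \<Rightarrow> (real ^ 'n \<Rightarrow> real ^ 'n) \<Rightarrow> real ^ 'n \<Rightarrow> real ^ 'n" where
  "flux \<gamma> H g x = sqrt (weight \<gamma> H x) *\<^sub>R g x"

section \<open>The Poincare inequality with the singular weight\<close>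

text \<open>Halve \<open>t\<close> until it reaches \<open>h\<close>. The increments form a geometric series of ratio \<open>2 powr (- \<beta>)\<close>, so the bound
  does not depend on the number of halvings, that is, on \<open>h\<close>.\<close>

lemma telescope_halving:
  fixes A :: "real \<Rightarrow> real"
  assumes step: "\<And>s t. 0 < s \<Longrightarrow> t / 2 \<le> s \<Longrightarrow> s \<le> t \<Longrightarrow> t \<le> H \<Longrightarrow> \<bar>A s - A t\<bar> \<le> B * (t / H) powr \<beta>"
    and "0 < \<beta>" "0 \<le> B" "0 < h" "h \<le> H"
  shows "\<bar>A h - A H\<bar> \<le> B / (1 - 2 powr (- \<beta>))"
proof -
  define \<theta> :: real where "\<theta> = 2 powr (- \<beta>)"
  have \<theta>: "0 < \<theta>" "\<theta> < 1" using assms(2) by (auto simp: \<theta>_def powr_less_one)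
  have "h \<le> t \<Longrightarrow> t \<le> H \<Longrightarrow> t / 2 ^ n \<le> h \<Longrightarrow> \<bar>A h - A t\<bar> \<le> B * (t / H) powr \<beta> / (1 - \<theta>)" for n t
  proof (induction n arbitrary: t)
    case 0
    then have "t = h" by simp
    then show ?case using \<theta> assms by simp
  next
    case (Suc n)
    have t: "0 < t" using Suc assms by linarith
    show ?case
    proof (cases "t / 2 \<le> h")
      case True
      have "\<bar>A h - A t\<bar> \<le> B * (t / H) powr \<beta>" using step[of h t] True Suc assms by simp
      also have "\<dots> \<le> B * (t / H) powr \<beta> / (1 - \<theta>)"
        using \<theta> assms by (simp add: pos_le_divide_eq mult_left_le)
      finally show ?thesis .
    next
      case False
      have "\<bar>A h - A (t / 2)\<bar> \<le> B * (t / 2 / H) powr \<beta> / (1 - \<theta>)"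
        using False Suc.prems t by (intro Suc.IH) (auto simp: field_simps)
      also have "(t / 2 / H) powr \<beta> = (t / H) powr \<beta> * \<theta>"
      proof -
        have "(t / 2 / H) powr \<beta> = ((t / H) * (1 / 2)) powr \<beta>" by (simp add: mult.commute)
        also have "\<dots> = (t / H) powr \<beta> * (1 / 2) powr \<beta>" by (rule powr_mult)
        also have "(1 / 2 :: real) powr \<beta> = \<theta>"
          unfolding \<theta>_def by (simp add: powr_minus_divide powr_divide)
        finally show ?thesis .
      qed
      finally have "\<bar>A h - A (t / 2)\<bar> \<le> B * ((t / H) powr \<beta> * \<theta>) / (1 - \<theta>)" .
      moreover have "\<bar>A (t / 2) - A t\<bar> \<le> B * (t / H) powr \<beta>"
        using t Suc.prems by (intro step) auto
      moreover have "B * ((t / H) powr \<beta> * \<theta>) / (1 - \<theta>) + B * (t / H) powr \<beta> = B * (t / H) powr \<beta> / (1 - \<theta>)"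
        using \<theta> by (simp add: field_simps)
      ultimately show ?thesis by linarith
    qed
  qed note claim = this
  obtain n where "H / h < 2 ^ n" using real_arch_pow[of 2 "H / h"] by auto
  then have "H / 2 ^ n \<le> h" using assms by (simp add: field_simps)
  from claim[OF assms(5) order_refl this] show ?thesis
    using assms by (simp add: \<theta>_def)
qed

text \<open>The unweighted energy in a small cube is a small fraction of the weighted energy: integrate the pointwise lower
  bound on the weight.\<close>

lemma cube_energy_le:
  fixes g :: "real ^ 'n \<Rightarrow> real ^ 'n"
  assumes H: "0 < H" "i \<in> indices H" "t \<le> H" and g: "g \<in> L2" and S: "flux \<gamma> H g \<in> L2"
    and p: "0 \<le> real CARD('n) - 2 + \<gamma>"
  shows "sqnorm_on (subcube t H i) g
    \<le> (sqrt (real CARD('n)) / 2 * (t / H)) powr (real CARD('n) - 2 + \<gamma>)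
        * sqnorm_on (subcube H H i) (flux \<gamma> H g)"
proof -
  let ?c = "(sqrt (real CARD('n)) / 2 * (t / H)) powr (real CARD('n) - 2 + \<gamma>)"
  have "(LINT x|lebesgue_on \<Omega>. indicator (subcube t H i) x *\<^sub>R g x \<bullet> g x)
     \<le> (LINT x|lebesgue_on \<Omega>. ?c * (indicator (subcube H H i) x *\<^sub>R flux \<gamma> H g x \<bullet> flux \<gamma> H g x))"
  proof (rule integral_mono_AE)
    show "integrable (lebesgue_on \<Omega>) (\<lambda>x. indicator (subcube t H i) x *\<^sub>R g x \<bullet> g x)"
      by (intro L2_integrable_inner L2_restrict subcube_sets g)
    show "integrable (lebesgue_on \<Omega>) (\<lambda>x. ?c * (indicator (subcube H H i) x *\<^sub>R flux \<gamma> H g x \<bullet> flux \<gamma> H g x))"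
      by (intro integrable_mult_right L2_integrable_inner L2_restrict subcube_sets S)
    show "AE x in lebesgue_on \<Omega>. indicator (subcube t H i) x *\<^sub>R g x \<bullet> g x
        \<le> ?c * (indicator (subcube H H i) x *\<^sub>R flux \<gamma> H g x \<bullet> flux \<gamma> H g x)"
      using AE_not_center[of H]
    proof eventually_elim
      case (elim x)
      have fl: "flux \<gamma> H g x \<bullet> flux \<gamma> H g x = weight \<gamma> H x * (g x \<bullet> g x)"
        using weight_nonneg[of \<gamma> H x] by (simp add: flux_def)
      show ?case
      proof (cases "x \<in> subcube t H i")
        case True
        then have "x \<in> subcube H H i" using subcube_mono[OF H(3)] by blast
        moreover have "1 * (g x \<bullet> g x) \<le> (?c * weight \<gamma> H x) * (g x \<bullet> g x)"
          by (intro mult_right_mono weight_lower(2)[OF H(1,2) True elim p]) simp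
        ultimately show ?thesis using True by (simp add: fl mult.assoc)
      next
        case False
        have "0 \<le> ?c * (weight \<gamma> H x * (g x \<bullet> g x))"
          by (intro mult_nonneg_nonneg weight_nonneg) auto
        with False show ?thesis by (simp add: fl indicator_def)
      qed
    qed
  qed
  then show ?thesis by (simp add: ip_def)
qed

text \<open>Four to the power \<open>d\<close> combines the \<open>2 ^ d\<close> of the unweighted Poincare inequality with the volume ratio of two
  cubes whose sides differ by at most a factor of two.\<close>

definition step_constant :: "nat \<Rightarrow> real \<Rightarrow> real" where
  "step_constant d \<gamma> = real d * 4 ^ d * (sqrt (real d) / 2) powr (real d - 2 + \<gamma>)"

lemma step_constant_nonneg: "0 \<le> step_constant d \<gamma>"
  by (simp add: step_constant_def)

text \<open>Without the weight, the means over comparable cubes of side \<open>t\<close> differ by at most a multiple of \<open>t\<close> to the power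
  \<open>1 - d/2\<close>, which in dimension at least two is not summable over small scales. The weight contributes the
  factor \<open>(t / H)\<close> to the power \<open>(d - 2 + \<gamma>) / 2\<close>: this cancels that power of \<open>t\<close> and leaves \<open>(t / H) powr (\<gamma> / 2)\<close>.\<close>

lemma avg_step:
  fixes u :: "real ^ 'n \<Rightarrow> real"
  assumes u: "H10_grad u g" and S: "flux \<gamma> H g \<in> L2"
    and H: "1 / H \<in> \<nat>" "0 < H" "i \<in> indices H" and p: "0 \<le> real CARD('n) - 2 + \<gamma>"
    and st: "0 < s" "t / 2 \<le> s" "s \<le> t" "t \<le> H"
  defines "E \<equiv> sqnorm_on (subcube H H i) (flux \<gamma> H g)"
  shows "\<bar>avg (subcube s H i) u - avg (subcube t H i) u\<bar>
    \<le> sqrt (step_constant CARD('n) \<gamma> * (H\<^sup>2 / H ^ CARD('n)) * E) * (t / H) powr (\<gamma> / 2)"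
proof -
  let ?d = "CARD('n)"
  let ?\<delta> = "avg (subcube s H i) u - avg (subcube t H i) u"
  let ?\<kappa> = "sqrt (real ?d) / 2"
  let ?p = "real ?d - 2 + \<gamma>"
  have t: "0 < t" using st by linarith
  have E0: "0 \<le> E"
    unfolding E_def ip_def by (intro Bochner_Integration.integral_nonneg) (simp add: indicator_def)
  have sub: "subcube t H i \<subseteq> \<Omega>"
    using subcube_mono[OF st(4)] subcube_subset_Omega[OF H] by blast
  have "s ^ ?d * ?\<delta>\<^sup>2 \<le> (real ?d * t\<^sup>2) * 2 ^ ?d * sqnorm_on (subcube t H i) g"
    using avg_diff_estimate[OF u subcube_sets sub _ convex_subcube _ subcube_diameter subcube_sets subcube_mono[OF st(3)]]
      measure_subcube[of t H i] measure_subcube[of s H i] t st(1) by simp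
  also have "\<dots> \<le> (real ?d * t\<^sup>2) * 2 ^ ?d * ((?\<kappa> * (t / H)) powr ?p * E)"
    unfolding E_def
    by (intro mult_left_mono cube_energy_le[OF H(2,3) st(4) H10_grad_L2(2)[OF u] S p]) simp
  finally have 1: "s ^ ?d * ?\<delta>\<^sup>2 \<le> (real ?d * t\<^sup>2) * 2 ^ ?d * ((?\<kappa> * (t / H)) powr ?p * E)" .
  have "(t / 2) ^ ?d * ?\<delta>\<^sup>2 \<le> s ^ ?d * ?\<delta>\<^sup>2"
    using st t by (intro mult_right_mono power_mono) auto
  with 1 have 2: "(t / 2) ^ ?d * ?\<delta>\<^sup>2 \<le> (real ?d * t\<^sup>2) * 2 ^ ?d * ((?\<kappa> * (t / H)) powr ?p * E)"
    by linarith
  have "(?\<kappa> * (t / H)) powr ?p = ?\<kappa> powr ?p * (t / H) powr ?p"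
    by (rule powr_mult)
  also have "(t / H) powr ?p = (t / H) powr real ?d / (t / H) powr 2 * (t / H) powr \<gamma>"
    by (simp add: powr_diff powr_add)
  also have "\<dots> = (t / H) ^ ?d / (t / H)\<^sup>2 * (t / H) powr \<gamma>"
    using t H(2) by (simp add: powr_realpow)
  finally have 3: "(?\<kappa> * (t / H)) powr ?p = ?\<kappa> powr ?p * ((t / H) ^ ?d / (t / H)\<^sup>2 * (t / H) powr \<gamma>)" .
  \<comment> \<open>Dividing by \<open>(t / 2) ^ d\<close> leaves \<open>t\<^sup>2 / t ^ d\<close>, which combines with the weight
    factor to \<open>H\<^sup>2 / H ^ d * (t / H) powr \<gamma>\<close>.\<close>
  have "(2 / t) ^ ?d * ((t / 2) ^ ?d * ?\<delta>\<^sup>2) \<le> (2 / t) ^ ?d * ((real ?d * t\<^sup>2) * 2 ^ ?d * ((?\<kappa> * (t / H)) powr ?p * E))"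
    using t by (intro mult_left_mono 2) simp
  also have "(2 / t) ^ ?d * ((t / 2) ^ ?d * ?\<delta>\<^sup>2) = ?\<delta>\<^sup>2"
    using t by (simp add: power_divide)
  also have "(2 / t) ^ ?d * ((real ?d * t\<^sup>2) * 2 ^ ?d * ((?\<kappa> * (t / H)) powr ?p * E))
      = step_constant ?d \<gamma> * (H\<^sup>2 / H ^ ?d) * E * (t / H) powr \<gamma>"
  proof -
    have "(2 / t) ^ ?d * t\<^sup>2 * 2 ^ ?d * ((t / H) ^ ?d / (t / H)\<^sup>2) = 4 ^ ?d * (H\<^sup>2 / H ^ ?d)"
      using t H(2) by (simp add: power_divide field_simps flip: power_mult_distrib)
    note 4 = this
    have 5: "a * ((b * c) * e * ((k * (q * r)) * w)) = b * k * (a * c * e * q) * w * r"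
      for a b c e k q r w :: real by (simp only: mult_ac)
    show ?thesis unfolding 3 5 4 step_constant_def by (simp only: mult_ac)
  qed
  also have "\<dots> = (sqrt (step_constant ?d \<gamma> * (H\<^sup>2 / H ^ ?d) * E) * (t / H) powr (\<gamma> / 2))\<^sup>2"
  proof -
    have "0 \<le> step_constant ?d \<gamma> * (H\<^sup>2 / H ^ ?d) * E"
      using E0 H(2) step_constant_nonneg[of ?d \<gamma>] by simp
    moreover have "((t / H) powr (\<gamma> / 2))\<^sup>2 = (t / H) powr \<gamma>"
      using t H(2) by (simp add: power2_eq_square flip: powr_add)
    ultimately show ?thesis by (simp add: power_mult_distrib)
  qed
  finally have "?\<delta>\<^sup>2 \<le> (sqrt (step_constant ?d \<gamma> * (H\<^sup>2 / H ^ ?d) * E) * (t / H) powr (\<gamma> / 2))\<^sup>2" .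
  moreover have "0 \<le> sqrt (step_constant ?d \<gamma> * (H\<^sup>2 / H ^ ?d) * E) * (t / H) powr (\<gamma> / 2)"
    using E0 H(2) step_constant_nonneg[of ?d \<gamma>] by (intro mult_nonneg_nonneg real_sqrt_ge_zero) auto
  ultimately show ?thesis by (simp add: abs_le_square_iff[symmetric])
qed

text \<open>The first summand bounds the deviation of a function from its mean over a grid cube, the second the mean
  itself; its denominator comes from the geometric series of the telescoping.\<close>

definition Poincare_constant :: "nat \<Rightarrow> real \<Rightarrow> real" where
  "Poincare_constant d \<gamma> = real d * 2 ^ d * (sqrt (real d) / 2) powr (real d - 2 + \<gamma>)
     + step_constant d \<gamma> / (1 - 2 powr (- (\<gamma> / 2)))\<^sup>2"

lemma Poincare_constant_nonneg: "0 \<le> Poincare_constant d \<gamma>"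
  unfolding Poincare_constant_def using step_constant_nonneg[of d \<gamma>] by simp

text \<open>Split \<open>u\<close> on the cube into its mean and the deviation from it. The deviation obeys the unweighted inequality;
  the mean over the full cube is compared with the vanishing mean over the subcube by telescoping.\<close>

lemma cube_Poincare:
  fixes u :: "real ^ 'n \<Rightarrow> real"
  assumes u: "H10_grad u g" and S: "flux \<gamma> H g \<in> L2"
    and H: "1 / H \<in> \<nat>" "0 < H" "i \<in> indices H" and p: "0 \<le> real CARD('n) - 2 + \<gamma>" and \<gamma>: "0 < \<gamma>"
    and h: "0 < h" "h \<le> H" and zero: "ip (indicator (subcube h H i)) u = 0"
  shows "sqnorm_on (subcube H H i) u
    \<le> Poincare_constant CARD('n) \<gamma> * H\<^sup>2 * sqnorm_on (subcube H H i) (flux \<gamma> H g)"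
proof -
  let ?d = "CARD('n)" and ?Q = "subcube H H i"
  let ?\<kappa> = "(sqrt (real ?d) / 2) powr (real ?d - 2 + \<gamma>)"
  let ?\<theta> = "1 - 2 powr (- (\<gamma> / 2))"
  define E where "E = sqnorm_on ?Q (flux \<gamma> H g)"
  have E0: "0 \<le> E"
    unfolding E_def ip_def by (intro Bochner_Integration.integral_nonneg) (simp add: indicator_def)
  have sub: "?Q \<subseteq> \<Omega>" by (rule subcube_subset_Omega[OF H])
  define B where "B = sqrt (step_constant ?d \<gamma> * (H\<^sup>2 / H ^ ?d) * E)"
  have B2: "B\<^sup>2 = step_constant ?d \<gamma> * (H\<^sup>2 / H ^ ?d) * E" and B0: "0 \<le> B"
    unfolding B_def using E0 H(2) step_constant_nonneg[of ?d \<gamma>] by simp_all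
  have "\<bar>avg (subcube h H i) u - avg ?Q u\<bar> \<le> B / ?\<theta>"
    by (rule telescope_halving[where A = "\<lambda>t. avg (subcube t H i) u", OF _ _ B0 h])
      (use avg_step[OF u S H p] \<gamma> in \<open>simp_all add: B_def E_def\<close>)
  then have "\<bar>avg ?Q u\<bar> \<le> B / ?\<theta>" using zero by (simp add: avg_def)
  from power_mono[OF this, of 2] have "(avg ?Q u)\<^sup>2 \<le> B\<^sup>2 / ?\<theta>\<^sup>2" by (simp add: power_divide)
  then have "H ^ ?d * (avg ?Q u)\<^sup>2 \<le> H ^ ?d * (B\<^sup>2 / ?\<theta>\<^sup>2)"
    using H(2) by (intro mult_left_mono) auto
  also have "\<dots> = step_constant ?d \<gamma> / ?\<theta>\<^sup>2 * H\<^sup>2 * E"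
    unfolding B2 using H(2) by simp
  finally have 1: "H ^ ?d * (avg ?Q u)\<^sup>2 \<le> step_constant ?d \<gamma> / ?\<theta>\<^sup>2 * H\<^sup>2 * E" .
  have "sqnorm_on ?Q u - measure lborel ?Q * (avg ?Q u)\<^sup>2
      \<le> (real ?d * H\<^sup>2) * 2 ^ ?d * sqnorm_on ?Q g"
    by (rule Poincare_variance[OF u subcube_sets sub _ convex_subcube _ subcube_diameter])
      (use H(2) measure_subcube[of H H i] in simp_all)
  also have "\<dots> \<le> (real ?d * H\<^sup>2) * 2 ^ ?d * (?\<kappa> * E)"
    using cube_energy_le[OF H(2,3) order_refl H10_grad_L2(2)[OF u] S p] H(2)
    unfolding E_def by (intro mult_left_mono) auto
  finally have "sqnorm_on ?Q u - H ^ ?d * (avg ?Q u)\<^sup>2 \<le> real ?d * 2 ^ ?d * ?\<kappa> * H\<^sup>2 * E"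
    using measure_subcube[of H H i] H(2) by (simp add: mult_ac)
  with 1 have "sqnorm_on ?Q u
      \<le> real ?d * 2 ^ ?d * ?\<kappa> * H\<^sup>2 * E + step_constant ?d \<gamma> / ?\<theta>\<^sup>2 * H\<^sup>2 * E"
    by linarith
  also have "\<dots> = Poincare_constant ?d \<gamma> * H\<^sup>2 * E"
    unfolding Poincare_constant_def distrib_right ..
  finally show ?thesis unfolding E_def .
qed

lemma ip_sum_subcubes:
  fixes f :: "real ^ 'n \<Rightarrow> 'b::euclidean_space"
  assumes "1 / H \<in> \<nat>" "0 < H" "f \<in> L2"
  shows "(\<Sum>i\<in>indices H. sqnorm_on (subcube H H i) f) = sqnorm f"
proof -
  have "(\<Sum>i\<in>indices H. sqnorm_on (subcube H H i) f)
     = (LINT x|lebesgue_on \<Omega>. (\<Sum>i\<in>indices H. indicator (subcube H H i) x *\<^sub>R f x \<bullet> f x))"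
    unfolding ip_def
    by (intro Bochner_Integration.integral_sum[symmetric] L2_integrable_inner L2_restrict subcube_sets assms)
  also have "\<dots> = sqnorm f"
    unfolding ip_def
  proof (rule integral_cong_AE)
    show "(\<lambda>x. \<Sum>i\<in>indices H. indicator (subcube H H i) x *\<^sub>R f x \<bullet> f x) \<in> borel_measurable (lebesgue_on \<Omega>)"
      by (intro borel_measurable_sum borel_measurable_integrable L2_integrable_inner L2_restrict subcube_sets assms)
    show "(\<lambda>x. f x \<bullet> f x) \<in> borel_measurable (lebesgue_on \<Omega>)"
      by (intro borel_measurable_integrable L2_integrable_inner assms)
    show "AE x in lebesgue_on \<Omega>. (\<Sum>i\<in>indices H. indicator (subcube H H i) x *\<^sub>R f x \<bullet> f x) = f x \<bullet> f x"
      using sum_indicator_subcubes[OF assms(1,2)]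
      by eventually_elim (simp flip: sum_distrib_right)
  qed
  finally show ?thesis .
qed

text \<open>Sum over the cubes, which tile the domain up to a null set.\<close>

lemma weighted_Poincare:
  fixes u :: "real ^ 'n \<Rightarrow> real"
  assumes u: "H10_grad u g" and S: "flux \<gamma> H g \<in> L2"
    and H: "1 / H \<in> \<nat>" "0 < H" and p: "0 \<le> real CARD('n) - 2 + \<gamma>" and \<gamma>: "0 < \<gamma>"
    and h: "0 < h" "h \<le> H" and zero: "\<And>i. i \<in> indices H \<Longrightarrow> ip (indicator (subcube h H i)) u = 0"
  shows "sqnorm u \<le> Poincare_constant CARD('n) \<gamma> * H\<^sup>2 * sqnorm (flux \<gamma> H g)"
proof -
  have "sqnorm u = (\<Sum>i\<in>indices H. sqnorm_on (subcube H H i) u)"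
    by (rule ip_sum_subcubes[OF H H10_grad_L2(1)[OF u], symmetric])
  also have "\<dots> \<le> (\<Sum>i\<in>indices H. Poincare_constant CARD('n) \<gamma> * H\<^sup>2 *
      sqnorm_on (subcube H H i) (flux \<gamma> H g))"
    by (intro sum_mono cube_Poincare[OF u S H _ p \<gamma> h zero])
  also have "\<dots> = Poincare_constant CARD('n) \<gamma> * H\<^sup>2 * sqnorm (flux \<gamma> H g)"
    unfolding sum_distrib_left[symmetric] ip_sum_subcubes[OF H S] ..
  finally show ?thesis .
qed

section \<open>Functions of finite energy\<close>

definition energy_pair :: "real \<Rightarrow> real \<Rightarrow> (real ^ 'n \<Rightarrow> real) \<Rightarrow> (real ^ 'n \<Rightarrow> real ^ 'n) \<Rightarrow> bool" where
  "energy_pair \<gamma> H v g \<longleftrightarrow> H10_grad v g \<and> flux \<gamma> H g \<in> L2"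

lemma energy_pairD:
  assumes "energy_pair \<gamma> H v g"
  shows "H10_grad v g" "flux \<gamma> H g \<in> L2" "v \<in> L2" "g \<in> L2"
  using assms H10_grad_L2 by (auto simp: energy_pair_def)

lemma flux_add: "flux \<gamma> H (\<lambda>x. g x + k x) = (\<lambda>x. flux \<gamma> H g x + flux \<gamma> H k x)"
  by (simp add: flux_def fun_eq_iff scaleR_add_right)

lemma flux_diff: "flux \<gamma> H (\<lambda>x. g x - k x) = (\<lambda>x. flux \<gamma> H g x - flux \<gamma> H k x)"
  by (simp add: flux_def fun_eq_iff scaleR_diff_right)

lemma flux_scale: "flux \<gamma> H (\<lambda>x. c *\<^sub>R g x) = (\<lambda>x. c *\<^sub>R flux \<gamma> H g x)"
  by (simp add: flux_def fun_eq_iff)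

lemma energy_pair_add:
  "energy_pair \<gamma> H v g \<Longrightarrow> energy_pair \<gamma> H w k \<Longrightarrow> energy_pair \<gamma> H (\<lambda>x. v x + w x) (\<lambda>x. g x + k x)"
  unfolding energy_pair_def flux_add by (blast intro: H10_grad_add L2_add)

lemma energy_pair_diff:
  "energy_pair \<gamma> H v g \<Longrightarrow> energy_pair \<gamma> H w k \<Longrightarrow> energy_pair \<gamma> H (\<lambda>x. v x - w x) (\<lambda>x. g x - k x)"
  unfolding energy_pair_def flux_diff by (blast intro: H10_grad_diff L2_diff)

lemma energy_pair_scale:
  "energy_pair \<gamma> H v g \<Longrightarrow> energy_pair \<gamma> H (\<lambda>x. c *\<^sub>R v x) (\<lambda>x. c *\<^sub>R g x)"
  unfolding energy_pair_def flux_scale by (blast intro: H10_grad_scale L2_scale)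

lemma energy_pair_zero: "energy_pair \<gamma> H (\<lambda>x :: real ^ 'n. 0) (\<lambda>x. 0)"
proof -
  have "flux \<gamma> H (\<lambda>x :: real ^ 'n. 0) = (\<lambda>x. 0)" by (simp add: flux_def fun_eq_iff)
  then show ?thesis by (simp add: energy_pair_def H10_grad_zero L2_zero)
qed

lemma energy_pair_sum:
  "finite I \<Longrightarrow> (\<And>i. i \<in> I \<Longrightarrow> energy_pair \<gamma> H (v i) (g i)) \<Longrightarrow>
    energy_pair \<gamma> H (\<lambda>x. \<Sum>i\<in>I. v i x) (\<lambda>x. \<Sum>i\<in>I. g i x)"
proof (induction I rule: finite_induct)
  case empty
  then show ?case using energy_pair_zero by simp
next
  case (insert i I)
  have "energy_pair \<gamma> H (\<lambda>x. v i x + (\<Sum>i\<in>I. v i x)) (\<lambda>x. g i x + (\<Sum>i\<in>I. g i x))"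
    by (rule energy_pair_add) (use insert in auto)
  then show ?case using insert(1,2) by simp
qed

lemma weight_measurable_Omega: "weight \<gamma> H \<in> borel_measurable (lebesgue_on \<Omega>)"
  by (intro measurable_restrict_space1 measurable_completion) (simp add: weight_measurable)

lemma sqrt_weight_measurable: "(\<lambda>x. sqrt (weight \<gamma> H x)) \<in> borel_measurable (lebesgue_on \<Omega>)"
  by (rule measurable_compose[OF weight_measurable_Omega]) measurable

lemma flux_measurable:
  assumes "g \<in> borel_measurable (lebesgue_on \<Omega>)"
  shows "flux \<gamma> H g \<in> borel_measurable (lebesgue_on \<Omega>)"
  unfolding flux_def[abs_def] by (rule borel_measurable_scaleR[OF sqrt_weight_measurable assms])

lemma norm_flux: "(norm (flux \<gamma> H g x))\<^sup>2 = weight \<gamma> H x * (norm (g x))\<^sup>2"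
  using weight_nonneg[of \<gamma> H x] by (simp add: flux_def power_mult_distrib)

lemma energy_norm_eq_flux: "energy_norm (weight \<gamma> H) v = L2_norm (flux \<gamma> H (weak_grad v))"
  unfolding energy_norm_def L2_norm_def norm_flux ..

lemma energy_pair_weak_grad:
  assumes "v \<in> H10" "energy_norm (weight \<gamma> H) v < \<infinity>"
  shows "energy_pair \<gamma> H v (weak_grad v)"
proof -
  have g: "H10_grad v (weak_grad v)" using assms(1) by (rule H10_imp_H10_grad)
  have "flux \<gamma> H (weak_grad v) \<in> borel_measurable (lebesgue_on \<Omega>)"
    by (rule flux_measurable[OF L2_measurable[OF H10_grad_L2(2)[OF g]]])
  with assms(2) g show ?thesis
    by (simp only: energy_norm_eq_flux L2_norm_finite_iff energy_pair_def)
qed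

lemma flux_AE_cong:
  "AE x in lebesgue_on \<Omega>. g x = k x \<Longrightarrow> AE x in lebesgue_on \<Omega>. flux \<gamma> H g x = flux \<gamma> H k x"
  by (erule eventually_mono) (simp add: flux_def)

text \<open>The energy norm is defined with the chosen weak gradient, but any admissible gradient gives the same value.\<close>

lemma energy_pair_energy_norm:
  assumes "energy_pair \<gamma> H v g"
  shows "v \<in> H10" "flux \<gamma> H (weak_grad v) \<in> L2"
    "energy_norm (weight \<gamma> H) v = ennreal (sqrt (sqnorm (flux \<gamma> H g)))"
proof -
  note pr = energy_pairD[OF assms]
  show H10: "v \<in> H10" using H10_gradD(1)[OF pr(1)] .
  have ae: "AE x in lebesgue_on \<Omega>. flux \<gamma> H (weak_grad v) x = flux \<gamma> H g x"
    by (rule flux_AE_cong[OF H10_gradD(2)[OF pr(1)]])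
  then have ae': "AE x in lebesgue_on \<Omega>. flux \<gamma> H g x = flux \<gamma> H (weak_grad v) x"
    by eventually_elim (rule sym)
  have "weak_grad v \<in> borel_measurable (lebesgue_on \<Omega>)"
    by (rule L2_measurable[OF H10_grad_L2(2)[OF H10_imp_H10_grad[OF H10]]])
  then show L2: "flux \<gamma> H (weak_grad v) \<in> L2"
    by (rule L2_AE_cong[OF pr(2) flux_measurable ae'])
  show "energy_norm (weight \<gamma> H) v = ennreal (sqrt (sqnorm (flux \<gamma> H g)))"
    unfolding energy_norm_eq_flux L2_norm_eq[OF L2]
    by (simp only: ip_AE_cong[OF L2 L2 pr(2) pr(2) ae ae])
qed

lemma H10_grad_AE_cong:
  assumes "H10_grad u g" "k \<in> L2" "AE x in lebesgue_on \<Omega>. g x = k x"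
  shows "H10_grad u k"
proof -
  obtain \<phi> where \<phi>: "\<And>n. \<phi> n \<in> test_functions" and l: "L2lim \<phi> u" "L2lim (\<lambda>n. grad (\<phi> n)) g"
    using assms unfolding H10_grad_def by blast
  have "sqnorm (\<lambda>x. grad (\<phi> n) x - k x)
      = sqnorm (\<lambda>x. grad (\<phi> n) x - g x)" for n
  proof -
    have ae: "AE x in lebesgue_on \<Omega>. grad (\<phi> n) x - k x = grad (\<phi> n) x - g x"
      using assms(3) by eventually_elim simp
    have "(\<lambda>x. grad (\<phi> n) x - k x) \<in> L2" "(\<lambda>x. grad (\<phi> n) x - g x) \<in> L2"
      using L2_diff[OF test_grad_L2[OF \<phi>]] assms(2) H10_grad_L2(2)[OF assms(1)] by blast+
    then show ?thesis by (intro ip_AE_cong ae)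
  qed
  then have "L2lim (\<lambda>n. grad (\<phi> n)) k"
    using l(2) assms(2) by (simp add: L2lim_def)
  with \<phi> l show ?thesis unfolding H10_grad_def by blast
qed

lemma inverse_weight_bounded:
  fixes x :: "real ^ 'n"
  assumes H: "1 / H \<in> \<nat>" "0 < H" and p: "0 \<le> real CARD('n) - 2 + \<gamma>" and x: "x \<in> \<Omega>"
  shows "\<bar>inverse (sqrt (weight \<gamma> H x))\<bar> \<le> sqrt ((sqrt (real CARD('n)) / 2) powr (real CARD('n) - 2 + \<gamma>))"
proof (cases "weight \<gamma> H x = 0")
  case False
  then have w: "0 < weight \<gamma> H x" using weight_nonneg[of \<gamma> H x] by simp
  have nc: "x \<notin> center H ` indices H"
  proof
    assume "x \<in> center H ` indices H"
    then have "infdist x (center H ` indices H) = 0" by (rule infdist_zero)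
    with False show False by (simp add: weight_def)
  qed
  obtain i where i: "i \<in> indices H" "x \<in> subcube H H i" using subcubes_cover[OF H x] .
  let ?c = "(sqrt (real CARD('n)) / 2) powr (real CARD('n) - 2 + \<gamma>)"
  have "1 \<le> ?c * weight \<gamma> H x"
    using weight_lower(2)[OF H(2) i nc p] H(2) by simp
  then have "inverse (weight \<gamma> H x) \<le> ?c" using w by (simp add: field_simps)
  then have "sqrt (inverse (weight \<gamma> H x)) \<le> sqrt ?c" by (rule real_sqrt_le_mono)
  then show ?thesis using w by (simp add: real_sqrt_inverse)
qed simp

lemma weight_pos:
  assumes "0 < H" "x \<notin> center H ` indices H" "(indices H :: (nat ^ 'n) set) \<noteq> {}"
  shows "0 < weight \<gamma> H (x :: real ^ 'n)"
proof -
  have "infdist x (center H ` indices H) \<noteq> 0"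
    using in_closed_iff_infdist_zero[OF finite_imp_closed[OF finite_imageI[OF finite_indices]], of "center H" H x]
      assms(2,3) by auto
  then show ?thesis using assms(1) by (simp add: weight_def)
qed

text \<open>Off the centers the weight is bounded below, so \<open>L\<^sup>2\<close> convergence of the fluxes implies that of the
  gradients; the limit gradient is recovered from the limit flux by dividing by the square root of the weight. At the centers, where the
  weight takes the value zero, the quotient is zero by convention; they form a null set.\<close>

lemma energy_pair_limit:
  fixes v :: "real ^ 'n \<Rightarrow> real"
  assumes H: "1 / H \<in> \<nat>" "0 < H" and p: "0 \<le> real CARD('n) - 2 + \<gamma>"
    and pr: "\<And>n. energy_pair \<gamma> H (vs n) (gs n)" and v: "L2lim vs v" and G: "L2lim (\<lambda>n. flux \<gamma> H (gs n)) G"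
  obtains g where "energy_pair \<gamma> H v g" "AE x in lebesgue_on \<Omega>. flux \<gamma> H g x = G x"
proof -
  define b where "b x = inverse (sqrt (weight \<gamma> H x))" for x :: "real ^ 'n"
  have bm: "b \<in> borel_measurable (lebesgue_on \<Omega>)"
    unfolding b_def[abs_def] by (rule borel_measurable_inverse[OF sqrt_weight_measurable])
  note lim = L2lim_bounded_mult[OF G bm inverse_weight_bounded[OF H p, folded b_def]]
  define g where "g x = b x *\<^sub>R G x" for x
  have pos: "0 < weight \<gamma> H x" if "x \<notin> center H ` indices H" for x :: "real ^ 'n"
    using H that indices_nonempty by (intro weight_pos)
  have "H10_grad v g"
  proof (rule H10_grad_limit[OF _ v])
    show "L2lim (\<lambda>n x. b x *\<^sub>R flux \<gamma> H (gs n) x) g" unfolding g_def[abs_def] by (rule lim)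
    show "H10_grad (vs n) (\<lambda>x. b x *\<^sub>R flux \<gamma> H (gs n) x)" for n
    proof (rule H10_grad_AE_cong[OF energy_pairD(1)[OF pr]])
      show "(\<lambda>x. b x *\<^sub>R flux \<gamma> H (gs n) x) \<in> L2" by (rule L2lim_mem(2)[OF lim])
      show "AE x in lebesgue_on \<Omega>. gs n x = b x *\<^sub>R flux \<gamma> H (gs n) x"
        using AE_not_center[of H]
        by eventually_elim (use pos in \<open>simp add: b_def flux_def less_imp_neq[symmetric]\<close>)
    qed
  qed
  moreover have ae: "AE x in lebesgue_on \<Omega>. G x = flux \<gamma> H g x"
    using AE_not_center[of H]
    by eventually_elim (use pos in \<open>simp add: b_def g_def flux_def less_imp_neq[symmetric]\<close>)
  moreover have "flux \<gamma> H g \<in> L2"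
    by (rule L2_AE_cong[OF L2lim_mem(1)[OF G] flux_measurable[OF L2_measurable[OF L2lim_mem(1)[OF lim, folded g_def]]] ae])
  ultimately have "energy_pair \<gamma> H v g" by (simp add: energy_pair_def)
  moreover have "AE x in lebesgue_on \<Omega>. flux \<gamma> H g x = G x"
    using ae by eventually_elim (rule sym)
  ultimately show ?thesis by (rule that)
qed

lemma L2_inner_measurement:
  fixes v :: "real ^ 'n \<Rightarrow> real"
  shows "L2_inner v (measurement h H j) = ip (indicator (subcube h H j)) v / h ^ CARD('n)"
  unfolding L2_inner_def measurement_def ip_def
  by (simp add: mult.commute)

text \<open>A competitor of finite energy for the constrained minimization. A bump in the middle of the cube
  would meet the singularity of the weight, so it is placed off center: all coordinates lie between \<open>h / 8\<close> and
  \<open>3 * h / 8\<close> from those of the center. There the weight is bounded, and only the measurement of this one cube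
  sees the bump.\<close>

lemma dual_bump_exists:
  fixes i :: "nat ^ 'n"
  assumes H: "1 / H \<in> \<nat>" "0 < H" and h: "0 < h" "h \<le> H" and i: "i \<in> indices H"
  obtains v g where "energy_pair \<gamma> H v g"
    "\<And>j. j \<in> indices H \<Longrightarrow> L2_inner v (measurement h H j) = (if i = j then 1 else 0)"
proof -
  let ?c = "center H i"
  let ?a = "?c + (\<chi> k. h / 8)" and ?b = "?c + (\<chi> k. 3 * h / 8)"
  let ?K = "cbox ?a ?b"
  define \<phi> where "\<phi> = bump 1 ?a ?b"
  have K: "h / 8 \<le> x $ k - ?c $ k \<and> x $ k - ?c $ k \<le> 3 * h / 8" if "x \<in> ?K" for x k
  proof -
    have "?a $ k \<le> x $ k \<and> x $ k \<le> ?b $ k" using that by (simp only: mem_box_cart)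
    then show ?thesis unfolding vector_add_component vec_lambda_beta by linarith
  qed
  have near: "\<bar>x $ k - ?c $ k\<bar> < H / 2" if "x \<in> ?K" for x k
    using K[OF that, of k] h by linarith
  have Kh: "?K \<subseteq> subcube h H i"
  proof
    fix x assume "x \<in> ?K"
    have "\<bar>x $ k - ?c $ k\<bar> \<le> h / 2" for k using K[OF \<open>x \<in> ?K\<close>, of k] h by linarith
    then show "x \<in> subcube h H i" by (simp add: mem_subcube)
  qed
  have "?K \<subseteq> box 0 1"
  proof
    fix x assume x: "x \<in> ?K"
    have "?c - (\<chi> k. H / 2) \<in> subcube H H i" "?c + (\<chi> k. H / 2) \<in> subcube H H i"
      using H(2) by (auto simp: mem_subcube)
    then have "?c - (\<chi> k. H / 2) \<in> \<Omega>" "?c + (\<chi> k. H / 2) \<in> \<Omega>"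
      using subcube_subset_Omega[OF H i] by blast+
    then have "0 \<le> ?c $ k - H / 2 \<and> ?c $ k + H / 2 \<le> 1" for k
      by (simp add: Omega_def mem_box_cart)
    then have "0 < x $ k \<and> x $ k < 1" for k
      using near[OF x, of k] by (smt (verit))
    then show "x \<in> box 0 1" by (simp add: mem_box_cart)
  qed
  then have test: "\<phi> \<in> test_functions" unfolding \<phi>_def by (intro bump_test_function) auto
  have \<phi>0: "\<phi> x = 0" if "x \<notin> ?K" for x
    using that box_subset_cbox[of ?a ?b] unfolding \<phi>_def by (subst bump_zero) auto
  have grad0: "grad \<phi> x = 0" if "x \<notin> ?K" for x
    by (rule grad_zero_on_open[of "- ?K"]) (use that \<phi>0 in \<open>auto simp: open_Compl\<close>)
  have nc: "x \<notin> center H ` indices H" if x: "x \<in> ?K" for x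
  proof
    assume "x \<in> center H ` indices H"
    then obtain j where j: "x = center H j" by blast
    have "x \<in> subcube H H j" using H(2) by (simp add: j mem_subcube)
    then have "j = i" by (intro subcube_unique[OF H(2) near[OF x]])
    then show False using K[OF x] h(1) j by simp
  qed
  have "continuous_on ?K (weight \<gamma> H)"
  proof -
    have "infdist x (center H ` indices H) \<noteq> 0" if "x \<in> ?K" for x
      using in_closed_iff_infdist_zero[OF finite_imp_closed[OF finite_imageI[OF finite_indices]], of "center H" H x]
        nc[OF that] indices_nonempty[OF H] by auto
    then show ?thesis
      unfolding weight_def[abs_def] using H(2)
      by (intro continuous_on_powr continuous_on_divide continuous_on_infdist continuous_intros) auto
  qed
  then have "compact (weight \<gamma> H ` ?K)" by (rule compact_continuous_image) simp
  from compact_imp_bounded[OF this] obtain W where "\<forall>y\<in>weight \<gamma> H ` ?K. norm y \<le> W"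
    unfolding bounded_iff by blast
  then have W: "\<bar>weight \<gamma> H x\<bar> \<le> W" if "x \<in> ?K" for x using that by auto
  obtain B where B: "B \<ge> 0" "\<And>x. norm (\<phi> x) \<le> B" "\<And>x. norm (grad \<phi> x) \<le> B"
  proof (rule test_bounded[OF test])
    fix B assume "0 \<le> B" "\<And>x. norm (\<phi> x) \<le> B" "\<And>x. norm (grad \<phi> x) \<le> B"
    then show thesis by (rule that)
  qed
  have "flux \<gamma> H (grad \<phi>) \<in> L2"
  proof (rule L2_bounded)
    show "flux \<gamma> H (grad \<phi>) \<in> borel_measurable (lebesgue_on \<Omega>)"
      by (rule flux_measurable[OF L2_measurable[OF test_grad_L2[OF test]]])
    show "norm (flux \<gamma> H (grad \<phi>) x) \<le> sqrt \<bar>W\<bar> * B" for x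
    proof (cases "x \<in> ?K")
      case True
      have "sqrt (weight \<gamma> H x) \<le> sqrt \<bar>W\<bar>" using W[OF True] by simp
      then show ?thesis unfolding flux_def norm_scaleR
        using B weight_nonneg[of \<gamma> H x] by (intro mult_mono) auto
    qed (use B in \<open>simp add: flux_def grad0\<close>)
  qed
  then have pair: "energy_pair \<gamma> H \<phi> (grad \<phi>)"
    using H10_grad_test[OF test] by (simp add: energy_pair_def)
  define I where "I = ip (indicator (subcube h H i)) \<phi>"
  have I_eq: "I = (LINT x|lborel. \<phi> x)"
  proof -
    have "I = (LINT x|lebesgue_on \<Omega>. \<phi> x)"
      unfolding I_def ip_def using \<phi>0 Kh
      by (intro Bochner_Integration.integral_cong) (auto simp: indicator_def)
    also have "\<dots> = (LINT x|lborel. \<phi> x)"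
      using test_zero_Omega[OF test] test_continuous[OF test]
      by (intro integral_Omega_lborel borel_measurable_continuous_onI) auto
    finally show ?thesis .
  qed
  have "I \<noteq> 0"
  proof
    assume "I = 0"
    have int: "integrable lborel \<phi>"
    proof -
      have "integrable lborel (\<lambda>x. indicator ?K x *\<^sub>R \<phi> x)"
        by (rule borel_integrable_compact) (use test_continuous[OF test] in \<open>auto intro: continuous_on_subset\<close>)
      also have "(\<lambda>x. indicator ?K x *\<^sub>R \<phi> x) = \<phi>" using \<phi>0 by (auto simp: indicator_def fun_eq_iff)
      finally show ?thesis .
    qed
    have nn: "AE x in lborel. 0 \<le> \<phi> x" unfolding \<phi>_def by (intro AE_I2 bump_le_1(1))
    have "AE x in lborel. \<phi> x = 0"
      using integral_nonneg_eq_0_iff_AE[OF int nn] \<open>I = 0\<close> I_eq by simp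
    then have "AE x in lborel. x \<notin> box ?a ?b"
      by eventually_elim (use bump_pos[of 1 _ ?a ?b] in \<open>force simp: \<phi>_def\<close>)
    then have "emeasure lborel (box ?a ?b) = 0"
      by (subst (asm) AE_iff_measurable[OF _ refl]) auto
    then have "negligible (box ?a ?b)"
      by (simp add: negligible_iff_emeasure0)
    then have "box ?a ?b = {}" using open_not_negligible[OF open_box] by blast
    moreover have "?c + (\<chi> k. h / 4) \<in> box ?a ?b" using h(1) by (simp add: mem_box_cart)
    ultimately show False by blast
  qed
  have other: "ip (indicator (subcube h H j)) \<phi> = 0" if "j \<noteq> i" for j
  proof -
    have "indicator (subcube h H j) x \<bullet> \<phi> x = 0" for x
    proof (cases "x \<in> ?K")
      case True
      have "x \<notin> subcube h H j"
        using subcube_unique[OF H(2) near[OF True], of j] subcube_mono[OF h(2), of H j] that by blast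
      then show ?thesis by simp
    qed (simp add: \<phi>0)
    then show ?thesis by (simp only: ip_def integral_zero)
  qed
  show ?thesis
  proof (rule that)
    show "energy_pair \<gamma> H (\<lambda>x. (h ^ CARD('n) / I) *\<^sub>R \<phi> x) (\<lambda>x. (h ^ CARD('n) / I) *\<^sub>R grad \<phi> x)"
      using pair by (rule energy_pair_scale)
    show "L2_inner (\<lambda>x. (h ^ CARD('n) / I) *\<^sub>R \<phi> x) (measurement h H j) = (if i = j then 1 else 0)" for j
      unfolding L2_inner_measurement ip_scale_right
      using other[of j] \<open>I \<noteq> 0\<close> h(1) by (auto simp: I_def)
  qed
qed

section \<open>The basis functions\<close>

lemma ip_parallelogram:
  assumes "f \<in> L2" "g \<in> L2"
  shows "sqnorm (\<lambda>x. f x - g x)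
    = 2 * sqnorm f + 2 * sqnorm g - 4 * sqnorm (\<lambda>x. (1/2) *\<^sub>R (f x + g x))"
proof -
  have "sqnorm (\<lambda>x. f x - g x) = sqnorm f - 2 * ip f g + sqnorm g"
    using ip_expand[OF assms, of "-1"] by simp
  moreover have "sqnorm (\<lambda>x. f x + g x) = sqnorm f + 2 * ip f g + sqnorm g"
    using ip_expand[OF assms, of 1] by simp
  ultimately show ?thesis
    unfolding ip_scale_left ip_scale_right by linarith
qed

lemma L2_inner_measurement_linear:
  fixes v w :: "real ^ 'n \<Rightarrow> real"
  assumes "v \<in> L2" "w \<in> L2"
  shows "L2_inner (\<lambda>x. v x + w x) (measurement h H j) = L2_inner v (measurement h H j) + L2_inner w (measurement h H j)"
    "L2_inner (\<lambda>x. v x - w x) (measurement h H j) = L2_inner v (measurement h H j) - L2_inner w (measurement h H j)"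
  unfolding L2_inner_measurement
    ip_add_right[OF assms indicator_L2(2)[OF subcube_sets]]
    ip_diff_right[OF assms indicator_L2(2)[OF subcube_sets]]
  by (simp_all add: add_divide_distrib diff_divide_distrib)

lemma L2_inner_measurement_scale:
  fixes v :: "real ^ 'n \<Rightarrow> real"
  shows "L2_inner (\<lambda>x. c *\<^sub>R v x) (measurement h H j) = c * L2_inner v (measurement h H j)"
  unfolding L2_inner_measurement ip_scale_right by simp

lemma weighted_Poincare_pair:
  fixes v :: "real ^ 'n \<Rightarrow> real"
  assumes "energy_pair \<gamma> H v g" "1 / H \<in> \<nat>" "0 < H" "0 \<le> real CARD('n) - 2 + \<gamma>" "0 < \<gamma>" "0 < h" "h \<le> H"
    and "\<And>j. j \<in> indices H \<Longrightarrow> L2_inner v (measurement h H j) = 0"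
  shows "sqnorm v \<le> Poincare_constant CARD('n) \<gamma> * H\<^sup>2 * sqnorm (flux \<gamma> H g)"
  using assms(8) assms(6)
  by (intro weighted_Poincare[OF energy_pairD(1,2)[OF assms(1)] assms(2-7)])
    (simp add: L2_inner_measurement)

text \<open>The direct method. By the parallelogram identity a minimizing sequence is Cauchy in energy. Differences of
  competitors have zero measurements, so the weighted Poincare inequality makes the sequence Cauchy in \<open>L\<^sup>2\<close> as
  well, and the limit is an admissible minimizer.\<close>

lemma energy_minimizer_exists:
  fixes i :: "nat ^ 'n"
  assumes H: "1 / H \<in> \<nat>" "0 < H" and p: "0 \<le> real CARD('n) - 2 + \<gamma>" and \<gamma>: "0 < \<gamma>"
    and h: "0 < h" "h \<le> H" and i: "i \<in> indices H"
  obtains v g where "energy_pair \<gamma> H v g"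
    "\<And>j. j \<in> indices H \<Longrightarrow> L2_inner v (measurement h H j) = (if i = j then 1 else 0)"
    "\<And>w k. energy_pair \<gamma> H w k \<Longrightarrow>
      (\<And>j. j \<in> indices H \<Longrightarrow> L2_inner w (measurement h H j) = (if i = j then 1 else 0)) \<Longrightarrow>
      sqnorm (flux \<gamma> H g) \<le> sqnorm (flux \<gamma> H k)"
proof -
  define K where "K = {(v :: real ^ 'n \<Rightarrow> real, g). energy_pair \<gamma> H v g \<and>
    (\<forall>j\<in>indices H. L2_inner v (measurement h H j) = (if i = j then 1 else 0))}"
  define e where "e = (\<lambda>(v :: real ^ 'n \<Rightarrow> real, g :: real ^ 'n \<Rightarrow> real ^ 'n). sqnorm (flux \<gamma> H g))"
  define m where "m = Inf (e ` K)"
  have "K \<noteq> {}"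
  proof (rule dual_bump_exists[OF H h i, of \<gamma>])
    fix v g assume "energy_pair \<gamma> H v g"
      "\<And>j. j \<in> indices H \<Longrightarrow> L2_inner v (measurement h H j) = (if i = j then 1 else 0)"
    then have "(v, g) \<in> K" by (simp add: K_def)
    then show ?thesis by blast
  qed
  have e0: "0 \<le> e z" for z by (auto simp: e_def ip_self_nonneg split: prod.split)
  have bdd: "bdd_below (e ` K)" using e0 by (intro bdd_belowI[of _ 0]) auto
  have m_le: "m \<le> e z" if "z \<in> K" for z unfolding m_def using that bdd by (intro cInf_lower) auto
  have "\<exists>z\<in>K. e z < m + (1/4) ^ n" for n :: nat
  proof -
    have "m < m + (1/4) ^ n" by simp
    then show ?thesis
      unfolding m_def using \<open>K \<noteq> {}\<close> bdd by (subst (asm) cInf_less_iff) auto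
  qed
  then have "\<forall>n :: nat. \<exists>z. z \<in> K \<and> e z < m + (1/4) ^ n" by blast
  from choice[OF this] obtain z where z: "\<And>n. z n \<in> K" "\<And>n :: nat. e (z n) < m + (1/4) ^ n" by blast
  define vs where "vs n = fst (z n)" for n
  define gs where "gs n = snd (z n)" for n
  have zn: "z n = (vs n, gs n)" for n by (simp add: vs_def gs_def)
  have pair: "energy_pair \<gamma> H (vs n) (gs n)"
    and meas: "\<And>j. j \<in> indices H \<Longrightarrow> L2_inner (vs n) (measurement h H j) = (if i = j then 1 else 0)" for n
    using z(1)[of n] by (auto simp: K_def zn)
  have en: "sqnorm (flux \<gamma> H (gs n)) < m + (1/4) ^ n" for n
    using z(2)[of n] by (simp add: e_def zn)
  note fL2 = energy_pairD(2)[OF pair] and vL2 = energy_pairD(3)[OF pair]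
  have cauchy: "sqnorm (\<lambda>x. flux \<gamma> H (gs l) x - flux \<gamma> H (gs n) x)
      \<le> 4 * (1/4) ^ n" if "n \<le> l" for n l
  proof -
    have "(\<lambda>x. (1/2) *\<^sub>R (vs l x + vs n x), \<lambda>x. (1/2) *\<^sub>R (gs l x + gs n x)) \<in> K"
      unfolding K_def mem_Collect_eq case_prod_conv
    proof (intro conjI ballI energy_pair_scale energy_pair_add pair)
      show "L2_inner (\<lambda>x. (1/2) *\<^sub>R (vs l x + vs n x)) (measurement h H j) = (if i = j then 1 else 0)"
        if "j \<in> indices H" for j
        unfolding L2_inner_measurement_scale L2_inner_measurement_linear(1)[OF vL2 vL2] meas[OF that] by simp
    qed
    from m_le[OF this] have "m \<le> sqnorm (\<lambda>x. (1/2) *\<^sub>R (flux \<gamma> H (gs l) x + flux \<gamma> H (gs n) x))"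
      by (simp add: e_def flux_scale flux_add)
    moreover have "(1/4 :: real) ^ l \<le> (1/4) ^ n" using that by (intro power_decreasing) auto
    ultimately show ?thesis
      using en[of l] en[of n] unfolding ip_parallelogram[OF fL2 fL2] by linarith
  qed
  obtain G where G: "L2lim (\<lambda>n. flux \<gamma> H (gs n)) G"
    using L2_complete_rapid[OF fL2 cauchy] by blast
  have "sqnorm (\<lambda>x. vs l x - vs n x) \<le> (Poincare_constant CARD('n) \<gamma> * H\<^sup>2 * 4) * (1/4) ^ n"
    if "n \<le> l" for n l
  proof -
    have "sqnorm (\<lambda>x. vs l x - vs n x)
      \<le> Poincare_constant CARD('n) \<gamma> * H\<^sup>2 * sqnorm (flux \<gamma> H (\<lambda>x. gs l x - gs n x))"
      by (rule weighted_Poincare_pair[OF energy_pair_diff[OF pair pair] H p \<gamma> h])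
        (simp add: L2_inner_measurement_linear vL2 meas)
    also have "\<dots> \<le> Poincare_constant CARD('n) \<gamma> * H\<^sup>2 * (4 * (1/4) ^ n)"
      unfolding flux_diff by (intro mult_left_mono cauchy that mult_nonneg_nonneg Poincare_constant_nonneg) simp
    finally show ?thesis by (simp only: mult.assoc)
  qed
  from L2_complete_rapid[OF vL2 this] obtain v where v: "L2lim vs v" by blast
  obtain g where g: "energy_pair \<gamma> H v g" "AE x in lebesgue_on \<Omega>. flux \<gamma> H g x = G x"
    by (rule energy_pair_limit[OF H p pair v G])
  show ?thesis
  proof (rule that[OF g(1)])
    show "L2_inner v (measurement h H j) = (if i = j then 1 else 0)" if j: "j \<in> indices H" for j
    proof (rule LIMSEQ_unique)
      show "(\<lambda>n. L2_inner (vs n) (measurement h H j)) \<longlonglongrightarrow> L2_inner v (measurement h H j)"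
        unfolding L2_inner_measurement divide_inverse
        by (intro tendsto_mult tendsto_const L2lim_ip[OF L2lim_const[OF indicator_L2(2)[OF subcube_sets]] v])
      show "(\<lambda>n. L2_inner (vs n) (measurement h H j)) \<longlonglongrightarrow> (if i = j then 1 else 0)"
        unfolding meas[OF j] by (rule tendsto_const)
    qed
    fix w k assume w: "energy_pair \<gamma> H w k"
      "\<And>j. j \<in> indices H \<Longrightarrow> L2_inner w (measurement h H j) = (if i = j then 1 else 0)"
    have "(\<lambda>n. sqnorm (flux \<gamma> H (gs n))) \<longlonglongrightarrow> sqnorm G"
      by (rule L2lim_ip[OF G G])
    moreover have "(\<lambda>n. m + (1/4) ^ n) \<longlonglongrightarrow> m + 0"
      by (intro tendsto_add tendsto_const LIMSEQ_power_zero) simp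
    ultimately have "sqnorm G \<le> m + 0"
      by (rule LIMSEQ_le) (use en in \<open>auto intro: less_imp_le\<close>)
    moreover have "sqnorm (flux \<gamma> H g) = sqnorm G"
      using energy_pairD(2)[OF g(1)] L2lim_mem(1)[OF G] g(2) by (intro ip_AE_cong)
    moreover have "m \<le> sqnorm (flux \<gamma> H k)"
      using m_le[of "(w, k)"] w by (simp add: K_def e_def)
    ultimately show "sqnorm (flux \<gamma> H g) \<le> sqnorm (flux \<gamma> H k)" by linarith
  qed
qed

text \<open>The basis function is an arbitrary minimizer, taken over all of \<^const>\<open>H10\<close> with energies that may be
  infinite. As a minimizer of finite energy exists, the chosen one has finite energy too. Perturbing it by multiples of a
  function with zero measurements keeps it admissible, and minimality gives the orthogonality.\<close>

lemma basis_function_properties: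
  fixes i :: "nat ^ 'n"
  assumes H: "1 / H \<in> \<nat>" "0 < H" and p: "0 \<le> real CARD('n) - 2 + \<gamma>" and \<gamma>: "0 < \<gamma>"
    and h: "0 < h" "h \<le> H" and i: "i \<in> indices H"
  defines "\<psi> \<equiv> basis_function (weight \<gamma> H) h H i"
  shows "energy_pair \<gamma> H \<psi> (weak_grad \<psi>)"
    and "\<And>j. j \<in> indices H \<Longrightarrow> L2_inner \<psi> (measurement h H j) = (if i = j then 1 else 0)"
    and "\<And>w k. energy_pair \<gamma> H w k \<Longrightarrow>
      (\<And>j. j \<in> indices H \<Longrightarrow> L2_inner w (measurement h H j) = 0) \<Longrightarrow>
      ip (flux \<gamma> H (weak_grad \<psi>)) (flux \<gamma> H k) = 0"
proof -
  define P where "P \<psi> \<longleftrightarrow> \<psi> \<in> H10 \<and>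
    (\<forall>j\<in>indices H. L2_inner \<psi> (measurement h H j) = (if i = j then 1 else 0))" for \<psi> :: "real ^ 'n \<Rightarrow> real"
  define F where "F \<psi> = (energy_norm (weight \<gamma> H) \<psi>)\<^sup>2" for \<psi> :: "real ^ 'n \<Rightarrow> real"
  have F_pair: "F v = ennreal (sqnorm (flux \<gamma> H g))" if "energy_pair \<gamma> H v g" for v g
    unfolding F_def energy_pair_energy_norm(3)[OF that]
    by (simp add: ennreal_power ip_self_nonneg)
  have pair: "energy_pair \<gamma> H v (weak_grad v)" if "P v" "F v < \<infinity>" for v
  proof (rule energy_pair_weak_grad)
    show "v \<in> H10" using that by (simp add: P_def)
    show "energy_norm (weight \<gamma> H) v < \<infinity>"
      using that(2) by (auto simp: F_def power2_eq_square ennreal_mult_less_top less_top)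
  qed
  obtain v g where v: "energy_pair \<gamma> H v g"
    "\<And>j. j \<in> indices H \<Longrightarrow> L2_inner v (measurement h H j) = (if i = j then 1 else 0)"
    and min: "\<And>w k. energy_pair \<gamma> H w k \<Longrightarrow>
      (\<And>j. j \<in> indices H \<Longrightarrow> L2_inner w (measurement h H j) = (if i = j then 1 else 0)) \<Longrightarrow>
      sqnorm (flux \<gamma> H g) \<le> sqnorm (flux \<gamma> H k)"
  proof (rule energy_minimizer_exists[OF H p \<gamma> h i])
    fix v g
    assume *: "energy_pair \<gamma> H v g"
      "\<And>j. j \<in> indices H \<Longrightarrow> L2_inner v (measurement h H j) = (if i = j then 1 else 0)"
      "\<And>w k. energy_pair \<gamma> H w k \<Longrightarrow>
        (\<And>j. j \<in> indices H \<Longrightarrow> L2_inner w (measurement h H j) = (if i = j then 1 else 0)) \<Longrightarrow>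
        sqnorm (flux \<gamma> H g) \<le> sqnorm (flux \<gamma> H k)"
    show thesis by (rule that[OF *])
  qed
  have Pv: "P v" using v energy_pair_energy_norm(1)[OF v(1)] by (simp add: P_def)
  have v_min: "F v \<le> F w" if "P w" for w
  proof (cases "F w < \<infinity>")
    case True
    have "sqnorm (flux \<gamma> H g) \<le> sqnorm (flux \<gamma> H (weak_grad w))"
      by (rule min[OF pair[OF that True]]) (use that in \<open>simp add: P_def\<close>)
    then show ?thesis
      unfolding F_pair[OF v(1)] F_pair[OF pair[OF that True]] by (rule ennreal_leI)
  next
    case False
    then show ?thesis by (simp add: not_less top_unique)
  qed
  have "is_arg_min F P v"
    unfolding is_arg_min_def using Pv v_min by (blast dest: leD)
  then have "is_arg_min F P (arg_min F P)"
    unfolding arg_min_def by (rule someI[of "is_arg_min F P"])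
  moreover have "\<psi> = arg_min F P"
    unfolding \<psi>_def basis_function_def F_def[abs_def] P_def[abs_def] ..
  ultimately have "is_arg_min F P \<psi>" by (simp only:)
  then have arg: "P \<psi> \<and> \<not> (\<exists>y. P y \<and> F y < F \<psi>)"
    unfolding is_arg_min_def .
  then have P\<psi>: "P \<psi>" ..
  have \<psi>_min: "F \<psi> \<le> F w" if "P w" for w
    using arg that by (intro leI) blast
  have "F \<psi> < \<infinity>"
    using \<psi>_min[OF Pv] F_pair[OF v(1)] by (simp add: order_le_less_trans)
  with P\<psi> show \<psi>_pair: "energy_pair \<gamma> H \<psi> (weak_grad \<psi>)" by (rule pair)
  show \<psi>_meas: "L2_inner \<psi> (measurement h H j) = (if i = j then 1 else 0)" if "j \<in> indices H" for j
    using P\<psi> that by (simp add: P_def)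
  fix w :: "real ^ 'n \<Rightarrow> real" and k
  assume w: "energy_pair \<gamma> H w k" "\<And>j. j \<in> indices H \<Longrightarrow> L2_inner w (measurement h H j) = 0"
  let ?S = "flux \<gamma> H (weak_grad \<psi>)" and ?T = "flux \<gamma> H k"
  note SL2 = energy_pairD(2)[OF \<psi>_pair] and TL2 = energy_pairD(2)[OF w(1)]
  have "0 \<le> 0 + 2 * t * ip ?S ?T + t\<^sup>2 * sqnorm ?T" for t
  proof -
    have pr: "energy_pair \<gamma> H (\<lambda>x. \<psi> x + t *\<^sub>R w x) (\<lambda>x. weak_grad \<psi> x + t *\<^sub>R k x)"
      by (intro energy_pair_add energy_pair_scale \<psi>_pair w(1))
    have "P (\<lambda>x. \<psi> x + t *\<^sub>R w x)"
      unfolding P_def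
    proof (intro conjI ballI)
      show "(\<lambda>x. \<psi> x + t *\<^sub>R w x) \<in> H10" by (rule energy_pair_energy_norm(1)[OF pr])
      show "L2_inner (\<lambda>x. \<psi> x + t *\<^sub>R w x) (measurement h H j) = (if i = j then 1 else 0)" if "j \<in> indices H" for j
        unfolding L2_inner_measurement_linear(1)[OF energy_pairD(3)[OF \<psi>_pair] L2_scale[OF energy_pairD(3)[OF w(1)]]]
          L2_inner_measurement_scale
        using \<psi>_meas[OF that] w(2)[OF that] by simp
    qed
    from \<psi>_min[OF this] have "sqnorm ?S \<le> sqnorm (\<lambda>x. ?S x + t *\<^sub>R ?T x)"
      unfolding F_pair[OF \<psi>_pair] F_pair[OF pr] flux_add flux_scale by (simp add: ip_self_nonneg)
    then show ?thesis unfolding ip_expand[OF SL2 TL2] by simp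
  qed
  from quadratic_nonneg_imp_discriminant[OF this ip_self_nonneg]
  show "ip ?S ?T = 0" by simp
qed

section \<open>The error estimates\<close>

text \<open>The error \<open>w\<close> has zero measurements, so by minimality of the basis functions it is orthogonal in energy to
  the ideal solution. Hence its energy is its energy product with \<open>u\<close> and is at most the energy of \<open>u\<close>, while
  its \<open>L\<^sup>2\<close> norm is controlled by the weighted Poincare inequality.\<close>

lemma ideal_solution_decomposition:
  fixes u :: "real ^ 'n \<Rightarrow> real"
  assumes H: "1 / H \<in> \<nat>" "0 < H" and p: "0 \<le> real CARD('n) - 2 + \<gamma>" and \<gamma>: "0 < \<gamma>"
    and h: "0 < h" "h \<le> H" and u: "energy_pair \<gamma> H u g"
  defines "w \<equiv> \<lambda>x. u x - ideal_solution (weight \<gamma> H) h H u x"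
  obtains k where "energy_pair \<gamma> H w k"
    "sqnorm (flux \<gamma> H k) = ip (flux \<gamma> H g) (flux \<gamma> H k)"
    "sqnorm (flux \<gamma> H k) \<le> sqnorm (flux \<gamma> H g)"
    "sqnorm w \<le> Poincare_constant CARD('n) \<gamma> * H\<^sup>2 * sqnorm (flux \<gamma> H k)"
proof -
  define \<psi> where "\<psi> i = basis_function (weight \<gamma> H) h H i" for i :: "nat ^ 'n"
  define c where "c i = L2_inner u (measurement h H i)" for i
  note bas = basis_function_properties[OF H p \<gamma> h, folded \<psi>_def]
  define r where "r x = (\<Sum>i\<in>indices H. c i *\<^sub>R weak_grad (\<psi> i) x)" for x
  define k where "k x = g x - r x" for x
  have P_eq: "ideal_solution (weight \<gamma> H) h H u = (\<lambda>x. \<Sum>i\<in>indices H. c i *\<^sub>R \<psi> i x)"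
    by (simp add: ideal_solution_def \<psi>_def c_def)
  have Pp: "energy_pair \<gamma> H (\<lambda>x. \<Sum>i\<in>indices H. c i *\<^sub>R \<psi> i x) r"
    unfolding r_def[abs_def] by (intro energy_pair_sum finite_indices energy_pair_scale bas(1))
  have wk: "energy_pair \<gamma> H w k"
    unfolding w_def k_def[abs_def] P_eq by (rule energy_pair_diff[OF u Pp])
  have zero: "L2_inner w (measurement h H j) = 0" if j: "j \<in> indices H" for j
  proof -
    have \<psi>L2: "\<psi> i \<in> L2" if "i \<in> indices H" for i
      by (rule energy_pairD(3)[OF bas(1)[OF that]])
    have "L2_inner (\<lambda>x. \<Sum>i\<in>I. c i *\<^sub>R \<psi> i x) (measurement h H j)
        = (\<Sum>i\<in>I. c i * L2_inner (\<psi> i) (measurement h H j))" if "finite I" "I \<subseteq> indices H" for I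
      using that
    proof (induction I rule: finite_induct)
      case empty
      then show ?case by (simp add: L2_inner_def)
    next
      case (insert i I)
      have "energy_pair \<gamma> H (\<lambda>x. \<Sum>i\<in>I. c i *\<^sub>R \<psi> i x) (\<lambda>x. \<Sum>i\<in>I. c i *\<^sub>R weak_grad (\<psi> i) x)"
        using insert by (intro energy_pair_sum energy_pair_scale bas(1)) auto
      then have "(\<lambda>x. \<Sum>i\<in>I. c i *\<^sub>R \<psi> i x) \<in> L2" by (rule energy_pairD(3))
      moreover have "(\<lambda>x. c i *\<^sub>R \<psi> i x) \<in> L2" using insert by (intro L2_scale \<psi>L2) auto
      ultimately have "L2_inner (\<lambda>x. c i *\<^sub>R \<psi> i x + (\<Sum>i\<in>I. c i *\<^sub>R \<psi> i x)) (measurement h H j)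
        = c i * L2_inner (\<psi> i) (measurement h H j) + (\<Sum>i\<in>I. c i * L2_inner (\<psi> i) (measurement h H j))"
        using insert by (simp only: L2_inner_measurement_linear L2_inner_measurement_scale insert_subset simp_thms)
      then show ?case using insert(1,2) by simp
    qed
    from this[OF finite_indices order_refl]
    have "L2_inner (\<lambda>x. \<Sum>i\<in>indices H. c i *\<^sub>R \<psi> i x) (measurement h H j)
        = (\<Sum>i\<in>indices H. c i * L2_inner (\<psi> i) (measurement h H j))" .
    also have "\<dots> = (\<Sum>i\<in>indices H. if i = j then c i else 0)"
    proof (rule sum.cong[OF refl])
      fix i :: "nat ^ 'n" assume "i \<in> indices H"
      from bas(2)[OF this j] show "c i * L2_inner (\<psi> i) (measurement h H j) = (if i = j then c i else 0)" by simp
    qed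
    also have "\<dots> = c j" using sum.delta[OF finite_indices[of H], of j c] j by simp
    finally show ?thesis
      unfolding w_def P_eq L2_inner_measurement_linear(2)[OF energy_pairD(3)[OF u] energy_pairD(3)[OF Pp]]
      by (simp add: c_def)
  qed
  note kL2 = energy_pairD(2)[OF wk] and gL2 = energy_pairD(2)[OF u] and rL2 = energy_pairD(2)[OF Pp]
  have "ip (flux \<gamma> H (\<lambda>x. \<Sum>i\<in>I. c i *\<^sub>R weak_grad (\<psi> i) x)) (flux \<gamma> H k) = 0" if "finite I" "I \<subseteq> indices H" for I
    using that
  proof (induction I rule: finite_induct)
    case empty
    then show ?case by (simp add: ip_def flux_def)
  next
    case (insert i I)
    have pI: "energy_pair \<gamma> H (\<lambda>x. \<Sum>i\<in>I. c i *\<^sub>R \<psi> i x) (\<lambda>x. \<Sum>i\<in>I. c i *\<^sub>R weak_grad (\<psi> i) x)"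
      using insert by (intro energy_pair_sum energy_pair_scale bas(1)) auto
    have i: "i \<in> indices H" using insert by simp
    have "ip (\<lambda>x. c i *\<^sub>R flux \<gamma> H (weak_grad (\<psi> i)) x + flux \<gamma> H (\<lambda>x. \<Sum>i\<in>I. c i *\<^sub>R weak_grad (\<psi> i) x) x) (flux \<gamma> H k)
      = c i * ip (flux \<gamma> H (weak_grad (\<psi> i))) (flux \<gamma> H k) +
        ip (flux \<gamma> H (\<lambda>x. \<Sum>i\<in>I. c i *\<^sub>R weak_grad (\<psi> i) x)) (flux \<gamma> H k)"
      unfolding ip_add_left[OF L2_scale[OF energy_pairD(2)[OF bas(1)[OF i]]] energy_pairD(2)[OF pI] kL2] ip_scale_left ..
    also have "\<dots> = 0" using insert bas(3)[OF i wk zero] by simp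
    finally show ?case
      using insert(1,2) by (simp add: flux_add flux_scale)
  qed
  from this[OF finite_indices order_refl]
  have orth: "ip (flux \<gamma> H r) (flux \<gamma> H k) = 0" unfolding r_def[abs_def] .
  have fk: "flux \<gamma> H k = (\<lambda>x. flux \<gamma> H g x - flux \<gamma> H r x)"
    unfolding k_def[abs_def] by (rule flux_diff)
  have e1: "sqnorm (flux \<gamma> H k) = ip (flux \<gamma> H g) (flux \<gamma> H k)"
    using ip_diff_left[OF gL2 rL2 kL2] orth by (simp flip: fk)
  have "ip (flux \<gamma> H g) (flux \<gamma> H k) = sqnorm (flux \<gamma> H g) - ip (flux \<gamma> H g) (flux \<gamma> H r)"
    unfolding fk by (rule ip_diff_right[OF gL2 rL2 gL2])
  moreover have "ip (flux \<gamma> H r) (flux \<gamma> H k) = ip (flux \<gamma> H r) (flux \<gamma> H g) - sqnorm (flux \<gamma> H r)"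
    unfolding fk by (rule ip_diff_right[OF gL2 rL2 rL2])
  ultimately have e2: "sqnorm (flux \<gamma> H k) \<le> sqnorm (flux \<gamma> H g)"
    using e1 orth ip_self_nonneg[of "flux \<gamma> H r"] ip_commute[of "flux \<gamma> H r" "flux \<gamma> H g"] by linarith
  show ?thesis
    by (rule that[OF wk e1 e2 weighted_Poincare_pair[OF wk H p \<gamma> h zero]])
qed

theorem theorem3p2:
  fixes \<gamma> :: real
  assumes "CARD('n::finite) \<ge> 2" and "\<gamma> > 0"
  shows "\<exists>C>0. \<forall>(H::real) (h::real) (u :: real ^ 'n \<Rightarrow> real).
    1 / H \<in> \<nat> \<and> 0 < h \<and> h \<le> H \<and> u \<in> H10 \<longrightarrow>
      (energy_norm (weight \<gamma> H) u < \<infinity> \<longrightarrow>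
        error0 (weight \<gamma> H) h H u \<le> ennreal (C * H) * energy_norm (weight \<gamma> H) u) \<and>
      (\<forall>f\<in>L2. weak_solution (weight \<gamma> H) f u \<longrightarrow>
        error1 (weight \<gamma> H) h H u \<le> ennreal (C * H) * L2_norm f \<and>
        error0 (weight \<gamma> H) h H u \<le> ennreal (C * H\<^sup>2) * L2_norm f)"
proof -
  \<comment> \<open>The errors are bounded with the square root of \<open>K\<close> or with \<open>K\<close> itself; \<open>K + 1\<close> dominates both.\<close>
  define K where "K = Poincare_constant CARD('n) \<gamma>"
  have K0: "0 \<le> K" unfolding K_def by (rule Poincare_constant_nonneg)
  have p: "0 \<le> real CARD('n) - 2 + \<gamma>" using assms by linarith
  have sqrt_K: "sqrt K \<le> K + 1"
    using K0 by (intro real_le_lsqrt) (auto simp: power2_eq_square algebra_simps)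
  have main: "(energy_norm (weight \<gamma> H) u < \<infinity> \<longrightarrow>
        error0 (weight \<gamma> H) h H u \<le> ennreal ((K + 1) * H) * energy_norm (weight \<gamma> H) u) \<and>
      (\<forall>f\<in>L2. weak_solution (weight \<gamma> H) f u \<longrightarrow>
        error1 (weight \<gamma> H) h H u \<le> ennreal ((K + 1) * H) * L2_norm f \<and>
        error0 (weight \<gamma> H) h H u \<le> ennreal ((K + 1) * H\<^sup>2) * L2_norm f)"
    if H: "1 / H \<in> \<nat>" and h: "0 < h" "h \<le> H" and u: "u \<in> H10" for H h :: real and u :: "real ^ 'n \<Rightarrow> real"
  proof (cases "energy_norm (weight \<gamma> H) u < \<infinity>")
    case False
    then show ?thesis by (simp add: weak_solution_def)
  next
    case True
    have H0: "0 < H" using h by linarith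
    let ?g = "weak_grad u"
    have gu: "energy_pair \<gamma> H u ?g" by (rule energy_pair_weak_grad[OF u True])
    define w where "w = (\<lambda>x. u x - ideal_solution (weight \<gamma> H) h H u x)"
    obtain k where k: "energy_pair \<gamma> H w k"
      "sqnorm (flux \<gamma> H k) = ip (flux \<gamma> H ?g) (flux \<gamma> H k)"
      "sqnorm (flux \<gamma> H k) \<le> sqnorm (flux \<gamma> H ?g)"
      "sqnorm w \<le> K * H\<^sup>2 * sqnorm (flux \<gamma> H k)"
    proof (rule ideal_solution_decomposition[OF H H0 p assms(2) h gu])
      fix k assume *: "energy_pair \<gamma> H (\<lambda>x. u x - ideal_solution (weight \<gamma> H) h H u x) k"
        "sqnorm (flux \<gamma> H k) = ip (flux \<gamma> H ?g) (flux \<gamma> H k)"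
        "sqnorm (flux \<gamma> H k) \<le> sqnorm (flux \<gamma> H ?g)"
        "sqnorm (\<lambda>x. u x - ideal_solution (weight \<gamma> H) h H u x)
          \<le> Poincare_constant CARD('n) \<gamma> * H\<^sup>2 * sqnorm (flux \<gamma> H k)"
      show thesis by (rule that[OF *[folded w_def K_def]])
    qed
    define e where "e = sqrt (sqnorm (flux \<gamma> H k))"
    have e0: "0 \<le> e" by (simp add: e_def ip_self_nonneg)
    have err1: "error1 (weight \<gamma> H) h H u = ennreal e"
      unfolding error1_def w_def[symmetric] e_def by (rule energy_pair_energy_norm(3)[OF k(1)])
    have err0: "error0 (weight \<gamma> H) h H u = ennreal (sqrt (sqnorm w))"
      unfolding error0_def w_def[symmetric] by (rule L2_norm_eq[OF energy_pairD(3)[OF k(1)]])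
    have "sqrt (sqnorm w) \<le> sqrt (K * H\<^sup>2 * sqnorm (flux \<gamma> H k))"
      using k(4) by (rule real_sqrt_le_mono)
    also have "\<dots> = sqrt K * H * e" using H0 by (simp add: real_sqrt_mult e_def)
    finally have w_le: "sqrt (sqnorm w) \<le> sqrt K * H * e" .
    show ?thesis
    proof (intro conjI impI ballI)
      define E where "E = sqrt (sqnorm (flux \<gamma> H ?g))"
      have "e \<le> E" unfolding e_def E_def using k(3) by (rule real_sqrt_le_mono)
      have "sqrt (sqnorm w) \<le> sqrt K * H * e" by (rule w_le)
      also have "\<dots> \<le> (K + 1) * H * E"
        using \<open>e \<le> E\<close> sqrt_K e0 H0 K0 by (intro mult_mono) auto
      finally show "error0 (weight \<gamma> H) h H u \<le> ennreal ((K + 1) * H) * energy_norm (weight \<gamma> H) u"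
        unfolding err0 energy_pair_energy_norm(3)[OF gu] E_def[symmetric]
        using K0 H0 by (simp add: E_def ip_self_nonneg ennreal_leI flip: ennreal_mult)
    next
      fix f :: "real ^ 'n \<Rightarrow> real" assume f: "f \<in> L2" "weak_solution (weight \<gamma> H) f u"
      define F where "F = sqrt (sqnorm f)"
      have F0: "0 \<le> F" by (simp add: F_def ip_self_nonneg)
      have normf: "L2_norm f = ennreal F" unfolding F_def by (rule L2_norm_eq[OF f(1)])
      have w_en: "energy_norm (weight \<gamma> H) w < \<infinity>"
        unfolding energy_pair_energy_norm(3)[OF k(1)] by simp
      \<comment> \<open>The error itself is an admissible test function in the weak formulation.\<close>
      have "(LINT x|lebesgue_on \<Omega>. weight \<gamma> H x * (?g x \<bullet> weak_grad w x)) = L2_inner f w"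
        using f(2) energy_pair_energy_norm(1)[OF k(1)] w_en unfolding weak_solution_def by blast
      also have "L2_inner f w = ip f w" by (simp add: L2_inner_def ip_def)
      also have "(LINT x|lebesgue_on \<Omega>. weight \<gamma> H x * (?g x \<bullet> weak_grad w x))
          = ip (flux \<gamma> H ?g) (flux \<gamma> H (weak_grad w))"
        unfolding ip_def
        by (intro Bochner_Integration.integral_cong)
          (simp_all add: flux_def abs_of_nonneg[OF weight_nonneg] flip: mult.assoc)
      also have "\<dots> = ip (flux \<gamma> H ?g) (flux \<gamma> H k)"
      proof (rule ip_AE_cong[OF energy_pairD(2)[OF gu] energy_pair_energy_norm(2)[OF k(1)]
            energy_pairD(2)[OF gu] energy_pairD(2)[OF k(1)]])
        show "AE x in lebesgue_on \<Omega>. flux \<gamma> H (weak_grad w) x = flux \<gamma> H k x"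
          by (rule flux_AE_cong[OF H10_gradD(2)[OF energy_pairD(1)[OF k(1)]]])
      qed simp
      finally have "sqnorm (flux \<gamma> H k) = ip f w" using k(2) by simp
      also have "\<dots> \<le> F * sqrt (sqnorm w)"
        unfolding F_def using ip_Cauchy_Schwarz_sqrt[OF f(1) energy_pairD(3)[OF k(1)]]
        by (rule order_trans[OF abs_ge_self])
      also have "\<dots> \<le> F * (sqrt K * H * e)" using w_le F0 by (rule mult_left_mono)
      finally have "e * e \<le> (F * (sqrt K * H)) * e"
        by (simp add: e_def ip_self_nonneg mult.assoc)
      then have e_le: "e \<le> sqrt K * H * F"
        using e0 F0 H0 K0 by (cases "e = 0") (auto simp: mult_ac)
      also have "\<dots> \<le> (K + 1) * H * F" using sqrt_K H0 F0 by (intro mult_right_mono) auto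
      finally show "error1 (weight \<gamma> H) h H u \<le> ennreal ((K + 1) * H) * L2_norm f"
        unfolding err1 normf using K0 H0 F0 by (simp add: ennreal_leI flip: ennreal_mult)
      have "sqrt (sqnorm w) \<le> sqrt K * H * (sqrt K * H * F)"
        using w_le mult_left_mono[OF e_le, of "sqrt K * H"] H0 K0 by simp
      also have "\<dots> = (sqrt K * sqrt K) * (H\<^sup>2 * F)" by (simp only: power2_eq_square mult_ac)
      also have "\<dots> \<le> (K + 1) * (H\<^sup>2 * F)" using K0 F0 by (intro mult_right_mono) auto
      finally have "sqrt (sqnorm w) \<le> (K + 1) * H\<^sup>2 * F" by (simp only: mult.assoc)
      then show "error0 (weight \<gamma> H) h H u \<le> ennreal ((K + 1) * H\<^sup>2) * L2_norm f"
        unfolding err0 normf using K0 H0 F0 by (simp add: ennreal_leI flip: ennreal_mult)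
    qed
  qed
  show ?thesis
    by (rule exI[of _ "K + 1"]) (use main K0 in auto)
qed

end
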